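(* Let $M=\bigoplus_{1\le\alpha\le m}M_\alpha$ with $M_\alpha=Mat_{n_\alpha}(\mathbb C)$. Let $p_{\alpha,\beta}\ge0$ be integers, and for $1\le\alpha,\beta\le m$, $1\le i\le p_{\alpha,\beta}$ let $a_{i,\beta,\alpha}$ be $n_\beta\times n_\alpha$ matrices, $b^i_{\alpha,\beta}$ be $n_\alpha\times n_\beta$ matrices and $c_\alpha$ be $n_\alpha\times n_\alpha$ matrices, such that each of the following sets is linearly independent: $\{a_{i,\beta,\alpha}\}_{i}$ and $\{b^i_{\alpha,\beta}\}_i$ for $\alpha\ne\beta$; $\{1,a_{i,\alpha,\alpha}\}_i$ and $\{1,b^i_{\alpha,\alpha}\}_i$. Let $R:M\to M$ be the linear operator whose component $R_{\beta,\alpha}:M_\alpha\to M_\beta$ is $$R_{\beta,\alpha}(x_\alpha)=a_{i,\beta,\alpha}x_\alpha b^i_{\alpha,\beta}\ (\alpha\ne\beta),\qquad R_{\alpha,\alpha}(x_\alpha)=a_{i,\alpha,\alpha}x_\alpha b^i_{\alpha,\alpha}+c_\alpha x_\alpha,$$ and let $x\circ y=R(x)y+xR(y)-R(xy)$ for $x,y\in M$, where juxtaposition is the usual product of $M$. If $\circ$ is an associative product on $M$, then $$a_{i,\alpha,\beta}a_{j,\beta,\gamma}=\phi^k_{i,j,\alpha,\beta,\gamma}a_{k,\alpha,\gamma}+\delta_{\alpha,\gamma}\mu_{i,j,\alpha,\beta},\qquad b^i_{\alpha,\beta}b^j_{\beta,\gamma}=\psi^{i,j}_{k,\alpha,\beta,\gamma}b^k_{\alpha,\gamma}+\delta_{\alpha,\gamma}\lambda^{i,j}_{\alpha,\beta},$$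 $$b^i_{\alpha,\beta}a_{j,\beta,\gamma}=\phi^i_{j,k,\beta,\gamma,\alpha}b^k_{\alpha,\gamma}+\psi^{k,i}_{j,\gamma,\alpha,\beta}a_{k,\alpha,\gamma}+\delta_{\alpha,\gamma}t^i_{j,\alpha,\beta}+\delta_{\alpha,\gamma}\delta^i_jc_\alpha,$$ $$c_\alpha a_{i,\alpha,\beta}=\mu_{i,k,\alpha,\beta}b^k_{\alpha,\beta}-t^k_{i,\beta,\alpha}a_{k,\alpha,\beta}-\sum_{1\le\nu\le m}\phi^k_{l,s,\alpha,\nu,\beta}\psi^{s,l}_{i,\beta,\nu,\alpha}a_{k,\alpha,\beta}-\sum_{1\le\nu\le m}\delta_{\alpha,\beta}\mu_{l,s,\alpha,\nu}\psi^{s,l}_{i,\alpha,\nu,\alpha},$$ $$b^i_{\alpha,\beta}c_\beta=\lambda^{k,i}_{\beta,\alpha}a_{k,\alpha,\beta}-t^i_{k,\alpha,\beta}b^k_{\alpha,\beta}-\sum_{1\le\nu\le m}\phi^i_{l,s,\beta,\nu,\alpha}\psi^{s,l}_{k,\alpha,\nu,\beta}b^k_{\alpha,\beta}-\sum_{1\le\nu\le m}\delta_{\alpha,\beta}\phi^i_{s,l,\alpha,\nu,\alpha}\lambda^{l,s}_{\alpha,\nu},$$ where $\phi^k_{i,j,\alpha,\beta,\gamma},\mu_{i,j,\alpha,\beta},\psi^{i,j}_{k,\alpha,\beta,\gamma},\lambda^{i,j}_{\alpha,\beta},t^i_{j,\alpha,\beta}$ are tensors (complex numbers) satisfying $$\phi^s_{j,k,\alpha,\beta,\gamma}\phi^i_{s,l,\alpha,\gamma,\delta}+\delta^i_l\delta_{\alpha,\gamma}\mu_{j,k,\alpha,\beta}=\phi^i_{j,s,\alpha,\beta,\delta}\phi^s_{k,l,\beta,\gamma,\delta}+\delta^i_j\delta_{\beta,\delta}\mu_{k,l,\beta,\gamma},$$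 $$\phi^s_{j,k,\beta,\gamma,\alpha}\mu_{i,s,\alpha,\beta}=\phi^s_{i,j,\alpha,\beta,\gamma}\mu_{s,k,\alpha,\gamma},$$ $$\psi^{i,j}_{s,\alpha,\beta,\gamma}\psi^{s,k}_{l,\alpha,\gamma,\delta}+\delta^k_l\delta_{\alpha,\gamma}\lambda^{i,j}_{\alpha,\beta}=\psi^{j,k}_{s,\beta,\gamma,\delta}\psi^{i,s}_{l,\alpha,\beta,\delta}+\delta^i_l\delta_{\beta,\delta}\lambda^{j,k}_{\beta,\gamma},$$ $$\psi_{s,\alpha,\beta,\gamma}^{i,j}\lambda^{s,k}_{\alpha,\gamma}=\psi^{j,k}_{s,\beta,\gamma,\alpha}\lambda^{i,s}_{\alpha,\beta},$$ $$\phi^s_{j,k,\beta,\gamma,\delta}\psi_{s,\delta,\alpha,\beta}^{l,i}=\phi^l_{s,k,\alpha,\gamma,\delta}\psi_{j,\gamma,\alpha,\beta}^{s,i}+\phi^i_{j,s,\beta,\gamma,\alpha}\psi_{k,\delta,\alpha,\gamma}^{l,s}+\delta^l_k\delta_{\alpha,\gamma}t^i_{j,\alpha,\beta}-\delta^i_j\delta_{\alpha,\gamma}t_{k,\delta,\alpha}^l-\delta^i_j\delta_{\alpha,\gamma}\sum_{1\le\nu\le m}\phi^l_{s,r,\alpha,\nu,\delta}\psi^{r,s}_{k,\delta,\nu,\alpha},$$ $$\phi^s_{j,k,\beta,\gamma,\alpha}t^i_{s,\alpha,\beta}=\psi_{j,\gamma,\alpha,\beta}^{s,i}\mu_{s,k,\alpha,\gamma}+\phi^i_{j,s,\beta,\gamma,\alpha}t_{k,\alpha,\gamma}^s-\delta^i_j\delta_{\alpha,\gamma}\sum_{1\le\nu\le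 m}\psi_{k,\alpha,\nu,\alpha}^{s,r}\mu_{r,s,\alpha,\nu},$$ $$\psi^{k,i}_{s,\alpha,\beta,\gamma}t_{j,\alpha,\gamma}^s=\phi^i_{j,s,\gamma,\alpha,\beta}\lambda^{k,s}_{\alpha,\beta}+\psi_{j,\alpha,\beta,\gamma}^{s,i}t_{s,\alpha,\beta}^k-\delta^i_j\delta_{\alpha,\beta}\sum_{1\le\nu\le m}\phi^k_{s,r,\alpha,\nu,\alpha}\lambda^{r,s}_{\alpha,\nu}.$$
   Context: Repeated Latin indices are summed over their range; repeated Greek indices are not summed unless a sum sign is written. Greek indices run over $1,\dots,m$. A Latin index attached to $a_{\cdot,\alpha,\beta}$ runs over $1,\dots,p_{\beta,\alpha}$ and one attached to $b^{\cdot}_{\alpha,\beta}$ runs over $1,\dots,p_{\alpha,\beta}$. Scalars with a factor $\delta_{\alpha,\gamma}$ (or $\delta_{\alpha,\beta}$) in matrix identities denote multiples of the identity matrix of $Mat_{n_\alpha}$. $\delta^i_j,\delta_{\alpha,\beta}$ are Kronecker deltas. *)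

theory Defs
  imports "Jordan_Normal_Form.VS_Connect"
begin

definition msum :: "nat \<Rightarrow> nat \<Rightarrow> ('i \<Rightarrow> complex mat) \<Rightarrow> 'i set \<Rightarrow> complex mat" where
  "msum r c f I = finsum (module_mat TYPE(complex) r c) f I"

lemma msum_closed:
  assumes "\<And>i. i \<in> I \<Longrightarrow> f i \<in> carrier_mat r c"
  shows "msum r c f I \<in> carrier_mat r c"
proof -
  interpret abelian_group "module_mat TYPE(complex) r c" by (rule abelian_group_mat)
  show ?thesis
    using finsum_closed[of f I] assms by (auto simp: msum_def module_mat_simps)
qed

lemma msum_index:
  assumes "finite I" and "\<And>i. i \<in> I \<Longrightarrow> f i \<in> carrier_mat r c" and "j < r" "k < c"
  shows "msum r c f I $$ (j, k) = (\<Sum>i\<in>I. f i $$ (j, k))"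
  using assms(1,2)
proof (induction I rule: finite_induct)
  interpret abelian_group "module_mat TYPE(complex) r c" by (rule abelian_group_mat)
  case empty
  then show ?case using assms(3,4) by (simp add: msum_def module_mat_simps)
next
  interpret abelian_group "module_mat TYPE(complex) r c" by (rule abelian_group_mat)
  case (insert i I)
  have "msum r c f (insert i I) = f i + msum r c f I"
    using insert.hyps insert.prems finsum_insert[of I i f]
    by (auto simp: msum_def module_mat_simps)
  moreover have "msum r c f I \<in> carrier_mat r c" by (rule msum_closed) (use insert.prems in auto)
  ultimately show ?case using insert assms(3,4) by simp
qed

text \<open>Linear independence of a finite family: members with different indices are different,
  and the set of members is linearly independent.\<close>

definition lin_indpt_family :: "nat \<Rightarrow> nat \<Rightarrow> ('i \<Rightarrow> complex mat) \<Rightarrow> 'i set \<Rightarrow> bool" where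
  "lin_indpt_family r c f I \<longleftrightarrow>
     inj_on f I \<and> \<not> module.lin_dep class_ring (module_mat TYPE(complex) r c) (f ` I)"

text \<open>An element of the direct sum of the matrix algebras is the extensional function of its
  components, so that equality in the direct sum is equality of functions.\<close>

definition dsum :: "nat \<Rightarrow> (nat \<Rightarrow> nat) \<Rightarrow> (nat \<Rightarrow> complex mat) set" where
  "dsum m n = (\<Pi>\<^sub>E \<alpha>\<in>{1..m}. carrier_mat (n \<alpha>) (n \<alpha>))"

definition dplus :: "nat \<Rightarrow> (nat \<Rightarrow> complex mat) \<Rightarrow> (nat \<Rightarrow> complex mat) \<Rightarrow> nat \<Rightarrow> complex mat" where
  "dplus m x y = (\<lambda>\<alpha>\<in>{1..m}. x \<alpha> + y \<alpha>)"

definition dminus :: "nat \<Rightarrow> (nat \<Rightarrow> complex mat) \<Rightarrow> (nat \<Rightarrow> complex mat) \<Rightarrow> nat \<Rightarrow> complex mat" where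
  "dminus m x y = (\<lambda>\<alpha>\<in>{1..m}. x \<alpha> - y \<alpha>)"

definition dtimes :: "nat \<Rightarrow> (nat \<Rightarrow> complex mat) \<Rightarrow> (nat \<Rightarrow> complex mat) \<Rightarrow> nat \<Rightarrow> complex mat" where
  "dtimes m x y = (\<lambda>\<alpha>\<in>{1..m}. x \<alpha> * y \<alpha>)"

text \<open>Index order: \<open>a i \<beta> \<alpha>\<close> is $a_{i,\beta,\alpha}$ (size $n_\beta \times n_\alpha$) and \<open>b i \<alpha> \<beta>\<close> is
  $b^i_{\alpha,\beta}$ (size $n_\alpha \times n_\beta$), both with \<open>i\<close> in \<open>{1..p \<alpha> \<beta>}\<close>.
  \<open>R_comp n p a b c \<beta> \<alpha>\<close> is the component $R_{\beta,\alpha}$, a map from block $\alpha$ to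
  block $\beta$.\<close>

definition R_comp :: "(nat \<Rightarrow> nat) \<Rightarrow> (nat \<Rightarrow> nat \<Rightarrow> nat) \<Rightarrow> (nat \<Rightarrow> nat \<Rightarrow> nat \<Rightarrow> complex mat) \<Rightarrow>
    (nat \<Rightarrow> nat \<Rightarrow> nat \<Rightarrow> complex mat) \<Rightarrow> (nat \<Rightarrow> complex mat) \<Rightarrow> nat \<Rightarrow> nat \<Rightarrow> complex mat \<Rightarrow> complex mat"
  where
  "R_comp n p a b c \<beta> \<alpha> x =
     (if \<alpha> = \<beta>
      then msum (n \<alpha>) (n \<alpha>) (\<lambda>i. a i \<alpha> \<alpha> * x * b i \<alpha> \<alpha>) {1..p \<alpha> \<alpha>} + c \<alpha> * x
      else msum (n \<beta>) (n \<beta>) (\<lambda>i. a i \<beta> \<alpha> * x * b i \<alpha> \<beta>) {1..p \<alpha> \<beta>})"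

definition R_op :: "nat \<Rightarrow> (nat \<Rightarrow> nat) \<Rightarrow> (nat \<Rightarrow> nat \<Rightarrow> nat) \<Rightarrow> (nat \<Rightarrow> nat \<Rightarrow> nat \<Rightarrow> complex mat) \<Rightarrow>
    (nat \<Rightarrow> nat \<Rightarrow> nat \<Rightarrow> complex mat) \<Rightarrow> (nat \<Rightarrow> complex mat) \<Rightarrow> (nat \<Rightarrow> complex mat) \<Rightarrow> nat \<Rightarrow> complex mat"
  where
  "R_op m n p a b c x =
     (\<lambda>\<beta>\<in>{1..m}. msum (n \<beta>) (n \<beta>) (\<lambda>\<alpha>. R_comp n p a b c \<beta> \<alpha> (x \<alpha>)) {1..m})"

definition circ :: "nat \<Rightarrow> ((nat \<Rightarrow> complex mat) \<Rightarrow> nat \<Rightarrow> complex mat) \<Rightarrow>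
    (nat \<Rightarrow> complex mat) \<Rightarrow> (nat \<Rightarrow> complex mat) \<Rightarrow> nat \<Rightarrow> complex mat" where
  "circ m R x y = dminus m (dplus m (dtimes m (R x) y) (dtimes m x (R y))) (R (dtimes m x y))"

text \<open>\<open>delta_mat n \<alpha> \<gamma> X\<close> is $\delta_{\alpha,\gamma} X$ for a square matrix \<open>X\<close> of size $n_\alpha$. It occurs
  as a summand in identities between $n_\alpha \times n_\gamma$ matrices, so for $\alpha \ne \gamma$ it has to be
  the zero matrix of that size.\<close>

definition delta_mat :: "(nat \<Rightarrow> nat) \<Rightarrow> nat \<Rightarrow> nat \<Rightarrow> complex mat \<Rightarrow> complex mat" where
  "delta_mat n \<alpha> \<gamma> X = (if \<alpha> = \<gamma> then X else 0\<^sub>m (n \<alpha>) (n \<gamma>))"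

text \<open>The same for a scalar \<open>s\<close>, which denotes the corresponding multiple of the identity.\<close>

definition delta_scal :: "(nat \<Rightarrow> nat) \<Rightarrow> nat \<Rightarrow> nat \<Rightarrow> complex \<Rightarrow> complex mat" where
  "delta_scal n \<alpha> \<gamma> s = delta_mat n \<alpha> \<gamma> (s \<cdot>\<^sub>m 1\<^sub>m (n \<alpha>))"

end

theory Submission
  imports Defs
begin

text \<open>Put $T(x, y) = R(x \circ y) - R(x) R(y)$. Associativity of $\circ$ says precisely that $T$ is a Hochschild
  2-cocycle of the semisimple algebra $M$, so $T(x, y) = S(x) y + x S(y) - S(xy)$ for some linear $S$.
  Read blockwise as an identity of 3-tensors, this is an equation for the products $aa$, $bb$, $ba$, $ca$, $bc$.
  Contracting two of the three tensor factors with functionals dual to the linearly independent families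
  (and vanishing on $1$, so that the terms with $S$ contribute only multiples of $1$) gives first
  $a a$ and $b b$, then $b a$, and from the remaining terms $c a$ and $b c$. The identities between the
  structure constants are coefficient comparisons in $(aa)a = a(aa)$, $(bb)b = b(bb)$, $(ba)a = b(aa)$ and
  $(bb)a = b(ba)$.\<close>

section \<open>Finitely supported matrices\<close>

text \<open>Two obstacles shape the proof. The values of S are under no control; what helps is that
  S(x)y, xS(y) and S(xy) carry the identity in the third, first and second tensor factor. A
  functional that kills 1 in one factor removes one of these terms. The last occurrence of S
  disappears only by comparing S in two different positions, and this is how ca and bc are reached.
  The sums over \<nu> come from R(R(xy)), the only term that passes through a block not fixed by the
  blocks of x, y and the target. The other obstacle: a_{k,\<alpha>,\<gamma>} and
  b^k_{\<alpha>,\<gamma>} lie in the same matrix space, but only each family by itself is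
  independent, and c_\<alpha> is arbitrary. Coefficients in an identity that mixes a, b and c
  therefore cannot be compared directly. In (ba)a = b(aa) the b-terms and c-terms have to be matched
  by the identities coming from aa, and only then may a functional dual to the a's be applied; for
  (bb)a = b(ba) the roles of a and b are exchanged.\<close>

text \<open>Padding matrices of all sizes with zeros to infinite matrices turns them into elements of one
  non-unital ring, in which rectangular products are associative without any dimension bookkeeping.\<close>

typedef fmat = "{F :: nat \<Rightarrow> nat \<Rightarrow> complex. \<exists>N. \<forall>i j. N \<le> i \<or> N \<le> j \<longrightarrow> F i j = 0}"
  morphisms ent Fmat
  by (rule exI[of _ "\<lambda>_ _. 0"]) auto

setup_lifting type_definition_fmat

lemma fmat_eqI: "(\<And>i j. ent x i j = ent y i j) \<Longrightarrow> x = y"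
  by (simp add: ent_inject[symmetric] fun_eq_iff)

definition supp :: "nat \<Rightarrow> nat \<Rightarrow> fmat \<Rightarrow> bool" where
  "supp r c x \<longleftrightarrow> (\<forall>i j. r \<le> i \<or> c \<le> j \<longrightarrow> ent x i j = 0)"

lemma supp_bounded: "\<exists>N. supp N N x"
  using ent[of x] by (simp add: supp_def)

instantiation fmat :: ring
begin

lift_definition zero_fmat :: fmat is "\<lambda>_ _. 0" by auto

lift_definition plus_fmat :: "fmat \<Rightarrow> fmat \<Rightarrow> fmat" is "\<lambda>F G i j. F i j + G i j"
proof -
  fix F G :: "nat \<Rightarrow> nat \<Rightarrow> complex"
  assume "\<exists>N. \<forall>i j. N \<le> i \<or> N \<le> j \<longrightarrow> F i j = 0" "\<exists>N. \<forall>i j. N \<le> i \<or> N \<le> j \<longrightarrow> G i j = 0"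
  then obtain N N' where "\<forall>i j. N \<le> i \<or> N \<le> j \<longrightarrow> F i j = 0" "\<forall>i j. N' \<le> i \<or> N' \<le> j \<longrightarrow> G i j = 0"
    by blast
  then show "\<exists>N. \<forall>i j. N \<le> i \<or> N \<le> j \<longrightarrow> F i j + G i j = 0"
    by (intro exI[of _ "max N N'"]) auto
qed

lift_definition uminus_fmat :: "fmat \<Rightarrow> fmat" is "\<lambda>F i j. - F i j" by simp

definition "x - y = x + - (y :: fmat)"

text \<open>The summation runs over the support of a row of the left factor. That set is finite, so
  the product refers to no size; \<open>ent_times_supp\<close> recovers the usual sum for any column
  bound.\<close>

lift_definition times_fmat :: "fmat \<Rightarrow> fmat \<Rightarrow> fmat"
  is "\<lambda>F G i k. \<Sum>j\<in>{j. F i j \<noteq> 0}. F i j * G j k"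
proof -
  fix F G :: "nat \<Rightarrow> nat \<Rightarrow> complex"
  assume "\<exists>N. \<forall>i j. N \<le> i \<or> N \<le> j \<longrightarrow> F i j = 0" "\<exists>N. \<forall>i j. N \<le> i \<or> N \<le> j \<longrightarrow> G i j = 0"
  then obtain N N' where "\<forall>i j. N \<le> i \<or> N \<le> j \<longrightarrow> F i j = 0" "\<forall>i j. N' \<le> i \<or> N' \<le> j \<longrightarrow> G i j = 0"
    by blast
  then show "\<exists>N. \<forall>i k. N \<le> i \<or> N \<le> k \<longrightarrow> (\<Sum>j\<in>{j. F i j \<noteq> 0}. F i j * G j k) = 0"
    by (intro exI[of _ "max N N'"]) (auto intro!: sum.neutral)
qed

lemma ent_times_supp:
  assumes "supp r c x"
  shows "ent (x * y) i k = (\<Sum>j<c. ent x i j * ent y j k)"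
  unfolding times_fmat.rep_eq
proof (rule sum.mono_neutral_left)
  show "{j. ent x i j \<noteq> 0} \<subseteq> {..<c}" using assms by (auto simp: supp_def not_le[symmetric])
qed auto

lemma ent_minus: "ent (x - y) i j = ent x i j - ent y i j"
  by (simp add: minus_fmat_def plus_fmat.rep_eq uminus_fmat.rep_eq)

instance
proof
  fix x y z :: fmat
  show "x + y + z = x + (y + z)" "x + y = y + x" "0 + x = x" "- x + x = 0" "x - y = x + - y"
    by (auto intro!: fmat_eqI simp: plus_fmat.rep_eq zero_fmat.rep_eq uminus_fmat.rep_eq ent_minus)
  show "x * y * z = x * (y * z)"
  proof (rule fmat_eqI)
    fix i k
    obtain N where N: "supp N N x" using supp_bounded by meson
    obtain K where K: "supp K K y" using supp_bounded by meson
    have "supp N K (x * y)"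
      using N K by (auto simp: supp_def ent_times_supp[OF N])
    then have "ent (x * y * z) i k = (\<Sum>l<K. (\<Sum>j<N. ent x i j * ent y j l) * ent z l k)"
      by (simp add: ent_times_supp[OF N] ent_times_supp[of N K "x * y"])
    also have "\<dots> = (\<Sum>l<K. \<Sum>j<N. ent x i j * (ent y j l * ent z l k))"
      by (simp add: sum_distrib_right mult.assoc)
    also have "\<dots> = (\<Sum>j<N. ent x i j * (\<Sum>l<K. ent y j l * ent z l k))"
      by (subst sum.swap) (simp add: sum_distrib_left)
    also have "\<dots> = ent (x * (y * z)) i k"
      by (simp add: ent_times_supp[OF N] ent_times_supp[OF K])
    finally show "ent (x * y * z) i k = ent (x * (y * z)) i k" .
  qed
  show "(x + y) * z = x * z + y * z"
  proof (rule fmat_eqI)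
    fix i k
    obtain N where N: "supp N N x" using supp_bounded by meson
    obtain K where K: "supp K K y" using supp_bounded by meson
    let ?N = "max N K"
    have 1: "supp ?N ?N x" "supp ?N ?N y" "supp ?N ?N (x + y)"
      using N K by (auto simp: supp_def plus_fmat.rep_eq)
    show "ent ((x + y) * z) i k = ent (x * z + y * z) i k"
      by (simp add: 1[THEN ent_times_supp] plus_fmat.rep_eq sum.distrib algebra_simps)
  qed
  show "x * (y + z) = x * y + x * z"
  proof (rule fmat_eqI)
    fix i k
    obtain N where N: "supp N N x" using supp_bounded by meson
    show "ent (x * (y + z)) i k = ent (x * y + x * z) i k"
      by (simp add: ent_times_supp[OF N] plus_fmat.rep_eq sum.distrib algebra_simps)
  qed
qed

end

lift_definition cscale :: "complex \<Rightarrow> fmat \<Rightarrow> fmat"  (infixr "*\<^sub>C" 75) is "\<lambda>c F i j. c * F i j"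
  by auto

lemmas ent_simps = plus_fmat.rep_eq zero_fmat.rep_eq uminus_fmat.rep_eq ent_minus cscale.rep_eq

lemma ent_sum: "ent (sum x I) i j = (\<Sum>k\<in>I. ent (x k) i j)"
  by (induction I rule: infinite_finite_induct) (simp_all add: ent_simps)

global_interpretation fmat: vector_space cscale
  by unfold_locales (auto intro!: fmat_eqI simp: ent_simps algebra_simps)

lemma cscale_times_left [simp]: "(c *\<^sub>C x) * y = c *\<^sub>C (x * y)"
proof (rule fmat_eqI)
  fix i k
  obtain N where N: "supp N N x" using supp_bounded by meson
  then have N': "supp N N (c *\<^sub>C x)" by (simp add: supp_def ent_simps)
  show "ent (c *\<^sub>C x * y) i k = ent (c *\<^sub>C (x * y)) i k"
    by (simp add: ent_times_supp[OF N] ent_times_supp[OF N'] ent_simps sum_distrib_left mult.assoc)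
qed

lemma cscale_times_right [simp]: "x * (c *\<^sub>C y) = c *\<^sub>C (x * y)"
proof (rule fmat_eqI)
  fix i k
  obtain N where N: "supp N N x" using supp_bounded by meson
  show "ent (x * (c *\<^sub>C y)) i k = ent (c *\<^sub>C (x * y)) i k"
    by (simp add: ent_times_supp[OF N] ent_simps sum_distrib_left mult_ac)
qed

section \<open>Matrix units and the identities of the matrix blocks\<close>

lift_definition unitm :: "nat \<Rightarrow> nat \<Rightarrow> fmat" is "\<lambda>q r i j. if i = q \<and> j = r then 1 else 0"
  by (rule_tac x = "Suc (max nat1 nat2)" in exI) auto

text \<open>The ring \<open>fmat\<close> has no unit; \<open>idm N\<close> acts as one on the
  matrices with at most N rows or columns on the relevant side, and plays the role of 1 in a block
  of size N.\<close>

lift_definition idm :: "nat \<Rightarrow> fmat" is "\<lambda>N i j. if i = j \<and> i < N then 1 else 0"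
  by (rule_tac x = "nat" in exI) auto

lemma ent_unitm_times: "ent (unitm q r * x) u v = (if u = q then ent x r v else 0)"
proof -
  have "ent (unitm q r * x) u v = (\<Sum>j<Suc r. ent (unitm q r) u j * ent x j v)"
    by (rule ent_times_supp[of "Suc q"]) (simp add: supp_def unitm.rep_eq)
  also have "\<dots> = (if u = q then ent x r v else 0)"
    by (auto simp: unitm.rep_eq if_distrib[of "\<lambda>x. x * _"] cong: if_cong intro!: sum.neutral)
  finally show ?thesis .
qed

lemma ent_times_unitm: "ent (x * unitm q r) u v = (if v = r then ent x u q else 0)"
proof -
  obtain N where N: "supp N N x" using supp_bounded by meson
  have "ent (x * unitm q r) u v = (\<Sum>j<N. if j = q then (if v = r then ent x u q else 0) else 0)"
    unfolding ent_times_supp[OF N] by (rule sum.cong) (auto simp: unitm.rep_eq)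
  also have "\<dots> = (if v = r then ent x u q else 0)"
    using N by (auto simp: supp_def not_less)
  finally show ?thesis .
qed

lemma unitm_times_unitm: "unitm q r * unitm s t = (if r = s then unitm q t else 0)"
  by (rule fmat_eqI) (auto simp: ent_unitm_times unitm.rep_eq zero_fmat.rep_eq)

lemma ent_idm_times: "ent (idm N * x) u v = (if u < N then ent x u v else 0)"
proof -
  have "ent (idm N * x) u v = (\<Sum>j<N. ent (idm N) u j * ent x j v)"
    by (rule ent_times_supp[of N]) (auto simp: supp_def idm.rep_eq)
  also have "\<dots> = (\<Sum>j<N. if j = u then ent x u v else 0)"
    by (rule sum.cong) (auto simp: idm.rep_eq)
  finally show ?thesis by simp
qed

lemma ent_times_idm: "ent (x * idm N) u v = (if v < N then ent x u v else 0)"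
proof -
  obtain K where K: "supp K K x" using supp_bounded by meson
  have "ent (x * idm N) u v = (\<Sum>j<K. if j = v then (if v < N then ent x u v else 0) else 0)"
    unfolding ent_times_supp[OF K] by (rule sum.cong) (auto simp: idm.rep_eq)
  then show ?thesis using K by (auto simp: supp_def not_less)
qed

lemma idm_times_supp: "supp r c x \<Longrightarrow> idm r * x = x"
  by (rule fmat_eqI) (auto simp: ent_idm_times supp_def not_less)

lemma supp_times_idm: "supp r c x \<Longrightarrow> x * idm c = x"
  by (rule fmat_eqI) (auto simp: ent_times_idm supp_def not_less)

lemma supp_times: "supp r c x \<Longrightarrow> supp c d y \<Longrightarrow> supp r d (x * y)"
  by (auto simp: supp_def ent_times_supp[of r c])

lemma supp_unitm: "q < r \<Longrightarrow> s < c \<Longrightarrow> supp r c (unitm q s)"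
  by (auto simp: supp_def unitm.rep_eq)

lemma supp_idm: "supp N N (idm N)"
  by (auto simp: supp_def idm.rep_eq)

lemma supp_expand:
  assumes "supp r c x"
  shows "x = (\<Sum>(u,q)\<in>{..<r} \<times> {..<c}. ent x u q *\<^sub>C unitm u q)"
proof (rule fmat_eqI)
  fix i j
  have "ent (\<Sum>(u,q)\<in>{..<r} \<times> {..<c}. ent x u q *\<^sub>C unitm u q) i j =
    (\<Sum>P\<in>{..<r} \<times> {..<c}. if P = (i, j) then ent x i j else 0)"
    unfolding ent_sum by (rule sum.cong) (auto simp: ent_simps unitm.rep_eq split: if_splits)
  also have "\<dots> = ent x i j" using assms by (auto simp: supp_def)
  finally show "ent x i j = ent (\<Sum>(u,q)\<in>{..<r} \<times> {..<c}. ent x u q *\<^sub>C unitm u q) i j" by simp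
qed

section \<open>Linear functionals and dual families\<close>

abbreviation lin_form :: "(fmat \<Rightarrow> complex) \<Rightarrow> bool" where
  "lin_form \<equiv> Vector_Spaces.linear cscale (*)"

lemma lin_form_simps:
  assumes "lin_form f"
  shows "f (x + y) = f x + f y" "f (x - y) = f x - f y" "f (- x) = - f x" "f 0 = 0"
    "f (c *\<^sub>C x) = c * f x" "f (sum g I) = (\<Sum>i\<in>I. f (g i))"
proof -
  interpret Vector_Spaces.linear cscale "(*)" f by fact
  show "f (x + y) = f x + f y" "f (x - y) = f x - f y" "f (- x) = - f x" "f 0 = 0"
    "f (c *\<^sub>C x) = c * f x" "f (sum g I) = (\<Sum>i\<in>I. f (g i))"
    by (rule add diff neg zero scale sum)+
qed

lemma lin_form_ent: "lin_form (\<lambda>x. ent x i j)"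
  by unfold_locales (simp_all add: ent_simps algebra_simps)

text \<open>An independent set extends to a basis, so a functional can be prescribed on it.
  Independence is assumed for an indexed family while the extension theorem speaks of sets, hence
  the detour through injectivity of the family.\<close>

lemma dual_functional:
  assumes fin: "finite I" and i: "i \<in> I"
    and indep: "\<And>c. (\<Sum>j\<in>I. c j *\<^sub>C x j) = 0 \<Longrightarrow> \<forall>j\<in>I. c j = 0"
  shows "\<exists>f. lin_form f \<and> (\<forall>j\<in>I. f (x j) = of_bool (i = j))"
proof -
  interpret vector_space_pair cscale "(*) :: complex \<Rightarrow> complex \<Rightarrow> complex"
    by unfold_locales (simp_all add: algebra_simps)
  have inj: "inj_on x I"
  proof
    fix j k assume jk: "j \<in> I" "k \<in> I" "x j = x k"
    show "j = k"
    proof (rule ccontr)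
      assume "j \<noteq> k"
      \<comment> \<open>If two indices carried the same matrix, the coefficients 1 and -1 at these
        indices would give a nontrivial relation.\<close>
      have "(\<Sum>l\<in>I. (of_bool (l = j) - of_bool (l = k)) *\<^sub>C x l) = 0"
        using jk fin by (simp add: fmat.scale_left_diff_distrib sum_subtractf if_distrib[of "\<lambda>c. c *\<^sub>C _"] of_bool_def cong: if_cong)
      from indep[OF this] jk(1) \<open>j \<noteq> k\<close> show False by (auto simp: of_bool_def)
    qed
  qed
  have "fmat.independent (x ` I)"
    unfolding fmat.dependent_finite[OF finite_imageI[OF fin]]
  proof
    assume "\<exists>u. (\<exists>v\<in>x ` I. u v \<noteq> 0) \<and> (\<Sum>v\<in>x ` I. u v *\<^sub>C v) = 0"
    then obtain u j where u: "j \<in> I" "u (x j) \<noteq> 0" "(\<Sum>v\<in>x ` I. u v *\<^sub>C v) = 0" by blast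
    then have "(\<Sum>j\<in>I. u (x j) *\<^sub>C x j) = 0" by (simp add: sum.reindex[OF inj])
    from indep[OF this] u show False by auto
  qed
  then obtain f where f: "lin_form f" "\<forall>v\<in>x ` I. f v = of_bool (v = x i)"
    using linear_independent_extend[where f = "\<lambda>v. of_bool (v = x i)"] by blast
  then show ?thesis
    using inj i by (intro exI[of _ f]) (auto simp: inj_on_eq_iff)
qed

text \<open>Kronecker deltas are written as \<open>of_bool\<close> factors. This rule allows two
  summands to be compared under the assumption that the delta is 1, where block indices may be
  identified.\<close>

lemma of_bool_eq_mult_cong: "(P \<Longrightarrow> u = v) \<Longrightarrow> of_bool P * u = of_bool P * (v :: 'a :: semiring_1)"
  by auto

section \<open>The torsion of an associative block operator\<close>

lemma ent_times_unitm_times: "ent (x * unitm q r * y) u v = ent x u q * ent y r v"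
proof -
  obtain N where N: "supp N N (x * unitm q r)" using supp_bounded by meson
  have "ent (x * unitm q r * y) u v = (\<Sum>j<N. ent (x * unitm q r) u j * ent y j v)"
    by (rule ent_times_supp[OF N])
  also have "\<dots> = (\<Sum>j<N. if j = r then ent x u q * ent y r v else 0)"
    by (rule sum.cong) (auto simp: ent_times_unitm)
  also have "\<dots> = ent x u q * ent y r v"
  \<comment> \<open>\<open>N\<close> bounds the columns of x E_{qr}. If column r lies beyond that
    bound, it vanishes, and since its entries are those of column q of x, the right-hand side
    vanishes as well.\<close>
  proof (cases "r < N")
    case False
    then have "ent (x * unitm q r) u r = 0" using N by (auto simp: supp_def)
    with False show ?thesis by (simp add: ent_times_unitm)
  qed simp
  finally show ?thesis .
qed

lemma ent_unitm_sandwich: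
  "ent (x * unitm q r * y * unitm s t * z) u v = ent x u q * ent y r s * ent z t v"
  by (simp add: ent_times_unitm_times)

lemma sum_product3:
  "sum F X * sum G Y * sum H Z = (\<Sum>x\<in>X. \<Sum>y\<in>Y. \<Sum>z\<in>Z. F x * G y * (H z :: 'a :: semiring_0))"
proof -
  have "sum F X * sum G Y * sum H Z = (\<Sum>x\<in>X. \<Sum>y\<in>Y. F x * (\<Sum>z\<in>Z. G y * H z))"
    unfolding mult.assoc sum_product[of G Y H Z] by (rule sum_product)
  also have "\<dots> = (\<Sum>x\<in>X. \<Sum>y\<in>Y. \<Sum>z\<in>Z. F x * G y * H z)"
    by (simp add: sum_distrib_left mult.assoc)
  finally show ?thesis .
qed

lemma lin_form_supp:
  assumes "lin_form f" "supp r c x"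
  shows "f x = (\<Sum>P\<in>{..<r} \<times> {..<c}. f (unitm (fst P) (snd P)) * ent x (fst P) (snd P))"
  by (subst supp_expand[OF assms(2)])
    (simp add: lin_form_simps[OF assms(1)] case_prod_beta mult.commute)

text \<open>Multiplication sends the separability idempotent of the matrix algebra to 1. Writing 1
  in this way in front of the torsion brings it into the form to which the cocycle identity
  applies.\<close>

lemma idm_eq_sum: "idm N = (\<Sum>i<N. unitm i 0 * unitm 0 i)"
proof (rule fmat_eqI)
  fix u v
  have "ent (\<Sum>i<N. unitm i 0 * unitm 0 i) u v = (\<Sum>i<N. if i = u then (if u = v then 1 else 0) else 0)"
    unfolding ent_sum by (rule sum.cong) (auto simp: unitm_times_unitm unitm.rep_eq)
  then show "ent (idm N) u v = ent (\<Sum>i<N. unitm i 0 * unitm 0 i) u v"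
    by (auto simp: idm.rep_eq)
qed

section \<open>Operators given by blocks and their torsion\<close>

text \<open>The index sets \<open>J\<close> are left open so that the diagonal ones can contain an
  additional index for the summand with c. Every block of R then has the single form \<Sum> A x
  B.\<close>

locale block_operator =
  fixes m :: nat and n :: "nat \<Rightarrow> nat" and J :: "nat \<Rightarrow> nat \<Rightarrow> nat set"
    and A B :: "nat \<Rightarrow> nat \<Rightarrow> nat \<Rightarrow> fmat"
  assumes supp_A: "\<And>\<alpha> \<beta> i. \<alpha> \<in> {1..m} \<Longrightarrow> \<beta> \<in> {1..m} \<Longrightarrow> i \<in> J \<alpha> \<beta> \<Longrightarrow> supp (n \<beta>) (n \<alpha>) (A i \<beta> \<alpha>)"
    and supp_B: "\<And>\<alpha> \<beta> i. \<alpha> \<in> {1..m} \<Longrightarrow> \<beta> \<in> {1..m} \<Longrightarrow> i \<in> J \<alpha> \<beta> \<Longrightarrow> supp (n \<alpha>) (n \<beta>) (B i \<alpha> \<beta>)"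
    and n_pos: "\<And>\<alpha>. \<alpha> \<in> {1..m} \<Longrightarrow> 0 < n \<alpha>"
begin

definition block :: "nat \<Rightarrow> nat \<Rightarrow> fmat \<Rightarrow> fmat" where
  "block \<gamma> \<alpha> x = (\<Sum>i\<in>J \<alpha> \<gamma>. A i \<gamma> \<alpha> * x * B i \<alpha> \<gamma>)"

definition block_op :: "(nat \<Rightarrow> fmat) \<Rightarrow> nat \<Rightarrow> fmat" where
  "block_op x \<gamma> = (\<Sum>\<alpha>=1..m. block \<gamma> \<alpha> (x \<alpha>))"

definition circ_prod :: "(nat \<Rightarrow> fmat) \<Rightarrow> (nat \<Rightarrow> fmat) \<Rightarrow> nat \<Rightarrow> fmat" where
  "circ_prod x y \<gamma> = block_op x \<gamma> * y \<gamma> + x \<gamma> * block_op y \<gamma> - block_op (\<lambda>\<delta>. x \<delta> * y \<delta>) \<gamma>"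

text \<open>This is the T of the overview, up to sign the Nijenhuis torsion of the operator.\<close>

definition nijenhuis :: "(nat \<Rightarrow> fmat) \<Rightarrow> (nat \<Rightarrow> fmat) \<Rightarrow> nat \<Rightarrow> fmat" where
  "nijenhuis x y \<gamma> = block_op (circ_prod x y) \<gamma> - block_op x \<gamma> * block_op y \<gamma>"

definition inj_block :: "nat \<Rightarrow> fmat \<Rightarrow> nat \<Rightarrow> fmat" where
  "inj_block \<alpha> x \<delta> = (if \<delta> = \<alpha> then x else 0)"

definition blockwise :: "(nat \<Rightarrow> fmat) \<Rightarrow> bool" where
  "blockwise x \<longleftrightarrow> (\<forall>\<alpha>\<in>{1..m}. supp (n \<alpha>) (n \<alpha>) (x \<alpha>))"

lemma block_simps: "block \<gamma> \<alpha> (x + y) = block \<gamma> \<alpha> x + block \<gamma> \<alpha> y"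
  "block \<gamma> \<alpha> (x - y) = block \<gamma> \<alpha> x - block \<gamma> \<alpha> y" "block \<gamma> \<alpha> 0 = 0"
  by (simp_all add: block_def algebra_simps sum.distrib sum_subtractf)

lemma block_op_add: "block_op (\<lambda>\<delta>. x \<delta> + y \<delta>) \<gamma> = block_op x \<gamma> + block_op y \<gamma>"
  and block_op_diff: "block_op (\<lambda>\<delta>. x \<delta> - y \<delta>) \<gamma> = block_op x \<gamma> - block_op y \<gamma>"
  and block_op_zero: "block_op (\<lambda>\<delta>. 0) \<gamma> = 0"
  by (simp_all add: block_op_def block_simps sum.distrib sum_subtractf)

lemma block_op_inj_block: "\<alpha> \<in> {1..m} \<Longrightarrow> block_op (inj_block \<alpha> x) \<gamma> = block \<gamma> \<alpha> x"
  by (simp add: block_op_def inj_block_def if_distrib[of "block _ _"] block_simps cong: if_cong)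

lemma inj_block_times: "(\<lambda>\<delta>. inj_block \<alpha> x \<delta> * F \<delta>) = inj_block \<alpha> (x * F \<alpha>)"
  "(\<lambda>\<delta>. F \<delta> * inj_block \<alpha> x \<delta>) = inj_block \<alpha> (F \<alpha> * x)"
  by (auto simp: inj_block_def)

lemma blockwise_inj_block: "supp (n \<alpha>) (n \<alpha>) x \<Longrightarrow> blockwise (inj_block \<alpha> x)"
  by (auto simp: blockwise_def inj_block_def supp_def zero_fmat.rep_eq)

lemma nijenhuis_zero: "nijenhuis (\<lambda>\<delta>. 0) y \<gamma> = 0" "nijenhuis x (\<lambda>\<delta>. 0) \<gamma> = 0"
  by (simp_all add: nijenhuis_def circ_prod_def[abs_def] block_op_zero)

lemma inj_block_zero: "inj_block \<alpha> 0 = (\<lambda>\<delta>. 0)"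
  by (auto simp: inj_block_def)

lemma idm_times_block:
  assumes "\<alpha> \<in> {1..m}" "\<gamma> \<in> {1..m}"
  shows "idm (n \<gamma>) * block \<gamma> \<alpha> x = block \<gamma> \<alpha> x"
  unfolding block_def sum_distrib_left
  by (intro sum.cong refl) (simp add: idm_times_supp[OF supp_A[OF assms]] mult.assoc[symmetric])

lemma idm_times_block_op: "\<gamma> \<in> {1..m} \<Longrightarrow> idm (n \<gamma>) * block_op x \<gamma> = block_op x \<gamma>"
  unfolding block_op_def sum_distrib_left by (intro sum.cong refl idm_times_block)

lemma idm_times_nijenhuis: "\<gamma> \<in> {1..m} \<Longrightarrow> idm (n \<gamma>) * nijenhuis x y \<gamma> = nijenhuis x y \<gamma>"
  by (simp add: nijenhuis_def right_diff_distrib idm_times_block_op mult.assoc[symmetric])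

text \<open>Multiplying by an element of block \<beta> retains only the component in \<beta>, so
  R(R(x)y) and R(xR(y)) each follow one path of blocks. Only R(R(xy)), which is present for \<alpha>
  = \<beta>, runs through all intermediate blocks; every sum over \<nu> in the final identities
  originates here.\<close>

lemma nijenhuis_inj_block:
  assumes "\<alpha> \<in> {1..m}" "\<beta> \<in> {1..m}"
  shows "nijenhuis (inj_block \<alpha> x) (inj_block \<beta> y) \<gamma> = block \<gamma> \<beta> (block \<beta> \<alpha> x * y) + block \<gamma> \<alpha> (x * block \<alpha> \<beta> y)
    - (if \<alpha> = \<beta> then \<Sum>\<nu>=1..m. block \<gamma> \<nu> (block \<nu> \<alpha> (x * y)) else 0) - block \<gamma> \<alpha> x * block \<gamma> \<beta> y"
proof -
  have 1: "(\<lambda>\<delta>. inj_block \<alpha> x \<delta> * inj_block \<beta> y \<delta>) = (if \<alpha> = \<beta> then inj_block \<alpha> (x * y) else (\<lambda>\<delta>. 0))"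
    by (auto simp: inj_block_def)
  have 2: "block_op (\<lambda>\<delta>. block_op (if \<alpha> = \<beta> then inj_block \<alpha> (x * y) else (\<lambda>\<delta>. 0)) \<delta>) \<gamma> =
    (if \<alpha> = \<beta> then \<Sum>\<nu>=1..m. block \<gamma> \<nu> (block \<nu> \<alpha> (x * y)) else 0)"
    using assms by (simp add: block_op_inj_block block_op_zero) (simp add: block_op_def)
  show ?thesis
    unfolding nijenhuis_def circ_prod_def[abs_def] block_op_diff block_op_add 1 2
    using assms by (simp add: inj_block_times block_op_inj_block)
qed

text \<open>The primitive of the cocycle \<open>nijenhuis\<close> is obtained by contracting it with the separability idempotent
  $\sum_i E_{i0} \otimes E_{0i}$ of the target block.\<close>

definition primitive :: "nat \<Rightarrow> nat \<Rightarrow> fmat \<Rightarrow> fmat" where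
  "primitive \<gamma> \<alpha> x = (\<Sum>i<n \<gamma>. unitm i 0 * nijenhuis (inj_block \<gamma> (unitm 0 i)) (inj_block \<alpha> x) \<gamma>)"

lemma primitive_zero: "primitive \<gamma> \<alpha> 0 = 0"
  by (simp add: primitive_def inj_block_zero nijenhuis_zero)

end

section \<open>The torsion as a Hochschild coboundary\<close>

locale associative_block_operator = block_operator +
  assumes assoc: "\<And>x y z \<gamma>. blockwise x \<Longrightarrow> blockwise y \<Longrightarrow> blockwise z \<Longrightarrow> \<gamma> \<in> {1..m} \<Longrightarrow>
    circ_prod (circ_prod x y) z \<gamma> = circ_prod x (circ_prod y z) \<gamma>"
begin

text \<open>Expanding both bracketings of the new product and using only additivity of R and
  associativity of M, the associator becomes the Hochschild coboundary of T. The identity is solved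
  for the term with a left factor because the contraction that produces the primitive takes place on
  the left.\<close>

lemma nijenhuis_cocycle:
  assumes "blockwise x" "blockwise y" "blockwise z" "\<gamma> \<in> {1..m}"
  shows "x \<gamma> * nijenhuis y z \<gamma> = nijenhuis x y \<gamma> * z \<gamma> + nijenhuis (\<lambda>\<delta>. x \<delta> * y \<delta>) z \<gamma> - nijenhuis x (\<lambda>\<delta>. y \<delta> * z \<delta>) \<gamma>"
  using assoc[OF assms]
  by (simp add: nijenhuis_def circ_prod_def[abs_def] algebra_simps block_op_add block_op_diff)

text \<open>The left factor is taken from the target block \<gamma>, the only one that can act on
  the component read there. The three conditionals record which products of elements of different
  blocks are nonzero.\<close>

lemma nijenhuis_block_cocycle:
  assumes I: "\<alpha> \<in> {1..m}" "\<beta> \<in> {1..m}" "\<gamma> \<in> {1..m}"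
    and w: "supp (n \<gamma>) (n \<gamma>) w" and x: "supp (n \<alpha>) (n \<alpha>) x" and y: "supp (n \<beta>) (n \<beta>) y"
  shows "w * nijenhuis (inj_block \<alpha> x) (inj_block \<beta> y) \<gamma> =
      (if \<beta> = \<gamma> then nijenhuis (inj_block \<gamma> w) (inj_block \<alpha> x) \<gamma> * y else 0)
      + (if \<alpha> = \<gamma> then nijenhuis (inj_block \<gamma> (w * x)) (inj_block \<beta> y) \<gamma> else 0)
      - (if \<alpha> = \<beta> then nijenhuis (inj_block \<gamma> w) (inj_block \<alpha> (x * y)) \<gamma> else 0)"
proof -
  have 1: "(\<lambda>\<delta>. inj_block \<gamma> w \<delta> * inj_block \<alpha> x \<delta>) = (if \<alpha> = \<gamma> then inj_block \<gamma> (w * x) else (\<lambda>\<delta>. 0))"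
    and 2: "(\<lambda>\<delta>. inj_block \<alpha> x \<delta> * inj_block \<beta> y \<delta>) = (if \<alpha> = \<beta> then inj_block \<alpha> (x * y) else (\<lambda>\<delta>. 0))"
    by (auto simp: inj_block_def)
  have 3: "inj_block \<gamma> w \<gamma> = w" "inj_block \<beta> y \<gamma> = (if \<beta> = \<gamma> then y else 0)"
    by (auto simp: inj_block_def)
  show ?thesis
    using nijenhuis_cocycle[OF blockwise_inj_block[OF w] blockwise_inj_block[OF x] blockwise_inj_block[OF y] I(3)]
    unfolding 1 2 3 by (simp add: nijenhuis_zero)
qed

text \<open>Contracting the cocycle identity with the separability idempotent turns two of its terms
  into the primitive by definition. The third needs that the idempotent commutes with the action of
  the block. A matrix unit in the first argument is enough, since tensors are evaluated on matrix
  units only.\<close>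

lemma nijenhuis_coboundary:
  assumes I: "\<alpha> \<in> {1..m}" "\<beta> \<in> {1..m}" "\<gamma> \<in> {1..m}"
    and q: "q < n \<alpha>" "r < n \<alpha>" and y: "supp (n \<beta>) (n \<beta>) y"
  shows "nijenhuis (inj_block \<alpha> (unitm q r)) (inj_block \<beta> y) \<gamma> =
      (if \<beta> = \<gamma> then primitive \<gamma> \<alpha> (unitm q r) * y else 0)
      + (if \<alpha> = \<gamma> then unitm q r * primitive \<gamma> \<beta> y else 0)
      - (if \<alpha> = \<beta> then primitive \<gamma> \<alpha> (unitm q r * y) else 0)"
proof -
  let ?x = "unitm q r" and ?T = "nijenhuis (inj_block \<alpha> (unitm q r)) (inj_block \<beta> y) \<gamma>"
  have x: "supp (n \<alpha>) (n \<alpha>) ?x" using q by (simp add: supp_unitm)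
  \<comment> \<open>The torsion takes values in block \<gamma>, so 1 = \<Sum> E_{i0} E_{0i} may be
    inserted in front of it; the factor E_{0i} is the left argument for the cocycle
    identity.\<close>
  have "?T = (\<Sum>i<n \<gamma>. unitm i 0 * (unitm 0 i * ?T))"
    using idm_times_nijenhuis[OF I(3), of "inj_block \<alpha> ?x" "inj_block \<beta> y"]
    by (simp add: idm_eq_sum sum_distrib_right mult.assoc)
  also have "\<dots> = (\<Sum>i<n \<gamma>. unitm i 0 *
      ((if \<beta> = \<gamma> then nijenhuis (inj_block \<gamma> (unitm 0 i)) (inj_block \<alpha> ?x) \<gamma> * y else 0)
      + (if \<alpha> = \<gamma> then nijenhuis (inj_block \<gamma> (unitm 0 i * ?x)) (inj_block \<beta> y) \<gamma> else 0)
      - (if \<alpha> = \<beta> then nijenhuis (inj_block \<gamma> (unitm 0 i)) (inj_block \<alpha> (?x * y)) \<gamma> else 0)))"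
    using n_pos[OF I(3)] by (intro sum.cong refl arg_cong2[where f = "(*)"] nijenhuis_block_cocycle[OF I _ x y])
      (simp add: supp_unitm)
  also have "\<dots> = (if \<beta> = \<gamma> then primitive \<gamma> \<alpha> ?x * y else 0)
      + (if \<alpha> = \<gamma> then \<Sum>i<n \<gamma>. unitm i 0 * nijenhuis (inj_block \<gamma> (unitm 0 i * ?x)) (inj_block \<beta> y) \<gamma> else 0)
      - (if \<alpha> = \<beta> then primitive \<gamma> \<alpha> (?x * y) else 0)"
    by (auto simp: primitive_def sum_distrib_right distrib_left right_diff_distrib sum.distrib sum_subtractf mult.assoc)
  also have "(if \<alpha> = \<gamma> then \<Sum>i<n \<gamma>. unitm i 0 * nijenhuis (inj_block \<gamma> (unitm 0 i * ?x)) (inj_block \<beta> y) \<gamma> else 0)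
    = (if \<alpha> = \<gamma> then ?x * primitive \<gamma> \<beta> y else 0)"
  \<comment> \<open>Centrality of the idempotent: the sum of E_{i0} T(E_{0i} E_{qr}, y) retains i =
    q, the sum of E_{qr} E_{i0} T(E_{0i}, y) retains i = r, and both are E_{q0} T(E_{0r},
    y).\<close>
  proof (cases "\<alpha> = \<gamma>")
    case True
    let ?v = "unitm q 0 * nijenhuis (inj_block \<gamma> (unitm 0 r)) (inj_block \<beta> y) \<gamma>"
    have "(\<Sum>i<n \<gamma>. unitm i 0 * nijenhuis (inj_block \<gamma> (unitm 0 i * ?x)) (inj_block \<beta> y) \<gamma>)
      = (\<Sum>i<n \<gamma>. if i = q then ?v else 0)"
      by (rule sum.cong) (auto simp: unitm_times_unitm inj_block_zero nijenhuis_zero)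
    moreover have "?x * primitive \<gamma> \<beta> y = (\<Sum>i<n \<gamma>. if i = r then ?v else 0)"
      unfolding primitive_def sum_distrib_left
      by (rule sum.cong) (auto simp: mult.assoc[symmetric] unitm_times_unitm)
    ultimately show ?thesis using True q by simp
  qed simp
  finally show ?thesis .
qed

section \<open>Evaluating the coboundary identity on functionals\<close>

text \<open>The value of f \<otimes> g on the linear map \<open>primitive \<gamma> \<alpha>\<close>
  regarded as a 2-tensor, where a map x \<mapsto> A x B of the right sizes would give f(A)
  g(B).\<close>

definition primitive_form :: "nat \<Rightarrow> nat \<Rightarrow> (fmat \<Rightarrow> complex) \<Rightarrow> (fmat \<Rightarrow> complex) \<Rightarrow> complex" where
  "primitive_form \<gamma> \<alpha> f g = (\<Sum>P\<in>{..<n \<gamma>} \<times> {..<n \<alpha>}. \<Sum>Q\<in>{..<n \<alpha>} \<times> {..<n \<gamma>}.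
     f (unitm (fst P) (snd P)) * g (unitm (fst Q) (snd Q)) * ent (primitive \<gamma> \<alpha> (unitm (snd P) (fst Q))) (fst P) (snd Q))"

context
  fixes \<alpha> \<beta> \<gamma> :: nat and f g h :: "fmat \<Rightarrow> complex"
  assumes I: "\<alpha> \<in> {1..m}" "\<beta> \<in> {1..m}" "\<gamma> \<in> {1..m}" and f: "lin_form f" and g: "lin_form g" and h: "lin_form h"
begin

text \<open>An identity between bilinear maps $M_\alpha \times M_\beta \to M_\gamma$ is read as an identity of
  3-tensors, on which \<open>trilinear\<close> evaluates $f \otimes g \otimes h$: the map $(x, y) \mapsto A x B y C$
  is the tensor $A \otimes B \otimes C$.\<close>

definition trilinear :: "(fmat \<Rightarrow> fmat \<Rightarrow> fmat) \<Rightarrow> complex" where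
  "trilinear F = (\<Sum>P\<in>{..<n \<gamma>} \<times> {..<n \<alpha>}. \<Sum>Q\<in>{..<n \<alpha>} \<times> {..<n \<beta>}. \<Sum>W\<in>{..<n \<beta>} \<times> {..<n \<gamma>}.
     f (unitm (fst P) (snd P)) * g (unitm (fst Q) (snd Q)) * h (unitm (fst W) (snd W)) *
     ent (F (unitm (snd P) (fst Q)) (unitm (snd Q) (fst W))) (fst P) (snd W))"

lemma trilinear_cong:
  assumes "\<And>q r s t. q < n \<alpha> \<Longrightarrow> r < n \<alpha> \<Longrightarrow> s < n \<beta> \<Longrightarrow> t < n \<beta> \<Longrightarrow>
    F (unitm q r) (unitm s t) = G (unitm q r) (unitm s t)"
  shows "trilinear F = trilinear G"
  unfolding trilinear_def by (intro sum.cong refl) (auto simp: assms)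

lemma trilinear_add: "trilinear (\<lambda>x y. F x y + G x y) = trilinear F + trilinear G"
  and trilinear_diff: "trilinear (\<lambda>x y. F x y - G x y) = trilinear F - trilinear G"
  and trilinear_zero: "trilinear (\<lambda>x y. 0) = 0"
  by (simp_all add: trilinear_def ent_simps algebra_simps sum.distrib sum_subtractf)

lemma trilinear_if: "trilinear (\<lambda>x y. if P then F x y else 0) = of_bool P * trilinear F"
  by (simp add: trilinear_zero)

lemma trilinear_sum: "trilinear (\<lambda>x y. \<Sum>k\<in>K. F k x y) = (\<Sum>k\<in>K. trilinear (F k))"
  by (induction K rule: infinite_finite_induct) (simp_all add: trilinear_zero trilinear_add)

lemma trilinear_tensor:
  assumes "supp (n \<gamma>) (n \<alpha>) x" "supp (n \<alpha>) (n \<beta>) y" "supp (n \<beta>) (n \<gamma>) z"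
  shows "trilinear (\<lambda>u v. x * u * y * v * z) = f x * g y * h z"
  unfolding trilinear_def lin_form_supp[OF f assms(1)] lin_form_supp[OF g assms(2)] lin_form_supp[OF h assms(3)]
    ent_unitm_sandwich sum_product3
  by (intro sum.cong refl) (simp add: mult_ac)

lemma lin_form_idm: "lin_form k \<Longrightarrow> k (idm N) = (\<Sum>P\<in>{..<N} \<times> {..<N}. k (unitm (fst P) (snd P)) * of_bool (fst P = snd P))"
  by (subst lin_form_supp[OF _ supp_idm], assumption, intro sum.cong refl) (auto simp: idm.rep_eq of_bool_def)

text \<open>As a tensor S(x)y has 1 as its third factor; in the two lemmas that follow, xS(y) has it
  first and S(xy) second. Functionals that vanish on 1 therefore eliminate the unknown S.\<close>

lemma trilinear_primitive_left: "\<beta> = \<gamma> \<Longrightarrow> trilinear (\<lambda>x y. primitive \<gamma> \<alpha> x * y) = primitive_form \<gamma> \<alpha> f g * h (idm (n \<gamma>))"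
  unfolding trilinear_def primitive_form_def lin_form_idm[OF h] ent_times_unitm sum_distrib_right
  unfolding sum_distrib_left by (auto intro!: sum.cong simp: of_bool_def)

lemma trilinear_primitive_right: "\<alpha> = \<gamma> \<Longrightarrow> trilinear (\<lambda>x y. x * primitive \<gamma> \<beta> y) = f (idm (n \<gamma>)) * primitive_form \<gamma> \<beta> g h"
  unfolding trilinear_def primitive_form_def lin_form_idm[OF f] ent_unitm_times sum_distrib_right
  unfolding sum_distrib_left by (auto intro!: sum.cong simp: of_bool_def)

lemma trilinear_primitive_middle: "\<alpha> = \<beta> \<Longrightarrow> trilinear (\<lambda>x y. primitive \<gamma> \<alpha> (x * y)) = g (idm (n \<alpha>)) * primitive_form \<gamma> \<alpha> f h"
  unfolding trilinear_def primitive_form_def lin_form_idm[OF g] unitm_times_unitm sum_distrib_right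
  unfolding sum_distrib_left
  by (subst sum.swap) (auto intro!: sum.cong simp: of_bool_def primitive_zero ent_simps)

text \<open>Each of R(R(x)y), R(xR(y)), R(R(xy)) and R(x)R(y) is a sum of maps of the form A x B y
  C, so f \<otimes> g \<otimes> h can be evaluated on it factor by factor. Two adjacent left factors
  multiply to AA, two adjacent right factors to BB, and R(x)R(y) brings BA into the middle.\<close>

lemma torsion_tensor:
  "(\<Sum>i\<in>J \<alpha> \<beta>. \<Sum>j\<in>J \<beta> \<gamma>. f (A j \<gamma> \<beta> * A i \<beta> \<alpha>) * g (B i \<alpha> \<beta>) * h (B j \<beta> \<gamma>))
  + (\<Sum>i\<in>J \<beta> \<alpha>. \<Sum>j\<in>J \<alpha> \<gamma>. f (A j \<gamma> \<alpha>) * g (A i \<alpha> \<beta>) * h (B i \<beta> \<alpha> * B j \<alpha> \<gamma>))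
  - of_bool (\<alpha> = \<beta>) * g (idm (n \<alpha>)) *
    (\<Sum>\<nu>=1..m. \<Sum>s\<in>J \<alpha> \<nu>. \<Sum>l\<in>J \<nu> \<gamma>. f (A l \<gamma> \<nu> * A s \<nu> \<alpha>) * h (B s \<alpha> \<nu> * B l \<nu> \<gamma>))
  - (\<Sum>i\<in>J \<alpha> \<gamma>. \<Sum>j\<in>J \<beta> \<gamma>. f (A i \<gamma> \<alpha>) * g (B i \<alpha> \<gamma> * A j \<gamma> \<beta>) * h (B j \<beta> \<gamma>))
  = of_bool (\<beta> = \<gamma>) * primitive_form \<gamma> \<alpha> f g * h (idm (n \<gamma>)) + of_bool (\<alpha> = \<gamma>) * f (idm (n \<gamma>)) * primitive_form \<gamma> \<beta> g h
    - of_bool (\<alpha> = \<beta>) * g (idm (n \<alpha>)) * primitive_form \<gamma> \<alpha> f h"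
proof -
  note sA = supp_A supp_B supp_times
  have 1: "trilinear (\<lambda>x y. block \<gamma> \<beta> (block \<beta> \<alpha> x * y)) =
    (\<Sum>i\<in>J \<alpha> \<beta>. \<Sum>j\<in>J \<beta> \<gamma>. f (A j \<gamma> \<beta> * A i \<beta> \<alpha>) * g (B i \<alpha> \<beta>) * h (B j \<beta> \<gamma>))"
  proof -
    have "trilinear (\<lambda>x y. block \<gamma> \<beta> (block \<beta> \<alpha> x * y)) =
      trilinear (\<lambda>x y. \<Sum>j\<in>J \<beta> \<gamma>. \<Sum>i\<in>J \<alpha> \<beta>. (A j \<gamma> \<beta> * A i \<beta> \<alpha>) * x * B i \<alpha> \<beta> * y * B j \<beta> \<gamma>)"
      by (simp add: block_def sum_distrib_left sum_distrib_right mult.assoc)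
    also have "\<dots> = (\<Sum>j\<in>J \<beta> \<gamma>. \<Sum>i\<in>J \<alpha> \<beta>. f (A j \<gamma> \<beta> * A i \<beta> \<alpha>) * g (B i \<alpha> \<beta>) * h (B j \<beta> \<gamma>))"
      unfolding trilinear_sum by (intro sum.cong refl trilinear_tensor) (use I in \<open>blast intro: sA\<close>)+
    finally show ?thesis by (subst (asm) sum.swap)
  qed
  have 2: "trilinear (\<lambda>x y. block \<gamma> \<alpha> (x * block \<alpha> \<beta> y)) =
    (\<Sum>i\<in>J \<beta> \<alpha>. \<Sum>j\<in>J \<alpha> \<gamma>. f (A j \<gamma> \<alpha>) * g (A i \<alpha> \<beta>) * h (B i \<beta> \<alpha> * B j \<alpha> \<gamma>))"
  proof -
    have "trilinear (\<lambda>x y. block \<gamma> \<alpha> (x * block \<alpha> \<beta> y)) =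
      trilinear (\<lambda>x y. \<Sum>j\<in>J \<alpha> \<gamma>. \<Sum>i\<in>J \<beta> \<alpha>. A j \<gamma> \<alpha> * x * A i \<alpha> \<beta> * y * (B i \<beta> \<alpha> * B j \<alpha> \<gamma>))"
      by (simp add: block_def sum_distrib_left sum_distrib_right mult.assoc)
    also have "\<dots> = (\<Sum>j\<in>J \<alpha> \<gamma>. \<Sum>i\<in>J \<beta> \<alpha>. f (A j \<gamma> \<alpha>) * g (A i \<alpha> \<beta>) * h (B i \<beta> \<alpha> * B j \<alpha> \<gamma>))"
      unfolding trilinear_sum by (intro sum.cong refl trilinear_tensor) (use I in \<open>blast intro: sA\<close>)+
    finally show ?thesis by (subst (asm) sum.swap)
  qed
  have 3: "trilinear (\<lambda>x y. block \<gamma> \<alpha> x * block \<gamma> \<beta> y) =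
    (\<Sum>i\<in>J \<alpha> \<gamma>. \<Sum>j\<in>J \<beta> \<gamma>. f (A i \<gamma> \<alpha>) * g (B i \<alpha> \<gamma> * A j \<gamma> \<beta>) * h (B j \<beta> \<gamma>))"
  proof -
    have "trilinear (\<lambda>x y. block \<gamma> \<alpha> x * block \<gamma> \<beta> y) =
      trilinear (\<lambda>x y. \<Sum>i\<in>J \<alpha> \<gamma>. \<Sum>j\<in>J \<beta> \<gamma>. A i \<gamma> \<alpha> * x * (B i \<alpha> \<gamma> * A j \<gamma> \<beta>) * y * B j \<beta> \<gamma>)"
      by (simp add: block_def sum_product mult.assoc)
    also have "\<dots> = (\<Sum>i\<in>J \<alpha> \<gamma>. \<Sum>j\<in>J \<beta> \<gamma>. f (A i \<gamma> \<alpha>) * g (B i \<alpha> \<gamma> * A j \<gamma> \<beta>) * h (B j \<beta> \<gamma>))"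
      unfolding trilinear_sum by (intro sum.cong refl trilinear_tensor) (use I in \<open>blast intro: sA\<close>)+
    finally show ?thesis .
  qed
  have 4: "trilinear (\<lambda>x y. if \<alpha> = \<beta> then \<Sum>\<nu>=1..m. block \<gamma> \<nu> (block \<nu> \<alpha> (x * y)) else 0) =
    of_bool (\<alpha> = \<beta>) * g (idm (n \<alpha>)) *
    (\<Sum>\<nu>=1..m. \<Sum>s\<in>J \<alpha> \<nu>. \<Sum>l\<in>J \<nu> \<gamma>. f (A l \<gamma> \<nu> * A s \<nu> \<alpha>) * h (B s \<alpha> \<nu> * B l \<nu> \<gamma>))"
  proof (cases "\<alpha> = \<beta>")
    case True
    \<comment> \<open>Nothing stands between x and y in R(R(xy)), so the identity is inserted to
      make it a tensor with middle factor 1.\<close>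
    have "trilinear (\<lambda>x y. \<Sum>\<nu>=1..m. block \<gamma> \<nu> (block \<nu> \<alpha> (x * y))) =
      trilinear (\<lambda>x y. \<Sum>\<nu>=1..m. \<Sum>l\<in>J \<nu> \<gamma>. \<Sum>s\<in>J \<alpha> \<nu>. (A l \<gamma> \<nu> * A s \<nu> \<alpha>) * x * idm (n \<alpha>) * y * (B s \<alpha> \<nu> * B l \<nu> \<gamma>))"
    proof (rule trilinear_cong)
      fix q r s t assume "q < n \<alpha>" "r < n \<alpha>" "s < n \<beta>" "t < n \<beta>"
      then have "unitm q r * (idm (n \<alpha>) * X) = unitm q r * X" for X
        using supp_times_idm[OF supp_unitm[of q "n \<alpha>" r "n \<alpha>"]] by (metis mult.assoc)
      then show "(\<Sum>\<nu>=1..m. block \<gamma> \<nu> (block \<nu> \<alpha> (unitm q r * unitm s t))) = (\<Sum>\<nu>=1..m. \<Sum>l\<in>J \<nu> \<gamma>. \<Sum>s'\<in>J \<alpha> \<nu>.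
        (A l \<gamma> \<nu> * A s' \<nu> \<alpha>) * unitm q r * idm (n \<alpha>) * unitm s t * (B s' \<alpha> \<nu> * B l \<nu> \<gamma>))"
        by (simp add: block_def sum_distrib_left sum_distrib_right mult.assoc)
    qed
    also have "\<dots> = (\<Sum>\<nu>=1..m. \<Sum>l\<in>J \<nu> \<gamma>. \<Sum>s\<in>J \<alpha> \<nu>. f (A l \<gamma> \<nu> * A s \<nu> \<alpha>) * g (idm (n \<alpha>)) * h (B s \<alpha> \<nu> * B l \<nu> \<gamma>))"
      unfolding trilinear_sum using True supp_idm[of "n \<alpha>"]
      by (intro sum.cong refl trilinear_tensor) (use I in \<open>blast intro: sA\<close>)+
    also have "\<dots> = (\<Sum>\<nu>=1..m. \<Sum>s\<in>J \<alpha> \<nu>. \<Sum>l\<in>J \<nu> \<gamma>. g (idm (n \<alpha>)) * (f (A l \<gamma> \<nu> * A s \<nu> \<alpha>) * h (B s \<alpha> \<nu> * B l \<nu> \<gamma>)))"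
      by (rule sum.cong[OF refl], subst sum.swap) (simp add: mult_ac)
    finally show ?thesis using True by (simp add: sum_distrib_left)
  qed (simp add: trilinear_zero)
  \<comment> \<open>The functional looks at matrix units alone, and on these the torsion has been
    identified with the coboundary.\<close>
  have "trilinear (\<lambda>x y. block \<gamma> \<beta> (block \<beta> \<alpha> x * y) + block \<gamma> \<alpha> (x * block \<alpha> \<beta> y)
    - (if \<alpha> = \<beta> then \<Sum>\<nu>=1..m. block \<gamma> \<nu> (block \<nu> \<alpha> (x * y)) else 0) - block \<gamma> \<alpha> x * block \<gamma> \<beta> y)
    = trilinear (\<lambda>x y. (if \<beta> = \<gamma> then primitive \<gamma> \<alpha> x * y else 0) + (if \<alpha> = \<gamma> then x * primitive \<gamma> \<beta> y else 0)
      - (if \<alpha> = \<beta> then primitive \<gamma> \<alpha> (x * y) else 0))"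
    by (rule trilinear_cong) (simp only: nijenhuis_inj_block[OF I(1,2), symmetric] nijenhuis_coboundary[OF I] supp_unitm)
  also have "\<dots> = of_bool (\<beta> = \<gamma>) * primitive_form \<gamma> \<alpha> f g * h (idm (n \<gamma>)) + of_bool (\<alpha> = \<gamma>) * f (idm (n \<gamma>)) * primitive_form \<gamma> \<beta> g h
    - of_bool (\<alpha> = \<beta>) * g (idm (n \<alpha>)) * primitive_form \<gamma> \<alpha> f h"
    unfolding trilinear_add trilinear_diff trilinear_if mult.assoc
    by (intro arg_cong2[where f = "(+)"] arg_cong2[where f = "(-)"] of_bool_eq_mult_cong
        trilinear_primitive_left trilinear_primitive_right trilinear_primitive_middle)
  finally show ?thesis unfolding trilinear_add trilinear_diff 1 2 3 4 .
qed

end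

end

text \<open>The summand $c_\alpha x$ of $R_{\alpha,\alpha}$ is treated as $a_0 x b^0$ with $a_0 = c_\alpha$ and $b^0 = 1$.\<close>

locale unital_block_operator =
  associative_block_operator m n "\<lambda>\<alpha> \<gamma>. if \<alpha> = \<gamma> then {0..p \<alpha> \<gamma>} else {1..p \<alpha> \<gamma>}" A B
  for m :: nat and n :: "nat \<Rightarrow> nat" and p :: "nat \<Rightarrow> nat \<Rightarrow> nat"
    and A B :: "nat \<Rightarrow> nat \<Rightarrow> nat \<Rightarrow> fmat" +
  assumes B_0: "\<And>\<alpha>. \<alpha> \<in> {1..m} \<Longrightarrow> B 0 \<alpha> \<alpha> = idm (n \<alpha>)"
begin

section \<open>Splitting off the summands with c\<close>

lemma sum_index:
  "(\<Sum>i\<in>(if \<alpha> = \<gamma> then {0..p \<alpha> \<gamma>} else {1..p \<alpha> \<gamma>}). F i) = (\<Sum>i=1..p \<alpha> \<gamma>. F i) + of_bool (\<alpha> = \<gamma>) * (F 0 :: complex)"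
  by (simp add: sum.atLeast_Suc_atMost)

lemma idm_times_A: "\<alpha> \<in> {1..m} \<Longrightarrow> \<beta> \<in> {1..m} \<Longrightarrow> i \<in> {1..p \<alpha> \<beta>} \<Longrightarrow> idm (n \<beta>) * A i \<beta> \<alpha> = A i \<beta> \<alpha>"
  by (rule idm_times_supp[OF supp_A]) auto

lemma A_times_idm: "\<alpha> \<in> {1..m} \<Longrightarrow> \<beta> \<in> {1..m} \<Longrightarrow> i \<in> {1..p \<alpha> \<beta>} \<Longrightarrow> A i \<beta> \<alpha> * idm (n \<alpha>) = A i \<beta> \<alpha>"
  by (rule supp_times_idm[OF supp_A]) auto

lemma idm_times_B: "\<alpha> \<in> {1..m} \<Longrightarrow> \<beta> \<in> {1..m} \<Longrightarrow> i \<in> {1..p \<alpha> \<beta>} \<Longrightarrow> idm (n \<alpha>) * B i \<alpha> \<beta> = B i \<alpha> \<beta>"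
  by (rule idm_times_supp[OF supp_B]) auto

lemma B_times_idm: "\<alpha> \<in> {1..m} \<Longrightarrow> \<beta> \<in> {1..m} \<Longrightarrow> i \<in> {1..p \<alpha> \<beta>} \<Longrightarrow> B i \<alpha> \<beta> * idm (n \<beta>) = B i \<alpha> \<beta>"
  by (rule supp_times_idm[OF supp_B]) auto

lemma idm_idm: "idm N * idm N = idm N"
  by (rule idm_times_supp[OF supp_idm])

text \<open>On a path from \<alpha> through \<nu> to \<gamma> the index 0 is available on diagonal
  blocks only. In the first step it forces \<nu> = \<alpha>, in the second \<nu> = \<gamma>, so the
  sum over \<nu> collapses.\<close>

lemma sum_square_index:
  assumes I: "\<alpha> \<in> {1..m}" "\<gamma> \<in> {1..m}"
  shows "(\<Sum>\<nu>=1..m. \<Sum>s\<in>(if \<alpha> = \<nu> then {0..p \<alpha> \<nu>} else {1..p \<alpha> \<nu>}). \<Sum>l\<in>(if \<nu> = \<gamma> then {0..p \<nu> \<gamma>} else {1..p \<nu> \<gamma>}). (F \<nu> s l :: complex))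
    = (\<Sum>\<nu>=1..m. \<Sum>s=1..p \<alpha> \<nu>. \<Sum>l=1..p \<nu> \<gamma>. F \<nu> s l)
      + (\<Sum>s=1..p \<alpha> \<gamma>. F \<gamma> s 0) + (\<Sum>l=1..p \<alpha> \<gamma>. F \<alpha> 0 l) + of_bool (\<alpha> = \<gamma>) * F \<alpha> 0 0"
proof -
  have 1: "(\<Sum>\<nu>=1..m. of_bool (\<alpha> = \<nu>) * X \<nu>) = X \<alpha>" for X :: "nat \<Rightarrow> complex"
  proof -
    have "(\<Sum>\<nu>=1..m. of_bool (\<alpha> = \<nu>) * X \<nu>) = (\<Sum>\<nu>=1..m. if \<nu> = \<alpha> then X \<alpha> else 0)"
      by (rule sum.cong) auto
    then show ?thesis using I by simp
  qed
  have 2: "(\<Sum>\<nu>=1..m. \<Sum>s=1..p \<alpha> \<nu>. of_bool (\<nu> = \<gamma>) * X \<nu> s) = (\<Sum>s=1..p \<alpha> \<gamma>. X \<gamma> s)" for X :: "nat \<Rightarrow> nat \<Rightarrow> complex"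
  proof -
    have "(\<Sum>\<nu>=1..m. \<Sum>s=1..p \<alpha> \<nu>. of_bool (\<nu> = \<gamma>) * X \<nu> s) = (\<Sum>\<nu>=1..m. if \<nu> = \<gamma> then (\<Sum>s=1..p \<alpha> \<gamma>. X \<gamma> s) else 0)"
      by (rule sum.cong) auto
    then show ?thesis using I by simp
  qed
  show ?thesis
    unfolding sum_index sum.distrib 1 2 by (simp add: add.assoc)
qed

text \<open>Since the index 0 has right factor 1, the outer index 0 of R(xR(y)) gives the same
  tensors as the index 0 of R(x) in R(x)R(y), and the inner index 0 of R(R(x)y) the same as that of
  R(R(xy)). These cancel; what remains of c is ca \<otimes> b \<otimes> 1, a \<otimes> c \<otimes>
  b, a \<otimes> bc \<otimes> 1 and ca \<otimes> 1 \<otimes> b. The parts of R(R(xy)) have middle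
  factor 1 and are moved to the side of S.\<close>

lemma torsion:
  assumes I: "\<alpha> \<in> {1..m}" "\<beta> \<in> {1..m}" "\<gamma> \<in> {1..m}" and lin: "lin_form f" "lin_form g" "lin_form h"
  shows "(\<Sum>i=1..p \<alpha> \<beta>. \<Sum>j=1..p \<beta> \<gamma>. f (A j \<gamma> \<beta> * A i \<beta> \<alpha>) * g (B i \<alpha> \<beta>) * h (B j \<beta> \<gamma>))
      + of_bool (\<beta> = \<gamma>) * h (idm (n \<gamma>)) * (\<Sum>i=1..p \<alpha> \<gamma>. f (A 0 \<gamma> \<gamma> * A i \<gamma> \<alpha>) * g (B i \<alpha> \<gamma>))
      + (\<Sum>i=1..p \<beta> \<alpha>. \<Sum>j=1..p \<alpha> \<gamma>. f (A j \<gamma> \<alpha>) * g (A i \<alpha> \<beta>) * h (B i \<beta> \<alpha> * B j \<alpha> \<gamma>))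
      + of_bool (\<alpha> = \<beta>) * g (A 0 \<alpha> \<alpha>) * (\<Sum>j=1..p \<alpha> \<gamma>. f (A j \<gamma> \<alpha>) * h (B j \<alpha> \<gamma>))
      - (\<Sum>i=1..p \<alpha> \<gamma>. \<Sum>j=1..p \<beta> \<gamma>. f (A i \<gamma> \<alpha>) * g (B i \<alpha> \<gamma> * A j \<gamma> \<beta>) * h (B j \<beta> \<gamma>))
      - of_bool (\<beta> = \<gamma>) * h (idm (n \<gamma>)) * (\<Sum>i=1..p \<alpha> \<gamma>. f (A i \<gamma> \<alpha>) * g (B i \<alpha> \<gamma> * A 0 \<gamma> \<gamma>))
      = of_bool (\<beta> = \<gamma>) * h (idm (n \<gamma>)) * primitive_form \<gamma> \<alpha> f g
        + of_bool (\<alpha> = \<gamma>) * f (idm (n \<gamma>)) * primitive_form \<alpha> \<beta> g h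
        - of_bool (\<alpha> = \<beta>) * g (idm (n \<alpha>)) * (primitive_form \<gamma> \<alpha> f h
          - (\<Sum>\<nu>=1..m. \<Sum>s=1..p \<alpha> \<nu>. \<Sum>l=1..p \<nu> \<gamma>. f (A l \<gamma> \<nu> * A s \<nu> \<alpha>) * h (B s \<alpha> \<nu> * B l \<nu> \<gamma>))
          - (\<Sum>s=1..p \<alpha> \<gamma>. f (A 0 \<gamma> \<gamma> * A s \<gamma> \<alpha>) * h (B s \<alpha> \<gamma>)))"
proof -
  let ?J = "\<lambda>\<alpha> \<gamma>. if \<alpha> = \<gamma> then {0..p \<alpha> \<gamma>} else {1..p \<alpha> \<gamma>}"
  have A_0: "idm (n x) * A 0 x x = A 0 x x" if "x \<in> {1..m}" for x
    using supp_A[of x x 0] that by (intro idm_times_supp) auto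
  have split: "(\<Sum>i\<in>?J x y. \<Sum>j\<in>?J z w. F i j) = (\<Sum>i=1..p x y. \<Sum>j=1..p z w. F i j)
    + of_bool (z = w) * (\<Sum>i=1..p x y. F i 0) + of_bool (x = y) * (\<Sum>j=1..p z w. F 0 j)
    + of_bool (x = y) * (of_bool (z = w) * F 0 0)" for x y z w and F :: "nat \<Rightarrow> nat \<Rightarrow> complex"
    unfolding sum_index sum.distrib sum_distrib_left[symmetric] by (simp only: distrib_left add_ac mult_ac)
  note eqs = arg_cong2[where f = "(+)"] of_bool_eq_mult_cong refl
  have E1: "(\<Sum>i\<in>?J \<alpha> \<beta>. \<Sum>j\<in>?J \<beta> \<gamma>. f (A j \<gamma> \<beta> * A i \<beta> \<alpha>) * g (B i \<alpha> \<beta>) * h (B j \<beta> \<gamma>))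
    = (\<Sum>i=1..p \<alpha> \<beta>. \<Sum>j=1..p \<beta> \<gamma>. f (A j \<gamma> \<beta> * A i \<beta> \<alpha>) * g (B i \<alpha> \<beta>) * h (B j \<beta> \<gamma>))
    + of_bool (\<beta> = \<gamma>) * (h (idm (n \<gamma>)) * (\<Sum>i=1..p \<alpha> \<gamma>. f (A 0 \<gamma> \<gamma> * A i \<gamma> \<alpha>) * g (B i \<alpha> \<gamma>)))
    + of_bool (\<alpha> = \<beta>) * (g (idm (n \<alpha>)) * (\<Sum>i=1..p \<alpha> \<gamma>. f (A i \<gamma> \<alpha> * A 0 \<alpha> \<alpha>) * h (B i \<alpha> \<gamma>)))
    + of_bool (\<alpha> = \<beta>) * (of_bool (\<beta> = \<gamma>) * (f (A 0 \<alpha> \<alpha> * A 0 \<alpha> \<alpha>) * g (idm (n \<alpha>)) * h (idm (n \<alpha>))))"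
    unfolding split using I by (intro eqs) (simp_all add: B_0 sum_distrib_left mult_ac)
  have E2: "(\<Sum>i\<in>?J \<beta> \<alpha>. \<Sum>j\<in>?J \<alpha> \<gamma>. f (A j \<gamma> \<alpha>) * g (A i \<alpha> \<beta>) * h (B i \<beta> \<alpha> * B j \<alpha> \<gamma>))
    = (\<Sum>i=1..p \<beta> \<alpha>. \<Sum>j=1..p \<alpha> \<gamma>. f (A j \<gamma> \<alpha>) * g (A i \<alpha> \<beta>) * h (B i \<beta> \<alpha> * B j \<alpha> \<gamma>))
    + of_bool (\<alpha> = \<gamma>) * (f (A 0 \<gamma> \<gamma>) * (\<Sum>i=1..p \<beta> \<gamma>. g (A i \<gamma> \<beta>) * h (B i \<beta> \<gamma>)))
    + of_bool (\<beta> = \<alpha>) * (g (A 0 \<alpha> \<alpha>) * (\<Sum>i=1..p \<alpha> \<gamma>. f (A i \<gamma> \<alpha>) * h (B i \<alpha> \<gamma>)))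
    + of_bool (\<beta> = \<alpha>) * (of_bool (\<alpha> = \<gamma>) * (f (A 0 \<alpha> \<alpha>) * g (A 0 \<alpha> \<alpha>) * h (idm (n \<alpha>))))"
    unfolding split
  proof (intro eqs)
    assume "\<alpha> = \<gamma>"
    moreover have "(\<Sum>i=1..p \<beta> \<gamma>. f (A 0 \<gamma> \<gamma>) * g (A i \<gamma> \<beta>) * h (B i \<beta> \<gamma> * B 0 \<gamma> \<gamma>))
      = (\<Sum>i=1..p \<beta> \<gamma>. f (A 0 \<gamma> \<gamma>) * g (A i \<gamma> \<beta>) * h (B i \<beta> \<gamma>))"
      using B_times_idm[OF I(2,3)] I by (intro sum.cong) (simp_all add: B_0)
    ultimately show "(\<Sum>i=1..p \<beta> \<alpha>. f (A 0 \<gamma> \<alpha>) * g (A i \<alpha> \<beta>) * h (B i \<beta> \<alpha> * B 0 \<alpha> \<gamma>))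
      = f (A 0 \<gamma> \<gamma>) * (\<Sum>i=1..p \<beta> \<gamma>. g (A i \<gamma> \<beta>) * h (B i \<beta> \<gamma>))"
      by (simp add: sum_distrib_left mult_ac)
  next
    assume "\<beta> = \<alpha>"
    moreover have "(\<Sum>i=1..p \<alpha> \<gamma>. f (A i \<gamma> \<alpha>) * g (A 0 \<alpha> \<alpha>) * h (B 0 \<alpha> \<alpha> * B i \<alpha> \<gamma>))
      = (\<Sum>i=1..p \<alpha> \<gamma>. f (A i \<gamma> \<alpha>) * g (A 0 \<alpha> \<alpha>) * h (B i \<alpha> \<gamma>))"
      using idm_times_B[OF I(1,3)] I by (intro sum.cong) (simp_all add: B_0)
    ultimately show "(\<Sum>i=1..p \<alpha> \<gamma>. f (A i \<gamma> \<alpha>) * g (A 0 \<alpha> \<beta>) * h (B 0 \<beta> \<alpha> * B i \<alpha> \<gamma>))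
      = g (A 0 \<alpha> \<alpha>) * (\<Sum>i=1..p \<alpha> \<gamma>. f (A i \<gamma> \<alpha>) * h (B i \<alpha> \<gamma>))"
      by (simp add: sum_distrib_left mult_ac)
  qed (use I in \<open>simp_all add: B_0 idm_idm\<close>)
  have E3: "(\<Sum>i\<in>?J \<alpha> \<gamma>. \<Sum>j\<in>?J \<beta> \<gamma>. f (A i \<gamma> \<alpha>) * g (B i \<alpha> \<gamma> * A j \<gamma> \<beta>) * h (B j \<beta> \<gamma>))
    = (\<Sum>i=1..p \<alpha> \<gamma>. \<Sum>j=1..p \<beta> \<gamma>. f (A i \<gamma> \<alpha>) * g (B i \<alpha> \<gamma> * A j \<gamma> \<beta>) * h (B j \<beta> \<gamma>))
    + of_bool (\<beta> = \<gamma>) * (h (idm (n \<gamma>)) * (\<Sum>i=1..p \<alpha> \<gamma>. f (A i \<gamma> \<alpha>) * g (B i \<alpha> \<gamma> * A 0 \<gamma> \<gamma>)))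
    + of_bool (\<alpha> = \<gamma>) * (f (A 0 \<gamma> \<gamma>) * (\<Sum>i=1..p \<beta> \<gamma>. g (A i \<gamma> \<beta>) * h (B i \<beta> \<gamma>)))
    + of_bool (\<alpha> = \<gamma>) * (of_bool (\<beta> = \<gamma>) * (f (A 0 \<alpha> \<alpha>) * g (A 0 \<alpha> \<alpha>) * h (idm (n \<alpha>))))"
    unfolding split
  proof (intro eqs)
    assume "\<alpha> = \<gamma>"
    moreover have "(\<Sum>i=1..p \<beta> \<gamma>. f (A 0 \<gamma> \<gamma>) * g (B 0 \<gamma> \<gamma> * A i \<gamma> \<beta>) * h (B i \<beta> \<gamma>))
      = (\<Sum>i=1..p \<beta> \<gamma>. f (A 0 \<gamma> \<gamma>) * g (A i \<gamma> \<beta>) * h (B i \<beta> \<gamma>))"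
      using idm_times_A[OF I(2,3)] I by (intro sum.cong) (simp_all add: B_0)
    ultimately show "(\<Sum>i=1..p \<beta> \<gamma>. f (A 0 \<gamma> \<alpha>) * g (B 0 \<alpha> \<gamma> * A i \<gamma> \<beta>) * h (B i \<beta> \<gamma>))
      = f (A 0 \<gamma> \<gamma>) * (\<Sum>i=1..p \<beta> \<gamma>. g (A i \<gamma> \<beta>) * h (B i \<beta> \<gamma>))"
      by (simp add: sum_distrib_left mult_ac)
  qed (use I in \<open>simp_all add: B_0 A_0 sum_distrib_left mult_ac\<close>)
  have E4: "(\<Sum>\<nu>=1..m. \<Sum>s\<in>?J \<alpha> \<nu>. \<Sum>l\<in>?J \<nu> \<gamma>. f (A l \<gamma> \<nu> * A s \<nu> \<alpha>) * h (B s \<alpha> \<nu> * B l \<nu> \<gamma>))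
    = (\<Sum>\<nu>=1..m. \<Sum>s=1..p \<alpha> \<nu>. \<Sum>l=1..p \<nu> \<gamma>. f (A l \<gamma> \<nu> * A s \<nu> \<alpha>) * h (B s \<alpha> \<nu> * B l \<nu> \<gamma>))
    + (\<Sum>s=1..p \<alpha> \<gamma>. f (A 0 \<gamma> \<gamma> * A s \<gamma> \<alpha>) * h (B s \<alpha> \<gamma>))
    + (\<Sum>l=1..p \<alpha> \<gamma>. f (A l \<gamma> \<alpha> * A 0 \<alpha> \<alpha>) * h (B l \<alpha> \<gamma>))
    + of_bool (\<alpha> = \<gamma>) * (f (A 0 \<alpha> \<alpha> * A 0 \<alpha> \<alpha>) * h (idm (n \<alpha>)))"
    unfolding sum_square_index[OF I(1,3)]
    using I B_times_idm[OF I(1,3)] idm_times_B[OF I(1,3)]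
    by (intro eqs sum.cong) (simp_all add: B_0 idm_idm)
  \<comment> \<open>The delta allows the target block of this primitive to be renamed from \<gamma>
    to \<alpha>, the form in which the equation is used later.\<close>
  have S: "of_bool (\<alpha> = \<gamma>) * (f (idm (n \<gamma>)) * primitive_form \<gamma> \<beta> g h) = of_bool (\<alpha> = \<gamma>) * (f (idm (n \<gamma>)) * primitive_form \<alpha> \<beta> g h)"
    by (rule of_bool_eq_mult_cong) simp
  have bools: "of_bool (\<alpha> = \<beta>) * (of_bool (\<beta> = \<gamma>) * x) = of_bool (\<alpha> = \<beta>) * (of_bool (\<alpha> = \<gamma>) * x)"
    "of_bool (\<alpha> = \<gamma>) * (of_bool (\<beta> = \<gamma>) * x) = of_bool (\<alpha> = \<beta>) * (of_bool (\<alpha> = \<gamma>) * x)"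
    "of_bool (\<beta> = \<alpha>) = (of_bool (\<alpha> = \<beta>) :: complex)" for x :: complex
    by auto
  \<comment> \<open>The cancellation as an identity between complex variables: y2 and y4 occur on
    both sides, while x3 and x4 are the terms that R(R(xy)) repeats with the factor g(1).\<close>
  have "x1 + bc * x2 + ab * x3 + ab * (ac * x4) + (y1 + ac * y2 + ab * y3 + ab * (ac * y4))
      - ab * ge * (q1 + q2 + q3 + ac * q4) - (z1 + bc * z2 + ac * y2 + ab * (ac * y4)) = bc * s1 * he + ac * (fe * s2) - ab * ge * s3 \<Longrightarrow>
      x3 = ge * q3 \<Longrightarrow> x4 = ge * q4 \<Longrightarrow>
    x1 + bc * x2 + y1 + ab * y3 - z1 - bc * z2 = bc * he * s1 + ac * fe * s2 - ab * ge * (s3 - q1 - q2)"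
    for x1 x2 x3 x4 y1 y2 y3 y4 z1 z2 q1 q2 q3 q4 s1 s2 s3 ab ac bc fe ge he :: complex
    by (simp add: algebra_simps)
  from this[OF torsion_tensor[OF I lin, unfolded E1 E2 E3 E4 bools mult.assoc[of "of_bool (\<alpha> = \<gamma>)"] S]]
  show ?thesis by (simp only: mult.assoc refl mult.left_commute mult.commute)
qed

end

section \<open>Structure constants\<close>

lemma lin_form_eqI: "(\<And>f. lin_form f \<Longrightarrow> f x = f y) \<Longrightarrow> x = y"
  by (rule fmat_eqI) (use lin_form_ent in blast)

text \<open>\<open>as \<gamma> \<alpha> i\<close> and \<open>bs \<alpha> \<gamma> i\<close> are coordinate functionals of the families
  $\{1, a_{i,\gamma,\alpha}\}$ and $\{1, b^i_{\alpha,\gamma}\}$ (with $1$ only for $\alpha = \gamma$), and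
  \<open>ae \<alpha>\<close>, \<open>be \<alpha>\<close> are those of $1$. The assumption \<open>torsion\<close> is the equation that the torsion of $R$
  is the coboundary of $S$, evaluated on $f \otimes g \otimes h$; the terms
  $c \otimes a \otimes b$, $c \otimes c \otimes 1$, $ac \otimes 1 \otimes b$ and $cc \otimes 1 \otimes 1$ cancel.\<close>

locale tensor_data =
  fixes m :: nat and p :: "nat \<Rightarrow> nat \<Rightarrow> nat"
    and a b :: "nat \<Rightarrow> nat \<Rightarrow> nat \<Rightarrow> fmat" and c e :: "nat \<Rightarrow> fmat"
    and as bs :: "nat \<Rightarrow> nat \<Rightarrow> nat \<Rightarrow> fmat \<Rightarrow> complex"
    and ae be :: "nat \<Rightarrow> fmat \<Rightarrow> complex"
    and S :: "nat \<Rightarrow> nat \<Rightarrow> (fmat \<Rightarrow> complex) \<Rightarrow> (fmat \<Rightarrow> complex) \<Rightarrow> complex"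
  assumes e_a: "\<And>\<alpha> \<beta> i. \<alpha> \<in> {1..m} \<Longrightarrow> \<beta> \<in> {1..m} \<Longrightarrow> i \<in> {1..p \<alpha> \<beta>} \<Longrightarrow> e \<beta> * a i \<beta> \<alpha> = a i \<beta> \<alpha>"
    and a_e: "\<And>\<alpha> \<beta> i. \<alpha> \<in> {1..m} \<Longrightarrow> \<beta> \<in> {1..m} \<Longrightarrow> i \<in> {1..p \<alpha> \<beta>} \<Longrightarrow> a i \<beta> \<alpha> * e \<alpha> = a i \<beta> \<alpha>"
    and e_b: "\<And>\<alpha> \<beta> i. \<alpha> \<in> {1..m} \<Longrightarrow> \<beta> \<in> {1..m} \<Longrightarrow> i \<in> {1..p \<alpha> \<beta>} \<Longrightarrow> e \<alpha> * b i \<alpha> \<beta> = b i \<alpha> \<beta>"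
    and b_e: "\<And>\<alpha> \<beta> i. \<alpha> \<in> {1..m} \<Longrightarrow> \<beta> \<in> {1..m} \<Longrightarrow> i \<in> {1..p \<alpha> \<beta>} \<Longrightarrow> b i \<alpha> \<beta> * e \<beta> = b i \<alpha> \<beta>"
    and lin_form_as: "\<And>\<alpha> \<beta> i. \<alpha> \<in> {1..m} \<Longrightarrow> \<beta> \<in> {1..m} \<Longrightarrow> i \<in> {1..p \<alpha> \<beta>} \<Longrightarrow> lin_form (as \<beta> \<alpha> i)"
    and as_a: "\<And>\<alpha> \<beta> i j. \<alpha> \<in> {1..m} \<Longrightarrow> \<beta> \<in> {1..m} \<Longrightarrow> i \<in> {1..p \<alpha> \<beta>} \<Longrightarrow> j \<in> {1..p \<alpha> \<beta>} \<Longrightarrow>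
      as \<beta> \<alpha> i (a j \<beta> \<alpha>) = of_bool (i = j)"
    and as_e: "\<And>\<alpha> i. \<alpha> \<in> {1..m} \<Longrightarrow> i \<in> {1..p \<alpha> \<alpha>} \<Longrightarrow> as \<alpha> \<alpha> i (e \<alpha>) = 0"
    and lin_form_bs: "\<And>\<alpha> \<beta> i. \<alpha> \<in> {1..m} \<Longrightarrow> \<beta> \<in> {1..m} \<Longrightarrow> i \<in> {1..p \<alpha> \<beta>} \<Longrightarrow> lin_form (bs \<alpha> \<beta> i)"
    and bs_b: "\<And>\<alpha> \<beta> i j. \<alpha> \<in> {1..m} \<Longrightarrow> \<beta> \<in> {1..m} \<Longrightarrow> i \<in> {1..p \<alpha> \<beta>} \<Longrightarrow> j \<in> {1..p \<alpha> \<beta>} \<Longrightarrow>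
      bs \<alpha> \<beta> i (b j \<alpha> \<beta>) = of_bool (i = j)"
    and bs_e: "\<And>\<alpha> i. \<alpha> \<in> {1..m} \<Longrightarrow> i \<in> {1..p \<alpha> \<alpha>} \<Longrightarrow> bs \<alpha> \<alpha> i (e \<alpha>) = 0"
    and lin_form_ae: "\<And>\<alpha>. \<alpha> \<in> {1..m} \<Longrightarrow> lin_form (ae \<alpha>)"
    and ae_a: "\<And>\<alpha> i. \<alpha> \<in> {1..m} \<Longrightarrow> i \<in> {1..p \<alpha> \<alpha>} \<Longrightarrow> ae \<alpha> (a i \<alpha> \<alpha>) = 0"
    and ae_e: "\<And>\<alpha>. \<alpha> \<in> {1..m} \<Longrightarrow> ae \<alpha> (e \<alpha>) = 1"
    and lin_form_be: "\<And>\<alpha>. \<alpha> \<in> {1..m} \<Longrightarrow> lin_form (be \<alpha>)"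
    and be_b: "\<And>\<alpha> i. \<alpha> \<in> {1..m} \<Longrightarrow> i \<in> {1..p \<alpha> \<alpha>} \<Longrightarrow> be \<alpha> (b i \<alpha> \<alpha>) = 0"
    and be_e: "\<And>\<alpha>. \<alpha> \<in> {1..m} \<Longrightarrow> be \<alpha> (e \<alpha>) = 1"
    and torsion: "\<And>\<alpha> \<beta> \<gamma> f g h. \<alpha> \<in> {1..m} \<Longrightarrow> \<beta> \<in> {1..m} \<Longrightarrow> \<gamma> \<in> {1..m} \<Longrightarrow>
      lin_form f \<Longrightarrow> lin_form g \<Longrightarrow> lin_form h \<Longrightarrow>
      (\<Sum>i=1..p \<alpha> \<beta>. \<Sum>j=1..p \<beta> \<gamma>. f (a j \<gamma> \<beta> * a i \<beta> \<alpha>) * g (b i \<alpha> \<beta>) * h (b j \<beta> \<gamma>))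
      + of_bool (\<beta> = \<gamma>) * h (e \<gamma>) * (\<Sum>i=1..p \<alpha> \<gamma>. f (c \<gamma> * a i \<gamma> \<alpha>) * g (b i \<alpha> \<gamma>))
      + (\<Sum>i=1..p \<beta> \<alpha>. \<Sum>j=1..p \<alpha> \<gamma>. f (a j \<gamma> \<alpha>) * g (a i \<alpha> \<beta>) * h (b i \<beta> \<alpha> * b j \<alpha> \<gamma>))
      + of_bool (\<alpha> = \<beta>) * g (c \<alpha>) * (\<Sum>j=1..p \<alpha> \<gamma>. f (a j \<gamma> \<alpha>) * h (b j \<alpha> \<gamma>))
      - (\<Sum>i=1..p \<alpha> \<gamma>. \<Sum>j=1..p \<beta> \<gamma>. f (a i \<gamma> \<alpha>) * g (b i \<alpha> \<gamma> * a j \<gamma> \<beta>) * h (b j \<beta> \<gamma>))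
      - of_bool (\<beta> = \<gamma>) * h (e \<gamma>) * (\<Sum>i=1..p \<alpha> \<gamma>. f (a i \<gamma> \<alpha>) * g (b i \<alpha> \<gamma> * c \<gamma>))
      = of_bool (\<beta> = \<gamma>) * h (e \<gamma>) * S \<gamma> \<alpha> f g
        + of_bool (\<alpha> = \<gamma>) * f (e \<gamma>) * S \<alpha> \<beta> g h
        - of_bool (\<alpha> = \<beta>) * g (e \<alpha>) * (S \<gamma> \<alpha> f h
          - (\<Sum>\<nu>=1..m. \<Sum>s=1..p \<alpha> \<nu>. \<Sum>l=1..p \<nu> \<gamma>. f (a l \<gamma> \<nu> * a s \<nu> \<alpha>) * h (b s \<alpha> \<nu> * b l \<nu> \<gamma>))
          - (\<Sum>s=1..p \<alpha> \<gamma>. f (c \<gamma> * a s \<gamma> \<alpha>) * h (b s \<alpha> \<gamma>)))"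
begin

section \<open>Structure constants and the products aa, bb and ba\<close>

text \<open>The constants are defined as values of coordinate functionals, before anything is known
  about the products. An expansion then only requires that the product lies in the right
  span.\<close>

definition "\<phi> k i j \<alpha> \<beta> \<gamma> = as \<alpha> \<gamma> k (a i \<alpha> \<beta> * a j \<beta> \<gamma>)"
definition "\<mu> i j \<alpha> \<beta> = ae \<alpha> (a i \<alpha> \<beta> * a j \<beta> \<alpha>)"
definition "\<psi> i j k \<alpha> \<beta> \<gamma> = bs \<alpha> \<gamma> k (b i \<alpha> \<beta> * b j \<beta> \<gamma>)"
definition "lam i j \<alpha> \<beta> = be \<alpha> (b i \<alpha> \<beta> * b j \<beta> \<alpha>)"
text \<open>The coefficient of 1 in ba once all other terms have been subtracted. The subtraction is
  explicit because \<open>ae \<alpha>\<close> is prescribed on 1 and the a's only and may take any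
  values on the b's and on c.\<close>

definition "t i j \<alpha> \<beta> = ae \<alpha> (b i \<alpha> \<beta> * a j \<beta> \<alpha>
  - (\<Sum>k=1..p \<alpha> \<alpha>. \<phi> i j k \<beta> \<alpha> \<alpha> *\<^sub>C b k \<alpha> \<alpha>) - (\<Sum>k=1..p \<alpha> \<alpha>. \<psi> k i j \<alpha> \<alpha> \<beta> *\<^sub>C a k \<alpha> \<alpha>)
  - of_bool (i = j) *\<^sub>C c \<alpha>)"

lemma as_e': "\<alpha> \<in> {1..m} \<Longrightarrow> \<beta> \<in> {1..m} \<Longrightarrow> i \<in> {1..p \<alpha> \<beta>} \<Longrightarrow> of_bool (\<alpha> = \<beta>) * as \<beta> \<alpha> i (e \<beta>) = 0"
  and bs_e': "\<alpha> \<in> {1..m} \<Longrightarrow> \<beta> \<in> {1..m} \<Longrightarrow> i \<in> {1..p \<alpha> \<beta>} \<Longrightarrow> of_bool (\<alpha> = \<beta>) * bs \<alpha> \<beta> i (e \<beta>) = 0"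
  using as_e bs_e by auto

lemma sum_as_a:
  assumes "\<alpha> \<in> {1..m}" "\<beta> \<in> {1..m}" "i \<in> {1..p \<alpha> \<beta>}"
  shows "(\<Sum>j=1..p \<alpha> \<beta>. as \<beta> \<alpha> i (a j \<beta> \<alpha>) * F j) = F i"
proof -
  have "(\<Sum>j=1..p \<alpha> \<beta>. as \<beta> \<alpha> i (a j \<beta> \<alpha>) * F j) = (\<Sum>j=1..p \<alpha> \<beta>. if j = i then F j else 0)"
    by (rule sum.cong) (use assms as_a in auto)
  then show ?thesis using assms by simp
qed

lemma sum_bs_b:
  assumes "\<alpha> \<in> {1..m}" "\<beta> \<in> {1..m}" "i \<in> {1..p \<alpha> \<beta>}"
  shows "(\<Sum>j=1..p \<alpha> \<beta>. bs \<alpha> \<beta> i (b j \<alpha> \<beta>) * F j) = F i"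
proof -
  have "(\<Sum>j=1..p \<alpha> \<beta>. bs \<alpha> \<beta> i (b j \<alpha> \<beta>) * F j) = (\<Sum>j=1..p \<alpha> \<beta>. if j = i then F j else 0)"
    by (rule sum.cong) (use assms bs_b in auto)
  then show ?thesis using assms by simp
qed

text \<open>If every functional of x has the shape of a combination of the a's and 1, with whatever
  coefficients, then the dual functionals recover these coefficients. Thus the complicated
  \<open>C\<close> and \<open>D\<close>, with S among their ingredients, never have to be
  computed.\<close>

lemma expand_a:
  assumes I: "\<alpha> \<in> {1..m}" "\<gamma> \<in> {1..m}"
    and f: "\<And>f. lin_form f \<Longrightarrow> f x = (\<Sum>k=1..p \<gamma> \<alpha>. C k * f (a k \<alpha> \<gamma>)) + of_bool (\<alpha> = \<gamma>) * D * f (e \<alpha>)"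
  shows "x = (\<Sum>k=1..p \<gamma> \<alpha>. as \<alpha> \<gamma> k x *\<^sub>C a k \<alpha> \<gamma>) + (of_bool (\<alpha> = \<gamma>) * ae \<alpha> x) *\<^sub>C e \<alpha>"
proof -
  have C: "as \<alpha> \<gamma> k x = C k" if "k \<in> {1..p \<gamma> \<alpha>}" for k
    using f[OF lin_form_as[OF I(2,1) that]] sum_as_a[OF I(2,1) that, of C] as_e'[OF I(2,1) that]
    by (auto simp: mult.commute)
  have D: "of_bool (\<alpha> = \<gamma>) * ae \<alpha> x = of_bool (\<alpha> = \<gamma>) * D"
    using f[OF lin_form_ae[OF I(1)]] ae_a[OF I(1)] ae_e[OF I(1)] by auto
  show ?thesis
    unfolding D by (rule lin_form_eqI) (simp add: f lin_form_simps C)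
qed

lemma expand_b:
  assumes I: "\<alpha> \<in> {1..m}" "\<gamma> \<in> {1..m}"
    and f: "\<And>f. lin_form f \<Longrightarrow> f x = (\<Sum>k=1..p \<alpha> \<gamma>. C k * f (b k \<alpha> \<gamma>)) + of_bool (\<alpha> = \<gamma>) * D * f (e \<alpha>)"
  shows "x = (\<Sum>k=1..p \<alpha> \<gamma>. bs \<alpha> \<gamma> k x *\<^sub>C b k \<alpha> \<gamma>) + (of_bool (\<alpha> = \<gamma>) * be \<alpha> x) *\<^sub>C e \<alpha>"
proof -
  have C: "bs \<alpha> \<gamma> k x = C k" if "k \<in> {1..p \<alpha> \<gamma>}" for k
    using f[OF lin_form_bs[OF I that]] sum_bs_b[OF I that, of C] bs_e'[OF I that]
    by (auto simp: mult.commute)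
  have D: "of_bool (\<alpha> = \<gamma>) * be \<alpha> x = of_bool (\<alpha> = \<gamma>) * D"
    using f[OF lin_form_be[OF I(1)]] be_b[OF I(1)] be_e[OF I(1)] by auto
  show ?thesis
    unfolding D by (rule lin_form_eqI) (simp add: f lin_form_simps C)
qed

text \<open>Contract the last two tensor factors with functionals dual to the b's. The sum over aa
  \<otimes> b \<otimes> b collapses to the required product, the terms with 1 in the second or third
  factor vanish, and everything else has some a_k or 1 in its first factor.\<close>

lemma a_times_a:
  assumes I: "\<alpha> \<in> {1..m}" "\<beta> \<in> {1..m}" "\<gamma> \<in> {1..m}" and i: "i \<in> {1..p \<beta> \<alpha>}" and j: "j \<in> {1..p \<gamma> \<beta>}"
  shows "a i \<alpha> \<beta> * a j \<beta> \<gamma> =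
    (\<Sum>k=1..p \<gamma> \<alpha>. \<phi> k i j \<alpha> \<beta> \<gamma> *\<^sub>C a k \<alpha> \<gamma>) + (of_bool (\<alpha> = \<gamma>) * \<mu> i j \<alpha> \<beta>) *\<^sub>C e \<alpha>"
proof -
  define g where "g = bs \<gamma> \<beta> j"
  define h where "h = bs \<beta> \<alpha> i"
  have lin: "lin_form g" "lin_form h" unfolding g_def h_def using I i j by (blast intro: lin_form_bs)+
  \<comment> \<open>The coefficient of a_k collects a \<otimes> a \<otimes> bb, a \<otimes> c
    \<otimes> b and a \<otimes> ba \<otimes> b, after the last two factors have been
    evaluated.\<close>
  define C where "C k = - (\<Sum>i=1..p \<beta> \<gamma>. g (a i \<gamma> \<beta>) * h (b i \<beta> \<gamma> * b k \<gamma> \<alpha>))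
      - of_bool (\<gamma> = \<beta>) * g (c \<gamma>) * h (b k \<gamma> \<alpha>)
      + (\<Sum>j=1..p \<beta> \<alpha>. g (b k \<gamma> \<alpha> * a j \<alpha> \<beta>) * h (b j \<beta> \<alpha>))" for k
  have "f (a i \<alpha> \<beta> * a j \<beta> \<gamma>) = (\<Sum>k=1..p \<gamma> \<alpha>. C k * f (a k \<alpha> \<gamma>)) + of_bool (\<alpha> = \<gamma>) * S \<gamma> \<beta> g h * f (e \<alpha>)"
    if f: "lin_form f" for f
  proof -
    have 1: "(\<Sum>i=1..p \<gamma> \<beta>. \<Sum>j=1..p \<beta> \<alpha>. f (a j \<alpha> \<beta> * a i \<beta> \<gamma>) * g (b i \<gamma> \<beta>) * h (b j \<beta> \<alpha>)) = f (a i \<alpha> \<beta> * a j \<beta> \<gamma>)"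
      using sum_bs_b[OF I(3,2) j, of "\<lambda>k. \<Sum>l=1..p \<beta> \<alpha>. bs \<beta> \<alpha> i (b l \<beta> \<alpha>) * f (a l \<alpha> \<beta> * a k \<beta> \<gamma>)"]
        sum_bs_b[OF I(2,1) i, of "\<lambda>l. f (a l \<alpha> \<beta> * a j \<beta> \<gamma>)"]
      by (simp add: g_def h_def sum_distrib_left mult_ac)
    \<comment> \<open>Either the delta is 0, or the block is diagonal and the dual functional was
      chosen to vanish on 1.\<close>
    have 2: "of_bool (\<gamma> = \<beta>) * g (e \<gamma>) = 0" "of_bool (\<beta> = \<alpha>) * h (e \<alpha>) = 0"
      using bs_e'[OF I(3,2) j] bs_e'[OF I(2,1) i] by (auto simp: g_def h_def)
    have 3: "(\<Sum>i=1..p \<beta> \<gamma>. \<Sum>k=1..p \<gamma> \<alpha>. f (a k \<alpha> \<gamma>) * g (a i \<gamma> \<beta>) * h (b i \<beta> \<gamma> * b k \<gamma> \<alpha>))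
       = (\<Sum>k=1..p \<gamma> \<alpha>. (\<Sum>i=1..p \<beta> \<gamma>. g (a i \<gamma> \<beta>) * h (b i \<beta> \<gamma> * b k \<gamma> \<alpha>)) * f (a k \<alpha> \<gamma>))"
      by (subst sum.swap) (simp add: sum_distrib_left sum_distrib_right mult_ac)
    show ?thesis
      using torsion[OF I(3,2,1) f lin] unfolding 1 2 3
      by (auto simp: C_def sum.distrib sum_subtractf sum_negf sum_distrib_left sum_distrib_right algebra_simps)
  qed
  from expand_a[OF I(1,3) this] show ?thesis by (auto simp: \<phi>_def \<mu>_def)
qed

text \<open>The same contraction on the first two factors, with functionals dual to the a's,
  isolates the third factor of a \<otimes> a \<otimes> bb.\<close>

lemma b_times_b:
  assumes I: "\<alpha> \<in> {1..m}" "\<beta> \<in> {1..m}" "\<gamma> \<in> {1..m}" and i: "i \<in> {1..p \<alpha> \<beta>}" and j: "j \<in> {1..p \<beta> \<gamma>}"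
  shows "b i \<alpha> \<beta> * b j \<beta> \<gamma> =
    (\<Sum>k=1..p \<alpha> \<gamma>. \<psi> i j k \<alpha> \<beta> \<gamma> *\<^sub>C b k \<alpha> \<gamma>) + (of_bool (\<alpha> = \<gamma>) * lam i j \<alpha> \<beta>) *\<^sub>C e \<alpha>"
proof -
  define f where "f = as \<gamma> \<beta> j"
  define g where "g = as \<beta> \<alpha> i"
  have lin: "lin_form f" "lin_form g" unfolding f_def g_def using I i j by (blast intro: lin_form_as)+
  define C where "C k = - (\<Sum>i=1..p \<beta> \<alpha>. f (a k \<gamma> \<alpha> * a i \<alpha> \<beta>) * g (b i \<beta> \<alpha>))
      - of_bool (\<beta> = \<alpha>) * g (c \<beta>) * f (a k \<gamma> \<beta>)
      + (\<Sum>i=1..p \<beta> \<gamma>. f (a i \<gamma> \<beta>) * g (b i \<beta> \<gamma> * a k \<gamma> \<alpha>))" for k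
  \<comment> \<open>Unlike for aa, the tensors ca \<otimes> b \<otimes> 1 and a \<otimes> bc
    \<otimes> 1 survive here. Their third factor is 1, so they join S in the coefficient of the
    identity.\<close>
  define D where "D = S \<gamma> \<beta> f g - (\<Sum>i=1..p \<beta> \<gamma>. f (c \<gamma> * a i \<gamma> \<beta>) * g (b i \<beta> \<gamma>))
      + (\<Sum>i=1..p \<beta> \<gamma>. f (a i \<gamma> \<beta>) * g (b i \<beta> \<gamma> * c \<gamma>))"
  have "h (b i \<alpha> \<beta> * b j \<beta> \<gamma>) = (\<Sum>k=1..p \<alpha> \<gamma>. C k * h (b k \<alpha> \<gamma>)) + of_bool (\<alpha> = \<gamma>) * D * h (e \<alpha>)"
    if h: "lin_form h" for h
  proof -
    have 1: "(\<Sum>i=1..p \<alpha> \<beta>. \<Sum>j=1..p \<beta> \<gamma>. f (a j \<gamma> \<beta>) * g (a i \<beta> \<alpha>) * h (b i \<alpha> \<beta> * b j \<beta> \<gamma>)) = h (b i \<alpha> \<beta> * b j \<beta> \<gamma>)"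
      using sum_as_a[OF I(1,2) i, of "\<lambda>k. \<Sum>l=1..p \<beta> \<gamma>. as \<gamma> \<beta> j (a l \<gamma> \<beta>) * h (b k \<alpha> \<beta> * b l \<beta> \<gamma>)"]
        sum_as_a[OF I(2,3) j, of "\<lambda>l. h (b i \<alpha> \<beta> * b l \<beta> \<gamma>)"]
      by (simp add: g_def f_def sum_distrib_left mult_ac)
    have 2: "of_bool (\<beta> = \<gamma>) * f (e \<gamma>) = 0" "of_bool (\<beta> = \<alpha>) * g (e \<beta>) = 0"
      using as_e'[OF I(2,3) j] as_e'[OF I(1,2) i] by (auto simp: g_def f_def)
    have 3: "(\<Sum>i=1..p \<beta> \<alpha>. \<Sum>j=1..p \<alpha> \<gamma>. f (a j \<gamma> \<alpha> * a i \<alpha> \<beta>) * g (b i \<beta> \<alpha>) * h (b j \<alpha> \<gamma>))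
       = (\<Sum>k=1..p \<alpha> \<gamma>. (\<Sum>i=1..p \<beta> \<alpha>. f (a k \<gamma> \<alpha> * a i \<alpha> \<beta>) * g (b i \<beta> \<alpha>)) * h (b k \<alpha> \<gamma>))"
      by (subst sum.swap) (simp add: sum_distrib_left sum_distrib_right mult_ac)
    have 4: "(\<Sum>i=1..p \<beta> \<gamma>. \<Sum>j=1..p \<alpha> \<gamma>. f (a i \<gamma> \<beta>) * g (b i \<beta> \<gamma> * a j \<gamma> \<alpha>) * h (b j \<alpha> \<gamma>))
       = (\<Sum>k=1..p \<alpha> \<gamma>. (\<Sum>i=1..p \<beta> \<gamma>. f (a i \<gamma> \<beta>) * g (b i \<beta> \<gamma> * a k \<gamma> \<alpha>)) * h (b k \<alpha> \<gamma>))"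
      by (subst sum.swap) (simp add: sum_distrib_left sum_distrib_right mult_ac)
    have 5: "of_bool (\<beta> = \<alpha>) * (\<Sum>k=1..p \<beta> \<gamma>. f (a k \<gamma> \<beta>) * h (b k \<beta> \<gamma>))
      = (\<Sum>k=1..p \<alpha> \<gamma>. of_bool (\<beta> = \<alpha>) * f (a k \<gamma> \<beta>) * h (b k \<alpha> \<gamma>))"
      by auto
    have 6: "(\<Sum>k=1..p \<alpha> \<gamma>. C k * h (b k \<alpha> \<gamma>)) =
      - (\<Sum>k=1..p \<alpha> \<gamma>. (\<Sum>i=1..p \<beta> \<alpha>. f (a k \<gamma> \<alpha> * a i \<alpha> \<beta>) * g (b i \<beta> \<alpha>)) * h (b k \<alpha> \<gamma>))
      - g (c \<beta>) * (of_bool (\<beta> = \<alpha>) * (\<Sum>k=1..p \<beta> \<gamma>. f (a k \<gamma> \<beta>) * h (b k \<beta> \<gamma>)))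
      + (\<Sum>k=1..p \<alpha> \<gamma>. (\<Sum>i=1..p \<beta> \<gamma>. f (a i \<gamma> \<beta>) * g (b i \<beta> \<gamma> * a k \<gamma> \<alpha>)) * h (b k \<alpha> \<gamma>))"
      unfolding 5 C_def by (simp add: sum.distrib sum_subtractf sum_negf sum_distrib_left algebra_simps)
    show ?thesis
      using torsion[OF I(2,1,3) lin h] unfolding 1 2 3 4 6
      by (auto simp: D_def algebra_simps)
  qed
  from expand_b[OF I(1,3) this] show ?thesis by (auto simp: \<psi>_def lam_def)
qed

text \<open>Contracting the two outer factors isolates the middle of a \<otimes> ba \<otimes> b. The
  functionals then hit aa in one sum and bb in another, which by definition yields \<phi> and
  \<psi>; this is why no new constants occur with b and a. The tensor a \<otimes> c \<otimes> b
  gives the term with c.\<close>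

lemma b_times_a:
  assumes I: "\<alpha> \<in> {1..m}" "\<beta> \<in> {1..m}" "\<gamma> \<in> {1..m}" and i: "i \<in> {1..p \<alpha> \<beta>}" and j: "j \<in> {1..p \<gamma> \<beta>}"
  shows "b i \<alpha> \<beta> * a j \<beta> \<gamma> =
    (\<Sum>k=1..p \<alpha> \<gamma>. \<phi> i j k \<beta> \<gamma> \<alpha> *\<^sub>C b k \<alpha> \<gamma>) + (\<Sum>k=1..p \<gamma> \<alpha>. \<psi> k i j \<gamma> \<alpha> \<beta> *\<^sub>C a k \<alpha> \<gamma>)
    + (of_bool (\<alpha> = \<gamma>) * t i j \<alpha> \<beta>) *\<^sub>C e \<alpha> + (of_bool (\<alpha> = \<gamma>) * of_bool (i = j)) *\<^sub>C c \<alpha>"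
proof -
  define f where "f = as \<beta> \<alpha> i"
  define h where "h = bs \<gamma> \<beta> j"
  have lin: "lin_form f" "lin_form h" unfolding f_def h_def using I i j by (blast intro: lin_form_as lin_form_bs)+
  define D where "D = S \<beta> \<alpha> f h
    - (\<Sum>\<nu>=1..m. \<Sum>s=1..p \<alpha> \<nu>. \<Sum>l=1..p \<nu> \<beta>. f (a l \<beta> \<nu> * a s \<nu> \<alpha>) * h (b s \<alpha> \<nu> * b l \<nu> \<beta>))
    - (\<Sum>s=1..p \<alpha> \<beta>. f (c \<beta> * a s \<beta> \<alpha>) * h (b s \<alpha> \<beta>))"
  have eq: "b i \<alpha> \<beta> * a j \<beta> \<gamma> =
    (\<Sum>k=1..p \<alpha> \<gamma>. \<phi> i j k \<beta> \<gamma> \<alpha> *\<^sub>C b k \<alpha> \<gamma>) + (\<Sum>k=1..p \<gamma> \<alpha>. \<psi> k i j \<gamma> \<alpha> \<beta> *\<^sub>C a k \<alpha> \<gamma>)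
    + (of_bool (\<alpha> = \<gamma>) * D) *\<^sub>C e \<alpha> + (of_bool (\<alpha> = \<gamma>) * of_bool (i = j)) *\<^sub>C c \<alpha>"
  proof (rule lin_form_eqI)
    fix g assume g: "lin_form g"
    have 1: "(\<Sum>k=1..p \<alpha> \<gamma>. \<Sum>l=1..p \<gamma> \<beta>. f (a l \<beta> \<gamma> * a k \<gamma> \<alpha>) * g (b k \<alpha> \<gamma>) * h (b l \<gamma> \<beta>))
      = (\<Sum>k=1..p \<alpha> \<gamma>. \<phi> i j k \<beta> \<gamma> \<alpha> * g (b k \<alpha> \<gamma>))"
    proof (rule sum.cong)
      fix k
      show "(\<Sum>l=1..p \<gamma> \<beta>. f (a l \<beta> \<gamma> * a k \<gamma> \<alpha>) * g (b k \<alpha> \<gamma>) * h (b l \<gamma> \<beta>)) = \<phi> i j k \<beta> \<gamma> \<alpha> * g (b k \<alpha> \<gamma>)"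
        using sum_bs_b[OF I(3,2) j, of "\<lambda>l. f (a l \<beta> \<gamma> * a k \<gamma> \<alpha>) * g (b k \<alpha> \<gamma>)"]
        by (simp add: f_def h_def \<phi>_def mult_ac)
    qed simp
    have 2: "(\<Sum>k=1..p \<gamma> \<alpha>. \<Sum>l=1..p \<alpha> \<beta>. f (a l \<beta> \<alpha>) * g (a k \<alpha> \<gamma>) * h (b k \<gamma> \<alpha> * b l \<alpha> \<beta>))
      = (\<Sum>k=1..p \<gamma> \<alpha>. \<psi> k i j \<gamma> \<alpha> \<beta> * g (a k \<alpha> \<gamma>))"
    proof (rule sum.cong)
      fix k
      show "(\<Sum>l=1..p \<alpha> \<beta>. f (a l \<beta> \<alpha>) * g (a k \<alpha> \<gamma>) * h (b k \<gamma> \<alpha> * b l \<alpha> \<beta>)) = \<psi> k i j \<gamma> \<alpha> \<beta> * g (a k \<alpha> \<gamma>)"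
        using sum_as_a[OF I(1,2) i, of "\<lambda>l. g (a k \<alpha> \<gamma>) * h (b k \<gamma> \<alpha> * b l \<alpha> \<beta>)"]
        by (simp add: f_def h_def \<psi>_def mult_ac)
    qed simp
    have 3: "of_bool (\<alpha> = \<gamma>) * (\<Sum>l=1..p \<alpha> \<beta>. f (a l \<beta> \<alpha>) * h (b l \<alpha> \<beta>)) = of_bool (\<alpha> = \<gamma>) * of_bool (i = j)"
      using sum_as_a[OF I(1,2) i, of "\<lambda>l. h (b l \<alpha> \<beta>)"] bs_b[OF I(3,2) j] i by (auto simp: f_def h_def)
    have 4: "(\<Sum>k=1..p \<alpha> \<beta>. \<Sum>l=1..p \<gamma> \<beta>. f (a k \<beta> \<alpha>) * g (b k \<alpha> \<beta> * a l \<beta> \<gamma>) * h (b l \<gamma> \<beta>)) = g (b i \<alpha> \<beta> * a j \<beta> \<gamma>)"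
      using sum_as_a[OF I(1,2) i, of "\<lambda>k. \<Sum>l=1..p \<gamma> \<beta>. bs \<gamma> \<beta> j (b l \<gamma> \<beta>) * g (b k \<alpha> \<beta> * a l \<beta> \<gamma>)"]
        sum_bs_b[OF I(3,2) j, of "\<lambda>l. g (b i \<alpha> \<beta> * a l \<beta> \<gamma>)"]
      by (simp add: h_def f_def sum_distrib_left mult_ac)
    have 5: "of_bool (\<alpha> = \<beta>) * f (e \<beta>) = 0" "of_bool (\<gamma> = \<beta>) * h (e \<beta>) = 0"
      using as_e'[OF I(1,2) i] bs_e'[OF I(3,2) j] by (auto simp: h_def f_def)
    have 6: "of_bool (\<alpha> = \<gamma>) * g (c \<alpha>) * (\<Sum>j=1..p \<alpha> \<beta>. f (a j \<beta> \<alpha>) * h (b j \<alpha> \<beta>))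
      = of_bool (\<alpha> = \<gamma>) * of_bool (i = j) * g (c \<alpha>)"
      unfolding 3[symmetric] by (simp add: mult_ac)
    show "g (b i \<alpha> \<beta> * a j \<beta> \<gamma>) = g ((\<Sum>k=1..p \<alpha> \<gamma>. \<phi> i j k \<beta> \<gamma> \<alpha> *\<^sub>C b k \<alpha> \<gamma>) + (\<Sum>k=1..p \<gamma> \<alpha>. \<psi> k i j \<gamma> \<alpha> \<beta> *\<^sub>C a k \<alpha> \<gamma>)
    + (of_bool (\<alpha> = \<gamma>) * D) *\<^sub>C e \<alpha> + (of_bool (\<alpha> = \<gamma>) * of_bool (i = j)) *\<^sub>C c \<alpha>)"
      using torsion[OF I(1,3,2) lin(1) g lin(2), folded D_def] unfolding 1 2 4 5 6 lin_form_simps[OF g]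
      by (auto simp: algebra_simps)
  qed
  \<comment> \<open>For \<alpha> = \<gamma> subtracting the known terms leaves D times the identity,
    and \<open>ae\<close> takes the value 1 there.\<close>
  have "of_bool (\<alpha> = \<gamma>) * D = of_bool (\<alpha> = \<gamma>) * t i j \<alpha> \<beta>"
  proof (rule of_bool_eq_mult_cong)
    assume ag: "\<alpha> = \<gamma>"
    have "t i j \<alpha> \<beta> = ae \<alpha> (D *\<^sub>C e \<alpha>)"
      unfolding t_def using ag by (subst eq[unfolded ag[symmetric]]) (simp add: algebra_simps)
    then show "D = t i j \<alpha> \<beta>" using ae_e[OF I(1)] by (simp add: lin_form_simps[OF lin_form_ae[OF I(1)]])
  qed
  with eq show ?thesis by metis
qed

text \<open>What remains of \<open>torsion\<close> after all products $aa$, $bb$, $ba$ have been expanded has the form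
  $Y \otimes 1 + 1 \otimes Z = W_{13}$. Functionals that vanish on $1$ therefore do not distinguish
  $Y$ and $Z$ from $W$, and comparing them yields $bc$ and $ca$.\<close>

definition "Y \<gamma> \<alpha> f g = S \<gamma> \<alpha> f g - (\<Sum>i=1..p \<gamma> \<alpha>. \<Sum>j=1..p \<alpha> \<gamma>. lam i j \<gamma> \<alpha> * f (a j \<gamma> \<alpha>) * g (a i \<alpha> \<gamma>))
  - (\<Sum>i=1..p \<alpha> \<gamma>. f (c \<gamma> * a i \<gamma> \<alpha>) * g (b i \<alpha> \<gamma>))
  + (\<Sum>i=1..p \<alpha> \<gamma>. f (a i \<gamma> \<alpha>) * g (b i \<alpha> \<gamma> * c \<gamma>))"
definition "Z \<gamma> \<alpha> f g = S \<gamma> \<alpha> f g - (\<Sum>i=1..p \<gamma> \<alpha>. \<Sum>j=1..p \<alpha> \<gamma>. \<mu> j i \<gamma> \<alpha> * f (b i \<gamma> \<alpha>) * g (b j \<alpha> \<gamma>))"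
text \<open>The outer two factors of R(R(xy)), without the summands that involve c.\<close>

definition "Q \<gamma> \<alpha> f g =
  (\<Sum>\<nu>=1..m. \<Sum>s=1..p \<alpha> \<nu>. \<Sum>l=1..p \<nu> \<gamma>. f (a l \<gamma> \<nu> * a s \<nu> \<alpha>) * g (b s \<alpha> \<nu> * b l \<nu> \<gamma>))"
definition "W \<gamma> \<alpha> f g = S \<gamma> \<alpha> f g - Q \<gamma> \<alpha> f g - (\<Sum>s=1..p \<alpha> \<gamma>. f (c \<gamma> * a s \<gamma> \<alpha>) * g (b s \<alpha> \<gamma>))
  - (\<Sum>i=1..p \<alpha> \<gamma>. \<Sum>j=1..p \<alpha> \<gamma>. t i j \<alpha> \<gamma> * f (a i \<gamma> \<alpha>) * g (b j \<alpha> \<gamma>))"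

section \<open>The products bc and ca\<close>

text \<open>The \<phi>-terms from aa \<otimes> b \<otimes> b and the \<psi>-terms from a \<otimes> a
  \<otimes> bb reappear in a \<otimes> ba \<otimes> b and cancel, as does a \<otimes> c \<otimes> b.
  Every surviving tensor has 1 in one of its factors, and sorting by its position gives Y, Z and
  W.\<close>

lemma residual:
  assumes I: "\<alpha> \<in> {1..m}" "\<beta> \<in> {1..m}" "\<gamma> \<in> {1..m}" and lin: "lin_form f" "lin_form g" "lin_form h"
  shows "of_bool (\<beta> = \<gamma>) * h (e \<gamma>) * Y \<gamma> \<alpha> f g + of_bool (\<alpha> = \<gamma>) * f (e \<gamma>) * Z \<alpha> \<beta> g h
    = of_bool (\<alpha> = \<beta>) * g (e \<alpha>) * W \<gamma> \<alpha> f h"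
proof -
  let ?\<Phi> = "\<Sum>i=1..p \<alpha> \<beta>. \<Sum>j=1..p \<beta> \<gamma>. \<Sum>k=1..p \<alpha> \<gamma>. \<phi> k j i \<gamma> \<beta> \<alpha> * (f (a k \<gamma> \<alpha>) * g (b i \<alpha> \<beta>) * h (b j \<beta> \<gamma>))"
  let ?\<Psi> = "\<Sum>i=1..p \<beta> \<alpha>. \<Sum>j=1..p \<alpha> \<gamma>. \<Sum>k=1..p \<beta> \<gamma>. \<psi> i j k \<beta> \<alpha> \<gamma> * (f (a j \<gamma> \<alpha>) * g (a i \<alpha> \<beta>) * h (b k \<beta> \<gamma>))"
  have E1: "(\<Sum>i=1..p \<alpha> \<beta>. \<Sum>j=1..p \<beta> \<gamma>. f (a j \<gamma> \<beta> * a i \<beta> \<alpha>) * g (b i \<alpha> \<beta>) * h (b j \<beta> \<gamma>))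
    = ?\<Phi> + of_bool (\<alpha> = \<gamma>) * f (e \<gamma>) * (\<Sum>i=1..p \<alpha> \<beta>. \<Sum>j=1..p \<beta> \<gamma>. \<mu> j i \<gamma> \<beta> * g (b i \<alpha> \<beta>) * h (b j \<beta> \<gamma>))"
    unfolding sum_distrib_left sum.distrib[symmetric]
    by (intro sum.cong refl)
      (auto simp: a_times_a[OF I(3,2,1)] lin_form_simps[OF lin(1)] sum_distrib_left sum_distrib_right algebra_simps)
  have E2: "(\<Sum>i=1..p \<beta> \<alpha>. \<Sum>j=1..p \<alpha> \<gamma>. f (a j \<gamma> \<alpha>) * g (a i \<alpha> \<beta>) * h (b i \<beta> \<alpha> * b j \<alpha> \<gamma>))
    = ?\<Psi> + of_bool (\<beta> = \<gamma>) * h (e \<gamma>) * (\<Sum>i=1..p \<beta> \<alpha>. \<Sum>j=1..p \<alpha> \<gamma>. lam i j \<beta> \<alpha> * f (a j \<gamma> \<alpha>) * g (a i \<alpha> \<beta>))"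
    unfolding sum_distrib_left sum.distrib[symmetric]
    by (intro sum.cong refl)
      (auto simp: b_times_b[OF I(2,1,3)] lin_form_simps[OF lin(3)] sum_distrib_left sum_distrib_right algebra_simps)
  \<comment> \<open>The summations are reordered so that the indices of the two outer factors come
    first, as they do in the expansion of a \<otimes> ba \<otimes> b.\<close>
  have \<Phi>: "?\<Phi> = (\<Sum>i=1..p \<alpha> \<gamma>. \<Sum>j=1..p \<beta> \<gamma>. \<Sum>k=1..p \<alpha> \<beta>. \<phi> i j k \<gamma> \<beta> \<alpha> * (f (a i \<gamma> \<alpha>) * g (b k \<alpha> \<beta>) * h (b j \<beta> \<gamma>)))"
    by (subst sum.swap, subst sum.swap[of _ "{1..p \<alpha> \<gamma>}"], rule sum.cong, simp, subst sum.swap, rule refl)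
  have \<Psi>: "?\<Psi> = (\<Sum>i=1..p \<alpha> \<gamma>. \<Sum>j=1..p \<beta> \<gamma>. \<Sum>k=1..p \<beta> \<alpha>. \<psi> k i j \<beta> \<alpha> \<gamma> * (f (a i \<gamma> \<alpha>) * g (a k \<alpha> \<beta>) * h (b j \<beta> \<gamma>)))"
    by (subst sum.swap, rule sum.cong, simp, subst sum.swap, rule refl)
  have c: "of_bool (\<alpha> = \<beta>) * g (c \<alpha>) * (\<Sum>j=1..p \<alpha> \<gamma>. f (a j \<gamma> \<alpha>) * h (b j \<alpha> \<gamma>))
    = (\<Sum>i=1..p \<alpha> \<gamma>. \<Sum>j=1..p \<beta> \<gamma>. of_bool (\<alpha> = \<beta>) * of_bool (i = j) * (f (a i \<gamma> \<alpha>) * g (c \<alpha>) * h (b j \<beta> \<gamma>)))"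
  proof (cases "\<alpha> = \<beta>")
    case True
    have "(\<Sum>j=1..p \<beta> \<gamma>. of_bool (\<alpha> = \<beta>) * of_bool (i = j) * (f (a i \<gamma> \<alpha>) * g (c \<alpha>) * h (b j \<beta> \<gamma>)))
      = f (a i \<gamma> \<beta>) * g (c \<beta>) * h (b i \<beta> \<gamma>)" if "i \<in> {1..p \<beta> \<gamma>}" for i
      using that True by (simp add: of_bool_def if_distrib[of "\<lambda>x. x * _"] cong: if_cong)
    then have "(\<Sum>i=1..p \<alpha> \<gamma>. \<Sum>j=1..p \<beta> \<gamma>. of_bool (\<alpha> = \<beta>) * of_bool (i = j) * (f (a i \<gamma> \<alpha>) * g (c \<alpha>) * h (b j \<beta> \<gamma>)))
      = (\<Sum>i=1..p \<alpha> \<gamma>. f (a i \<gamma> \<beta>) * g (c \<beta>) * h (b i \<beta> \<gamma>))"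
      by (intro sum.cong refl) (use True in auto)
    then show ?thesis using True by (simp add: sum_distrib_left mult_ac)
  qed simp
  have E3: "(\<Sum>i=1..p \<alpha> \<gamma>. \<Sum>j=1..p \<beta> \<gamma>. f (a i \<gamma> \<alpha>) * g (b i \<alpha> \<gamma> * a j \<gamma> \<beta>) * h (b j \<beta> \<gamma>))
    = ?\<Phi> + ?\<Psi> + of_bool (\<alpha> = \<beta>) * g (e \<alpha>) * (\<Sum>i=1..p \<alpha> \<gamma>. \<Sum>j=1..p \<alpha> \<gamma>. t i j \<alpha> \<gamma> * f (a i \<gamma> \<alpha>) * h (b j \<alpha> \<gamma>))
      + of_bool (\<alpha> = \<beta>) * g (c \<alpha>) * (\<Sum>j=1..p \<alpha> \<gamma>. f (a j \<gamma> \<alpha>) * h (b j \<alpha> \<gamma>))"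
  proof -
    have t: "of_bool (\<alpha> = \<beta>) * g (e \<alpha>) * (\<Sum>i=1..p \<alpha> \<gamma>. \<Sum>j=1..p \<alpha> \<gamma>. t i j \<alpha> \<gamma> * f (a i \<gamma> \<alpha>) * h (b j \<alpha> \<gamma>))
      = (\<Sum>i=1..p \<alpha> \<gamma>. \<Sum>j=1..p \<beta> \<gamma>. of_bool (\<alpha> = \<beta>) * g (e \<alpha>) * (t i j \<alpha> \<gamma> * f (a i \<gamma> \<alpha>) * h (b j \<beta> \<gamma>)))"
      by (auto simp: sum_distrib_left)
    show ?thesis
      unfolding \<Phi> \<Psi> t c sum.distrib[symmetric]
      by (intro sum.cong refl)
        (simp add: b_times_a[OF I(1,3,2)] lin_form_simps[OF lin(2)] sum_distrib_left sum_distrib_right algebra_simps del: of_bool_eq_iff)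
  qed
  show ?thesis
    using torsion[OF I lin] unfolding E1 E2 E3 Q_def[symmetric]
    by (auto simp: Y_def Z_def W_def algebra_simps)
qed

text \<open>For \<alpha> = \<gamma> the Z-term drops and h(1) Y(f,g) = g(1) W(f,h) for all g and h.
  Putting \<open>ae\<close> for either or both shows that Y(f,g) and W(f,g) are g(1) times the same
  number. For \<alpha> \<noteq> \<gamma> both are 0: take \<beta> = \<gamma> with h(1) = 1 for Y,
  and \<beta> = \<alpha> with g(1) = 1 for W.\<close>

lemma Y_eq_W:
  assumes I: "\<alpha> \<in> {1..m}" "\<gamma> \<in> {1..m}" and lin: "lin_form f" "lin_form g" and f: "of_bool (\<alpha> = \<gamma>) * f (e \<gamma>) = 0"
  shows "Y \<gamma> \<alpha> f g = W \<gamma> \<alpha> f g"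
proof -
  note 1 = residual[OF I(1,2,2) lin(1)] and 2 = residual[OF I(1,1,2) lin(1)]
  note l = lin_form_ae[OF I(1)] ae_e[OF I(1)] lin_form_ae[OF I(2)] ae_e[OF I(2)]
  show ?thesis
  proof (cases "\<alpha> = \<gamma>")
    case True
    then show ?thesis
      using 1[OF l(1) lin(2)] 1[OF lin(2) l(1)] 1[OF l(1,1)] f l by simp
  next
    case False
    then show ?thesis
      using 1[OF lin(2) l(3)] 2[OF l(1) lin(2)] l by simp
  qed
qed

text \<open>The mirror image: now the last functional kills 1, the Y-term drops, and for \<alpha> =
  \<gamma> the equation is f(1) Z(g,h) = g(1) W(f,h).\<close>

lemma Z_eq_W:
  assumes I: "\<alpha> \<in> {1..m}" "\<gamma> \<in> {1..m}" and lin: "lin_form f" "lin_form h" and h: "of_bool (\<alpha> = \<gamma>) * h (e \<gamma>) = 0"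
  shows "Z \<gamma> \<alpha> f h = W \<gamma> \<alpha> f h"
proof -
  note l = lin_form_ae[OF I(1)] ae_e[OF I(1)] lin_form_ae[OF I(2)] ae_e[OF I(2)]
  note 1 = residual[OF I(2,1,2)] and 2 = residual[OF I(1,1,2)]
  show ?thesis
  proof (cases "\<alpha> = \<gamma>")
    case True
    then show ?thesis
      using 1[OF l(1) lin] 1[OF lin(1) l(1) lin(2)] 1[OF l(1) l(1) lin(2)] h l by simp
  next
    case False
    then show ?thesis
      using 1[OF l(3) lin] 2[OF lin(1) l(1) lin(2)] l by simp
  qed
qed

text \<open>In Y = W both S and ca \<otimes> b cancel. A functional dual to the a's in the first
  factor then picks bc from a \<otimes> bc.\<close>

lemma b_times_c:
  assumes I: "\<alpha> \<in> {1..m}" "\<beta> \<in> {1..m}" and i: "i \<in> {1..p \<alpha> \<beta>}"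
  shows "b i \<alpha> \<beta> * c \<beta> = (\<Sum>k=1..p \<beta> \<alpha>. lam k i \<beta> \<alpha> *\<^sub>C a k \<alpha> \<beta>) - (\<Sum>k=1..p \<alpha> \<beta>. t i k \<alpha> \<beta> *\<^sub>C b k \<alpha> \<beta>)
    - (\<Sum>k=1..p \<alpha> \<beta>. (\<Sum>\<nu>=1..m. \<Sum>l=1..p \<nu> \<beta>. \<Sum>s=1..p \<alpha> \<nu>. \<phi> i l s \<beta> \<nu> \<alpha> * \<psi> s l k \<alpha> \<nu> \<beta>) *\<^sub>C b k \<alpha> \<beta>)
    - (of_bool (\<alpha> = \<beta>) * (\<Sum>\<nu>=1..m. \<Sum>l=1..p \<alpha> \<nu>. \<Sum>s=1..p \<nu> \<alpha>. \<phi> i s l \<alpha> \<nu> \<alpha> * lam l s \<alpha> \<nu>)) *\<^sub>C e \<alpha>"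
proof (rule lin_form_eqI)
  fix g assume g: "lin_form g"
  let ?f = "as \<beta> \<alpha> i"
  \<comment> \<open>The functional turns aa into \<phi>, and expanding bb by
    \<open>b_times_b\<close> gives the sums over \<nu>: the \<psi>-part produces b_k, the
    \<open>lam\<close>-part the multiple of 1.\<close>
  have Q: "Q \<beta> \<alpha> ?f g = (\<Sum>k=1..p \<alpha> \<beta>. (\<Sum>\<nu>=1..m. \<Sum>l=1..p \<nu> \<beta>. \<Sum>s=1..p \<alpha> \<nu>. \<phi> i l s \<beta> \<nu> \<alpha> * \<psi> s l k \<alpha> \<nu> \<beta>) * g (b k \<alpha> \<beta>))
    + of_bool (\<alpha> = \<beta>) * (\<Sum>\<nu>=1..m. \<Sum>l=1..p \<alpha> \<nu>. \<Sum>s=1..p \<nu> \<alpha>. \<phi> i s l \<alpha> \<nu> \<alpha> * lam l s \<alpha> \<nu>) * g (e \<alpha>)" (is "_ = ?A + ?B")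
  proof -
    have A: "?A = (\<Sum>\<nu>=1..m. \<Sum>s=1..p \<alpha> \<nu>. \<Sum>l=1..p \<nu> \<beta>. \<phi> i l s \<beta> \<nu> \<alpha> * (\<Sum>k=1..p \<alpha> \<beta>. \<psi> s l k \<alpha> \<nu> \<beta> * g (b k \<alpha> \<beta>)))"
    proof -
      have "?A = (\<Sum>\<nu>=1..m. \<Sum>k=1..p \<alpha> \<beta>. \<Sum>l=1..p \<nu> \<beta>. \<Sum>s=1..p \<alpha> \<nu>. \<phi> i l s \<beta> \<nu> \<alpha> * (\<psi> s l k \<alpha> \<nu> \<beta> * g (b k \<alpha> \<beta>)))"
        by (subst (2) sum.swap) (simp add: sum_distrib_right mult.assoc)
      also have "\<dots> = (\<Sum>\<nu>=1..m. \<Sum>l=1..p \<nu> \<beta>. \<Sum>s=1..p \<alpha> \<nu>. \<Sum>k=1..p \<alpha> \<beta>. \<phi> i l s \<beta> \<nu> \<alpha> * (\<psi> s l k \<alpha> \<nu> \<beta> * g (b k \<alpha> \<beta>)))"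
        by (rule sum.cong[OF refl], subst sum.swap, rule sum.cong[OF refl], subst sum.swap, rule refl)
      also have "\<dots> = (\<Sum>\<nu>=1..m. \<Sum>s=1..p \<alpha> \<nu>. \<Sum>l=1..p \<nu> \<beta>. \<Sum>k=1..p \<alpha> \<beta>. \<phi> i l s \<beta> \<nu> \<alpha> * (\<psi> s l k \<alpha> \<nu> \<beta> * g (b k \<alpha> \<beta>)))"
        by (rule sum.cong[OF refl], rule sum.swap)
      finally show ?thesis unfolding sum_distrib_left .
    qed
    have B: "?B = (\<Sum>\<nu>=1..m. \<Sum>s=1..p \<alpha> \<nu>. \<Sum>l=1..p \<nu> \<beta>. \<phi> i l s \<beta> \<nu> \<alpha> * (of_bool (\<alpha> = \<beta>) * lam s l \<alpha> \<nu> * g (e \<alpha>)))"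
      by (auto simp: sum_distrib_right sum_distrib_left mult_ac)
    show ?thesis unfolding Q_def A B sum.distrib[symmetric]
      by (intro sum.cong refl)
        (simp add: \<phi>_def[symmetric] b_times_b[OF I(1) _ I(2)] lin_form_simps[OF g] algebra_simps del: of_bool_eq_iff)
  qed
  have 1: "(\<Sum>k=1..p \<beta> \<alpha>. \<Sum>j=1..p \<alpha> \<beta>. lam k j \<beta> \<alpha> * ?f (a j \<beta> \<alpha>) * g (a k \<alpha> \<beta>)) = (\<Sum>k=1..p \<beta> \<alpha>. lam k i \<beta> \<alpha> * g (a k \<alpha> \<beta>))"
    using sum_as_a[OF I i, of "\<lambda>j. lam _ j \<beta> \<alpha> * g (a _ \<alpha> \<beta>)"] by (simp add: mult_ac)
  have 2: "(\<Sum>j=1..p \<alpha> \<beta>. ?f (a j \<beta> \<alpha>) * g (b j \<alpha> \<beta> * c \<beta>)) = g (b i \<alpha> \<beta> * c \<beta>)"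
    by (rule sum_as_a[OF I i])
  have 3: "(\<Sum>j=1..p \<alpha> \<beta>. \<Sum>k=1..p \<alpha> \<beta>. t j k \<alpha> \<beta> * ?f (a j \<beta> \<alpha>) * g (b k \<alpha> \<beta>)) = (\<Sum>k=1..p \<alpha> \<beta>. t i k \<alpha> \<beta> * g (b k \<alpha> \<beta>))"
    using sum_as_a[OF I i, of "\<lambda>j. t j _ \<alpha> \<beta> * g (b _ \<alpha> \<beta>)"] by (subst sum.swap) (simp add: mult_ac)
  show "g (b i \<alpha> \<beta> * c \<beta>) = g ((\<Sum>k=1..p \<beta> \<alpha>. lam k i \<beta> \<alpha> *\<^sub>C a k \<alpha> \<beta>) - (\<Sum>k=1..p \<alpha> \<beta>. t i k \<alpha> \<beta> *\<^sub>C b k \<alpha> \<beta>)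
    - (\<Sum>k=1..p \<alpha> \<beta>. (\<Sum>\<nu>=1..m. \<Sum>l=1..p \<nu> \<beta>. \<Sum>s=1..p \<alpha> \<nu>. \<phi> i l s \<beta> \<nu> \<alpha> * \<psi> s l k \<alpha> \<nu> \<beta>) *\<^sub>C b k \<alpha> \<beta>)
    - (of_bool (\<alpha> = \<beta>) * (\<Sum>\<nu>=1..m. \<Sum>l=1..p \<alpha> \<nu>. \<Sum>s=1..p \<nu> \<alpha>. \<phi> i s l \<alpha> \<nu> \<alpha> * lam l s \<alpha> \<nu>)) *\<^sub>C e \<alpha>)"
    using Y_eq_W[OF I lin_form_as[OF I i] g as_e'[OF I i]] unfolding Y_def W_def 1 2 3 Q lin_form_simps[OF g]
    by (simp add: algebra_simps del: of_bool_eq_iff)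
qed

text \<open>In Z = W again S cancels, while ca \<otimes> b occurs only in W. A functional dual to
  the b's in the second factor isolates ca, and the aa inside \<open>Q\<close> is expanded instead
  of the bb.\<close>

lemma c_times_a:
  assumes I: "\<alpha> \<in> {1..m}" "\<beta> \<in> {1..m}" and i: "i \<in> {1..p \<beta> \<alpha>}"
  shows "c \<alpha> * a i \<alpha> \<beta> = (\<Sum>k=1..p \<alpha> \<beta>. \<mu> i k \<alpha> \<beta> *\<^sub>C b k \<alpha> \<beta>) - (\<Sum>k=1..p \<beta> \<alpha>. t k i \<beta> \<alpha> *\<^sub>C a k \<alpha> \<beta>)
    - (\<Sum>k=1..p \<beta> \<alpha>. (\<Sum>\<nu>=1..m. \<Sum>l=1..p \<nu> \<alpha>. \<Sum>s=1..p \<beta> \<nu>. \<phi> k l s \<alpha> \<nu> \<beta> * \<psi> s l i \<beta> \<nu> \<alpha>) *\<^sub>C a k \<alpha> \<beta>)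
    - (of_bool (\<alpha> = \<beta>) * (\<Sum>\<nu>=1..m. \<Sum>l=1..p \<nu> \<alpha>. \<Sum>s=1..p \<alpha> \<nu>. \<mu> l s \<alpha> \<nu> * \<psi> s l i \<alpha> \<nu> \<alpha>)) *\<^sub>C e \<alpha>"
proof (rule lin_form_eqI)
  fix f assume f: "lin_form f"
  let ?h = "bs \<beta> \<alpha> i"
  have Q: "Q \<alpha> \<beta> f ?h = (\<Sum>k=1..p \<beta> \<alpha>. (\<Sum>\<nu>=1..m. \<Sum>l=1..p \<nu> \<alpha>. \<Sum>s=1..p \<beta> \<nu>. \<phi> k l s \<alpha> \<nu> \<beta> * \<psi> s l i \<beta> \<nu> \<alpha>) * f (a k \<alpha> \<beta>))
    + of_bool (\<alpha> = \<beta>) * (\<Sum>\<nu>=1..m. \<Sum>l=1..p \<nu> \<alpha>. \<Sum>s=1..p \<alpha> \<nu>. \<mu> l s \<alpha> \<nu> * \<psi> s l i \<alpha> \<nu> \<alpha>) * f (e \<alpha>)" (is "_ = ?A + ?B")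
  proof -
    have A: "?A = (\<Sum>\<nu>=1..m. \<Sum>s=1..p \<beta> \<nu>. \<Sum>l=1..p \<nu> \<alpha>. (\<Sum>k=1..p \<beta> \<alpha>. \<phi> k l s \<alpha> \<nu> \<beta> * f (a k \<alpha> \<beta>)) * \<psi> s l i \<beta> \<nu> \<alpha>)"
    proof -
      have "?A = (\<Sum>\<nu>=1..m. \<Sum>k=1..p \<beta> \<alpha>. \<Sum>l=1..p \<nu> \<alpha>. \<Sum>s=1..p \<beta> \<nu>. \<phi> k l s \<alpha> \<nu> \<beta> * f (a k \<alpha> \<beta>) * \<psi> s l i \<beta> \<nu> \<alpha>)"
        by (subst (2) sum.swap) (simp add: sum_distrib_left sum_distrib_right mult_ac)
      also have "\<dots> = (\<Sum>\<nu>=1..m. \<Sum>l=1..p \<nu> \<alpha>. \<Sum>s=1..p \<beta> \<nu>. \<Sum>k=1..p \<beta> \<alpha>. \<phi> k l s \<alpha> \<nu> \<beta> * f (a k \<alpha> \<beta>) * \<psi> s l i \<beta> \<nu> \<alpha>)"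
        by (rule sum.cong[OF refl], subst sum.swap, rule sum.cong[OF refl], subst sum.swap, rule refl)
      also have "\<dots> = (\<Sum>\<nu>=1..m. \<Sum>s=1..p \<beta> \<nu>. \<Sum>l=1..p \<nu> \<alpha>. \<Sum>k=1..p \<beta> \<alpha>. \<phi> k l s \<alpha> \<nu> \<beta> * f (a k \<alpha> \<beta>) * \<psi> s l i \<beta> \<nu> \<alpha>)"
        by (rule sum.cong[OF refl], rule sum.swap)
      finally show ?thesis unfolding sum_distrib_right .
    qed
    have B: "?B = (\<Sum>\<nu>=1..m. \<Sum>s=1..p \<beta> \<nu>. \<Sum>l=1..p \<nu> \<alpha>. of_bool (\<alpha> = \<beta>) * \<mu> l s \<alpha> \<nu> * f (e \<alpha>) * \<psi> s l i \<beta> \<nu> \<alpha>)"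
      by (auto simp: sum_distrib_right sum_distrib_left mult_ac intro!: sum.cong sum.swap)
    show ?thesis unfolding Q_def A B sum.distrib[symmetric]
      by (intro sum.cong refl)
        (simp add: \<psi>_def[symmetric] a_times_a[OF I(1) _ I(2)] lin_form_simps[OF f] algebra_simps del: of_bool_eq_iff)
  qed
  have 1: "(\<Sum>k=1..p \<alpha> \<beta>. \<Sum>j=1..p \<beta> \<alpha>. \<mu> j k \<alpha> \<beta> * f (b k \<alpha> \<beta>) * ?h (b j \<beta> \<alpha>)) = (\<Sum>k=1..p \<alpha> \<beta>. \<mu> i k \<alpha> \<beta> * f (b k \<alpha> \<beta>))"
    using sum_bs_b[OF I(2,1) i, of "\<lambda>j. \<mu> j _ \<alpha> \<beta> * f (b _ \<alpha> \<beta>)"] by (simp add: mult_ac)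
  have 2: "(\<Sum>j=1..p \<beta> \<alpha>. f (c \<alpha> * a j \<alpha> \<beta>) * ?h (b j \<beta> \<alpha>)) = f (c \<alpha> * a i \<alpha> \<beta>)"
    using sum_bs_b[OF I(2,1) i, of "\<lambda>j. f (c \<alpha> * a j \<alpha> \<beta>)"] by (simp add: mult_ac)
  have 3: "(\<Sum>k=1..p \<beta> \<alpha>. \<Sum>j=1..p \<beta> \<alpha>. t k j \<beta> \<alpha> * f (a k \<alpha> \<beta>) * ?h (b j \<beta> \<alpha>)) = (\<Sum>k=1..p \<beta> \<alpha>. t k i \<beta> \<alpha> * f (a k \<alpha> \<beta>))"
    using sum_bs_b[OF I(2,1) i, of "\<lambda>j. t _ j \<beta> \<alpha> * f (a _ \<alpha> \<beta>)"] by (simp add: mult_ac)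
  show "f (c \<alpha> * a i \<alpha> \<beta>) = f ((\<Sum>k=1..p \<alpha> \<beta>. \<mu> i k \<alpha> \<beta> *\<^sub>C b k \<alpha> \<beta>) - (\<Sum>k=1..p \<beta> \<alpha>. t k i \<beta> \<alpha> *\<^sub>C a k \<alpha> \<beta>)
    - (\<Sum>k=1..p \<beta> \<alpha>. (\<Sum>\<nu>=1..m. \<Sum>l=1..p \<nu> \<alpha>. \<Sum>s=1..p \<beta> \<nu>. \<phi> k l s \<alpha> \<nu> \<beta> * \<psi> s l i \<beta> \<nu> \<alpha>) *\<^sub>C a k \<alpha> \<beta>)
    - (of_bool (\<alpha> = \<beta>) * (\<Sum>\<nu>=1..m. \<Sum>l=1..p \<nu> \<alpha>. \<Sum>s=1..p \<alpha> \<nu>. \<mu> l s \<alpha> \<nu> * \<psi> s l i \<alpha> \<nu> \<alpha>)) *\<^sub>C e \<alpha>)"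
    using Z_eq_W[OF I(2,1) f lin_form_bs[OF I(2,1) i] bs_e'[OF I(2,1) i]] unfolding Z_def W_def 1 2 3 Q lin_form_simps[OF f]
    by (simp add: algebra_simps del: of_bool_eq_iff)
qed

section \<open>Identities between the structure constants\<close>

text \<open>A coordinate functional is applied to both bracketings. Only the inner product is
  expanded, because on the outer one the functional is \<phi> by definition. The terms with \<mu>
  come from the multiple of 1 in the inner product, which leaves a single a.\<close>

lemma \<phi>_assoc:
  assumes I: "\<alpha> \<in> {1..m}" "\<beta> \<in> {1..m}" "\<gamma> \<in> {1..m}" "\<delta> \<in> {1..m}"
    and i: "i \<in> {1..p \<delta> \<alpha>}" "j \<in> {1..p \<beta> \<alpha>}" "k \<in> {1..p \<gamma> \<beta>}" "l \<in> {1..p \<delta> \<gamma>}"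
  shows "(\<Sum>s=1..p \<gamma> \<alpha>. \<phi> s j k \<alpha> \<beta> \<gamma> * \<phi> i s l \<alpha> \<gamma> \<delta>) + of_bool (i = l) * of_bool (\<alpha> = \<gamma>) * \<mu> j k \<alpha> \<beta> =
    (\<Sum>s=1..p \<delta> \<beta>. \<phi> i j s \<alpha> \<beta> \<delta> * \<phi> s k l \<beta> \<gamma> \<delta>) + of_bool (i = j) * of_bool (\<beta> = \<delta>) * \<mu> k l \<beta> \<gamma>"
proof -
  note lin = lin_form_simps[OF lin_form_as[OF I(4,1) i(1)]]
  have "as \<alpha> \<delta> i ((a j \<alpha> \<beta> * a k \<beta> \<gamma>) * a l \<gamma> \<delta>) =
    (\<Sum>s=1..p \<gamma> \<alpha>. \<phi> s j k \<alpha> \<beta> \<gamma> * \<phi> i s l \<alpha> \<gamma> \<delta>) + of_bool (i = l) * of_bool (\<alpha> = \<gamma>) * \<mu> j k \<alpha> \<beta>"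
    using as_a[OF I(4,1) i(1)] e_a[OF I(4,3) i(4)] i
    by (auto simp: a_times_a[OF I(1-3) i(2,3)] lin distrib_right sum_distrib_right \<phi>_def[of i])
  moreover have "as \<alpha> \<delta> i (a j \<alpha> \<beta> * (a k \<beta> \<gamma> * a l \<gamma> \<delta>)) =
    (\<Sum>s=1..p \<delta> \<beta>. \<phi> i j s \<alpha> \<beta> \<delta> * \<phi> s k l \<beta> \<gamma> \<delta>) + of_bool (i = j) * of_bool (\<beta> = \<delta>) * \<mu> k l \<beta> \<gamma>"
    using as_a[OF I(4,1) i(1)] a_e[OF I(2,1) i(2)] i
    by (auto simp: a_times_a[OF I(2-4) i(3,4)] lin distrib_left sum_distrib_left \<phi>_def[of i] mult.commute)
  ultimately show ?thesis by (simp add: mult.assoc)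
qed

text \<open>The coefficient of 1 instead of a_i: the functional \<open>ae\<close> vanishes on a
  single a, so the multiples of 1 in the inner products contribute nothing.\<close>

lemma \<phi>_\<mu>_assoc:
  assumes I: "\<alpha> \<in> {1..m}" "\<beta> \<in> {1..m}" "\<gamma> \<in> {1..m}"
    and i: "i \<in> {1..p \<beta> \<alpha>}" "j \<in> {1..p \<gamma> \<beta>}" "k \<in> {1..p \<alpha> \<gamma>}"
  shows "(\<Sum>s=1..p \<alpha> \<beta>. \<phi> s j k \<beta> \<gamma> \<alpha> * \<mu> i s \<alpha> \<beta>) = (\<Sum>s=1..p \<gamma> \<alpha>. \<phi> s i j \<alpha> \<beta> \<gamma> * \<mu> s k \<alpha> \<gamma>)"
proof -
  note lin = lin_form_simps[OF lin_form_ae[OF I(1)]]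
  have "ae \<alpha> ((a i \<alpha> \<beta> * a j \<beta> \<gamma>) * a k \<gamma> \<alpha>) = (\<Sum>s=1..p \<gamma> \<alpha>. \<phi> s i j \<alpha> \<beta> \<gamma> * \<mu> s k \<alpha> \<gamma>)"
    using ae_a[OF I(1)] e_a[OF I(1,3) i(3)] i
    by (auto simp: a_times_a[OF I i(1,2)] lin distrib_right sum_distrib_right \<mu>_def[of _ k])
  moreover have "ae \<alpha> (a i \<alpha> \<beta> * (a j \<beta> \<gamma> * a k \<gamma> \<alpha>)) = (\<Sum>s=1..p \<alpha> \<beta>. \<phi> s j k \<beta> \<gamma> \<alpha> * \<mu> i s \<alpha> \<beta>)"
    using ae_a[OF I(1)] a_e[OF I(2,1) i(1)] i
    by (auto simp: a_times_a[OF I(2,3,1) i(2,3)] lin distrib_left sum_distrib_left \<mu>_def[of i])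
  ultimately show ?thesis by (simp add: mult.assoc)
qed

lemma \<psi>_assoc:
  assumes I: "\<alpha> \<in> {1..m}" "\<beta> \<in> {1..m}" "\<gamma> \<in> {1..m}" "\<delta> \<in> {1..m}"
    and i: "i \<in> {1..p \<alpha> \<beta>}" "j \<in> {1..p \<beta> \<gamma>}" "k \<in> {1..p \<gamma> \<delta>}" "l \<in> {1..p \<alpha> \<delta>}"
  shows "(\<Sum>s=1..p \<alpha> \<gamma>. \<psi> i j s \<alpha> \<beta> \<gamma> * \<psi> s k l \<alpha> \<gamma> \<delta>) + of_bool (k = l) * of_bool (\<alpha> = \<gamma>) * lam i j \<alpha> \<beta> =
    (\<Sum>s=1..p \<beta> \<delta>. \<psi> j k s \<beta> \<gamma> \<delta> * \<psi> i s l \<alpha> \<beta> \<delta>) + of_bool (i = l) * of_bool (\<beta> = \<delta>) * lam j k \<beta> \<gamma>"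
proof -
  note lin = lin_form_simps[OF lin_form_bs[OF I(1,4) i(4)]]
  have "bs \<alpha> \<delta> l ((b i \<alpha> \<beta> * b j \<beta> \<gamma>) * b k \<gamma> \<delta>) =
    (\<Sum>s=1..p \<alpha> \<gamma>. \<psi> i j s \<alpha> \<beta> \<gamma> * \<psi> s k l \<alpha> \<gamma> \<delta>) + of_bool (k = l) * of_bool (\<alpha> = \<gamma>) * lam i j \<alpha> \<beta>"
    using bs_b[OF I(1,4) i(4)] e_b[OF I(3,4) i(3)] i
    by (auto simp: b_times_b[OF I(1-3) i(1,2)] lin distrib_right sum_distrib_right \<psi>_def[of _ _ l])
  moreover have "bs \<alpha> \<delta> l (b i \<alpha> \<beta> * (b j \<beta> \<gamma> * b k \<gamma> \<delta>)) =
    (\<Sum>s=1..p \<beta> \<delta>. \<psi> j k s \<beta> \<gamma> \<delta> * \<psi> i s l \<alpha> \<beta> \<delta>) + of_bool (i = l) * of_bool (\<beta> = \<delta>) * lam j k \<beta> \<gamma>"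
    using bs_b[OF I(1,4) i(4)] b_e[OF I(1,2) i(1)] i
    by (auto simp: b_times_b[OF I(2-4) i(2,3)] lin distrib_left sum_distrib_left \<psi>_def[of _ _ l])
  ultimately show ?thesis by (simp add: mult.assoc)
qed

lemma \<psi>_lam_assoc:
  assumes I: "\<alpha> \<in> {1..m}" "\<beta> \<in> {1..m}" "\<gamma> \<in> {1..m}"
    and i: "i \<in> {1..p \<alpha> \<beta>}" "j \<in> {1..p \<beta> \<gamma>}" "k \<in> {1..p \<gamma> \<alpha>}"
  shows "(\<Sum>s=1..p \<alpha> \<gamma>. \<psi> i j s \<alpha> \<beta> \<gamma> * lam s k \<alpha> \<gamma>) = (\<Sum>s=1..p \<beta> \<alpha>. \<psi> j k s \<beta> \<gamma> \<alpha> * lam i s \<alpha> \<beta>)"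
proof -
  note lin = lin_form_simps[OF lin_form_be[OF I(1)]]
  have "be \<alpha> ((b i \<alpha> \<beta> * b j \<beta> \<gamma>) * b k \<gamma> \<alpha>) = (\<Sum>s=1..p \<alpha> \<gamma>. \<psi> i j s \<alpha> \<beta> \<gamma> * lam s k \<alpha> \<gamma>)"
    using be_b[OF I(1)] e_b[OF I(3,1) i(3)] i
    by (auto simp: b_times_b[OF I i(1,2)] lin distrib_right sum_distrib_right lam_def[of _ k])
  moreover have "be \<alpha> (b i \<alpha> \<beta> * (b j \<beta> \<gamma> * b k \<gamma> \<alpha>)) = (\<Sum>s=1..p \<beta> \<alpha>. \<psi> j k s \<beta> \<gamma> \<alpha> * lam i s \<alpha> \<beta>)"
    using be_b[OF I(1)] b_e[OF I(1,2) i(1)] i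
    by (auto simp: b_times_b[OF I(2,3,1) i(2,3)] lin distrib_left sum_distrib_left lam_def[of i])
  ultimately show ?thesis by (simp add: mult.assoc)
qed

lemma lin_form_b_times_a:
  assumes I: "\<alpha> \<in> {1..m}" "\<beta> \<in> {1..m}" "\<gamma> \<in> {1..m}" and i: "i \<in> {1..p \<alpha> \<beta>}" and j: "j \<in> {1..p \<gamma> \<beta>}"
    and f: "lin_form f"
  shows "f (b i \<alpha> \<beta> * a j \<beta> \<gamma>) =
    (\<Sum>k=1..p \<alpha> \<gamma>. \<phi> i j k \<beta> \<gamma> \<alpha> * f (b k \<alpha> \<gamma>)) + (\<Sum>k=1..p \<gamma> \<alpha>. \<psi> k i j \<gamma> \<alpha> \<beta> * f (a k \<alpha> \<gamma>))
    + of_bool (\<alpha> = \<gamma>) * t i j \<alpha> \<beta> * f (e \<alpha>) + of_bool (\<alpha> = \<gamma>) * of_bool (i = j) * f (c \<alpha>)"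
  by (simp add: b_times_a[OF I i j] lin_form_simps[OF f] del: of_bool_eq_iff)

text \<open>Both bracketings of baa are expanded under an arbitrary functional, and the terms with b
  and c on which the duals of the a's are uncontrolled are matched. The only b-terms left over
  accompany c a_k with coefficients \<mu>; they are the leading terms in the expansion of that
  product.\<close>

lemma b_a_a_assoc:
  assumes I: "\<alpha> \<in> {1..m}" "\<beta> \<in> {1..m}" "\<gamma> \<in> {1..m}" "\<delta> \<in> {1..m}"
    and i: "i \<in> {1..p \<alpha> \<beta>}" "j \<in> {1..p \<gamma> \<beta>}" "k \<in> {1..p \<delta> \<gamma>}" and f: "lin_form f"
  shows "(\<Sum>s=1..p \<delta> \<beta>. \<phi> s j k \<beta> \<gamma> \<delta> *
      ((\<Sum>r=1..p \<delta> \<alpha>. \<psi> r i s \<delta> \<alpha> \<beta> * f (a r \<alpha> \<delta>)) + of_bool (\<alpha> = \<delta>) * t i s \<alpha> \<beta> * f (e \<alpha>))) =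
    (\<Sum>s=1..p \<alpha> \<gamma>. \<phi> i j s \<beta> \<gamma> \<alpha> *
      ((\<Sum>r=1..p \<delta> \<alpha>. \<psi> r s k \<delta> \<alpha> \<gamma> * f (a r \<alpha> \<delta>)) + of_bool (\<alpha> = \<delta>) * t s k \<alpha> \<gamma> * f (e \<alpha>)))
    + (\<Sum>s=1..p \<gamma> \<alpha>. \<psi> s i j \<gamma> \<alpha> \<beta> * f (a s \<alpha> \<gamma> * a k \<gamma> \<delta>))
    + of_bool (\<alpha> = \<gamma>) * t i j \<alpha> \<beta> * f (a k \<gamma> \<delta>)
    + of_bool (\<alpha> = \<gamma>) * of_bool (i = j) * (f (c \<gamma> * a k \<gamma> \<delta>) - (\<Sum>r=1..p \<alpha> \<delta>. \<mu> k r \<gamma> \<delta> * f (b r \<alpha> \<delta>)))"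
proof -
  let ?B1 = "\<Sum>s=1..p \<delta> \<beta>. \<phi> s j k \<beta> \<gamma> \<delta> * (\<Sum>r=1..p \<alpha> \<delta>. \<phi> i s r \<beta> \<delta> \<alpha> * f (b r \<alpha> \<delta>))"
  let ?B2 = "\<Sum>s=1..p \<alpha> \<gamma>. \<phi> i j s \<beta> \<gamma> \<alpha> * (\<Sum>r=1..p \<alpha> \<delta>. \<phi> s k r \<gamma> \<delta> \<alpha> * f (b r \<alpha> \<delta>))"
  let ?A1 = "\<lambda>s. (\<Sum>r=1..p \<delta> \<alpha>. \<psi> r i s \<delta> \<alpha> \<beta> * f (a r \<alpha> \<delta>)) + of_bool (\<alpha> = \<delta>) * t i s \<alpha> \<beta> * f (e \<alpha>)"
  let ?A2 = "\<lambda>s. (\<Sum>r=1..p \<delta> \<alpha>. \<psi> r s k \<delta> \<alpha> \<gamma> * f (a r \<alpha> \<delta>)) + of_bool (\<alpha> = \<delta>) * t s k \<alpha> \<gamma> * f (e \<alpha>)"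
  \<comment> \<open>All coefficients of the b's are compared by \<open>\<phi>_assoc\<close>, whose
    two terms with \<mu> account for b times the multiple of 1 in aa and for the remainder next to c
    a_k.\<close>
  have B: "?B1 + of_bool (\<beta> = \<delta>) * \<mu> j k \<beta> \<gamma> * f (b i \<alpha> \<beta>) =
    ?B2 + of_bool (\<alpha> = \<gamma>) * of_bool (i = j) * (\<Sum>r=1..p \<alpha> \<delta>. \<mu> k r \<gamma> \<delta> * f (b r \<alpha> \<delta>))"
  proof -
    have "(\<Sum>r=1..p \<alpha> \<delta>. ((\<Sum>s=1..p \<delta> \<beta>. \<phi> s j k \<beta> \<gamma> \<delta> * \<phi> i s r \<beta> \<delta> \<alpha>) + of_bool (i = r) * of_bool (\<beta> = \<delta>) * \<mu> j k \<beta> \<gamma>) * f (b r \<alpha> \<delta>))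
      = (\<Sum>r=1..p \<alpha> \<delta>. ((\<Sum>s=1..p \<alpha> \<gamma>. \<phi> i j s \<beta> \<gamma> \<alpha> * \<phi> s k r \<gamma> \<delta> \<alpha>) + of_bool (i = j) * of_bool (\<gamma> = \<alpha>) * \<mu> k r \<gamma> \<delta>) * f (b r \<alpha> \<delta>))"
      by (intro sum.cong refl arg_cong2[where f = "(*)"] \<phi>_assoc I i)
    moreover have "(\<Sum>r=1..p \<alpha> \<delta>. of_bool (i = r) * of_bool (\<beta> = \<delta>) * \<mu> j k \<beta> \<gamma> * f (b r \<alpha> \<delta>))
      = of_bool (\<beta> = \<delta>) * \<mu> j k \<beta> \<gamma> * f (b i \<alpha> \<beta>)"
    proof (cases "\<beta> = \<delta>")
      case True
      have "(\<Sum>r=1..p \<alpha> \<delta>. of_bool (i = r) * of_bool (\<beta> = \<delta>) * \<mu> j k \<beta> \<gamma> * f (b r \<alpha> \<delta>))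
        = (\<Sum>r=1..p \<alpha> \<delta>. if r = i then \<mu> j k \<beta> \<gamma> * f (b i \<alpha> \<beta>) else 0)"
        using True by (intro sum.cong) auto
      with True i(1) show ?thesis by simp
    qed simp
    moreover have "?B1 = (\<Sum>r=1..p \<alpha> \<delta>. (\<Sum>s=1..p \<delta> \<beta>. \<phi> s j k \<beta> \<gamma> \<delta> * \<phi> i s r \<beta> \<delta> \<alpha>) * f (b r \<alpha> \<delta>))"
      unfolding sum_distrib_left sum_distrib_right by (subst sum.swap) (simp add: mult.assoc)
    moreover have "?B2 = (\<Sum>r=1..p \<alpha> \<delta>. (\<Sum>s=1..p \<alpha> \<gamma>. \<phi> i j s \<beta> \<gamma> \<alpha> * \<phi> s k r \<gamma> \<delta> \<alpha>) * f (b r \<alpha> \<delta>))"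
      unfolding sum_distrib_left sum_distrib_right by (subst sum.swap) (simp add: mult.assoc)
    moreover have "(\<Sum>r=1..p \<alpha> \<delta>. of_bool (i = j) * of_bool (\<gamma> = \<alpha>) * \<mu> k r \<gamma> \<delta> * f (b r \<alpha> \<delta>))
      = of_bool (\<alpha> = \<gamma>) * of_bool (i = j) * (\<Sum>r=1..p \<alpha> \<delta>. \<mu> k r \<gamma> \<delta> * f (b r \<alpha> \<delta>))"
      unfolding sum_distrib_left by (auto intro!: sum.cong)
    ultimately show ?thesis by (simp only: distrib_right sum.distrib)
  qed
  \<comment> \<open>The multiples of c in the two bracketings are the same, namely \<phi> c by the
    delta in the expansion of ba.\<close>
  have C1: "(\<Sum>s=1..p \<delta> \<beta>. \<phi> s j k \<beta> \<gamma> \<delta> * (of_bool (\<alpha> = \<delta>) * of_bool (i = s) * f (c \<alpha>)))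
    = of_bool (\<alpha> = \<delta>) * \<phi> i j k \<beta> \<gamma> \<alpha> * f (c \<alpha>)"
  proof (cases "\<alpha> = \<delta>")
    case True
    have "(\<Sum>s=1..p \<delta> \<beta>. \<phi> s j k \<beta> \<gamma> \<delta> * (of_bool (\<alpha> = \<delta>) * of_bool (i = s) * f (c \<alpha>)))
      = (\<Sum>s=1..p \<delta> \<beta>. if s = i then \<phi> i j k \<beta> \<gamma> \<alpha> * f (c \<alpha>) else 0)"
      using True by (intro sum.cong) auto
    with True i(1) show ?thesis by simp
  qed simp
  have C2: "(\<Sum>s=1..p \<alpha> \<gamma>. \<phi> i j s \<beta> \<gamma> \<alpha> * (of_bool (\<alpha> = \<delta>) * of_bool (s = k) * f (c \<alpha>)))
    = of_bool (\<alpha> = \<delta>) * \<phi> i j k \<beta> \<gamma> \<alpha> * f (c \<alpha>)"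
  proof (cases "\<alpha> = \<delta>")
    case True
    have "(\<Sum>s=1..p \<alpha> \<gamma>. \<phi> i j s \<beta> \<gamma> \<alpha> * (of_bool (\<alpha> = \<delta>) * of_bool (s = k) * f (c \<alpha>)))
      = (\<Sum>s=1..p \<alpha> \<gamma>. if s = k then \<phi> i j k \<beta> \<gamma> \<alpha> * f (c \<alpha>) else 0)"
      using True by (intro sum.cong) auto
    with True i(3) show ?thesis by simp
  qed simp
  have "f (b i \<alpha> \<beta> * (a j \<beta> \<gamma> * a k \<gamma> \<delta>)) =
    (\<Sum>s=1..p \<delta> \<beta>. \<phi> s j k \<beta> \<gamma> \<delta> * f (b i \<alpha> \<beta> * a s \<beta> \<delta>)) + of_bool (\<beta> = \<delta>) * \<mu> j k \<beta> \<gamma> * f (b i \<alpha> \<beta>)"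
    using b_e[OF I(1,2) i(1)]
    by (auto simp: a_times_a[OF I(2-4) i(2,3)] lin_form_simps[OF f] distrib_left sum_distrib_left)
  also have "(\<Sum>s=1..p \<delta> \<beta>. \<phi> s j k \<beta> \<gamma> \<delta> * f (b i \<alpha> \<beta> * a s \<beta> \<delta>)) =
    (\<Sum>s=1..p \<delta> \<beta>. \<phi> s j k \<beta> \<gamma> \<delta> * (\<Sum>r=1..p \<alpha> \<delta>. \<phi> i s r \<beta> \<delta> \<alpha> * f (b r \<alpha> \<delta>))
      + \<phi> s j k \<beta> \<gamma> \<delta> * ?A1 s + \<phi> s j k \<beta> \<gamma> \<delta> * (of_bool (\<alpha> = \<delta>) * of_bool (i = s) * f (c \<alpha>)))"
    by (intro sum.cong refl) (simp only: lin_form_b_times_a[OF I(1,2,4) i(1) _ f] distrib_left add.assoc)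
  finally have 1: "f (b i \<alpha> \<beta> * (a j \<beta> \<gamma> * a k \<gamma> \<delta>)) =
    ?B1 + (\<Sum>s=1..p \<delta> \<beta>. \<phi> s j k \<beta> \<gamma> \<delta> * ?A1 s) + of_bool (\<alpha> = \<delta>) * \<phi> i j k \<beta> \<gamma> \<alpha> * f (c \<alpha>)
    + of_bool (\<beta> = \<delta>) * \<mu> j k \<beta> \<gamma> * f (b i \<alpha> \<beta>)"
    unfolding sum.distrib C1 .
  have "f ((b i \<alpha> \<beta> * a j \<beta> \<gamma>) * a k \<gamma> \<delta>) =
    (\<Sum>s=1..p \<alpha> \<gamma>. \<phi> i j s \<beta> \<gamma> \<alpha> * f (b s \<alpha> \<gamma> * a k \<gamma> \<delta>))
    + (\<Sum>s=1..p \<gamma> \<alpha>. \<psi> s i j \<gamma> \<alpha> \<beta> * f (a s \<alpha> \<gamma> * a k \<gamma> \<delta>))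
    + of_bool (\<alpha> = \<gamma>) * t i j \<alpha> \<beta> * f (a k \<gamma> \<delta>) + of_bool (\<alpha> = \<gamma>) * of_bool (i = j) * f (c \<gamma> * a k \<gamma> \<delta>)"
    using e_a[OF I(4,3) i(3)]
    by (auto simp: b_times_a[OF I(1-3) i(1,2)] lin_form_simps[OF f] distrib_right sum_distrib_right)
  also have "(\<Sum>s=1..p \<alpha> \<gamma>. \<phi> i j s \<beta> \<gamma> \<alpha> * f (b s \<alpha> \<gamma> * a k \<gamma> \<delta>)) =
    (\<Sum>s=1..p \<alpha> \<gamma>. \<phi> i j s \<beta> \<gamma> \<alpha> * (\<Sum>r=1..p \<alpha> \<delta>. \<phi> s k r \<gamma> \<delta> \<alpha> * f (b r \<alpha> \<delta>))
      + \<phi> i j s \<beta> \<gamma> \<alpha> * ?A2 s + \<phi> i j s \<beta> \<gamma> \<alpha> * (of_bool (\<alpha> = \<delta>) * of_bool (s = k) * f (c \<alpha>)))"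
    by (intro sum.cong refl) (simp only: lin_form_b_times_a[OF I(1,3,4) _ i(3) f] distrib_left add.assoc)
  finally have 2: "f ((b i \<alpha> \<beta> * a j \<beta> \<gamma>) * a k \<gamma> \<delta>) =
    ?B2 + (\<Sum>s=1..p \<alpha> \<gamma>. \<phi> i j s \<beta> \<gamma> \<alpha> * ?A2 s) + of_bool (\<alpha> = \<delta>) * \<phi> i j k \<beta> \<gamma> \<alpha> * f (c \<alpha>)
    + (\<Sum>s=1..p \<gamma> \<alpha>. \<psi> s i j \<gamma> \<alpha> \<beta> * f (a s \<alpha> \<gamma> * a k \<gamma> \<delta>))
    + of_bool (\<alpha> = \<gamma>) * t i j \<alpha> \<beta> * f (a k \<gamma> \<delta>) + of_bool (\<alpha> = \<gamma>) * of_bool (i = j) * f (c \<gamma> * a k \<gamma> \<delta>)"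
    unfolding sum.distrib C2 .
  from 1 2 B show ?thesis unfolding mult.assoc[of "b i \<alpha> \<beta>"] right_diff_distrib by Groebner_Basis.algebra
qed

text \<open>The coordinate of a_l in baa. Inserting \<open>c_times_a\<close> makes the \<mu> b
  remainder cancel and brings in the terms with t and the sum over \<nu>.\<close>

lemma \<phi>_\<psi>_assoc:
  assumes I: "\<alpha> \<in> {1..m}" "\<beta> \<in> {1..m}" "\<gamma> \<in> {1..m}" "\<delta> \<in> {1..m}"
    and i: "i \<in> {1..p \<alpha> \<beta>}" "j \<in> {1..p \<gamma> \<beta>}" "k \<in> {1..p \<delta> \<gamma>}" "l \<in> {1..p \<delta> \<alpha>}"
  shows "(\<Sum>s=1..p \<delta> \<beta>. \<phi> s j k \<beta> \<gamma> \<delta> * \<psi> l i s \<delta> \<alpha> \<beta>) =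
        (\<Sum>s=1..p \<gamma> \<alpha>. \<phi> l s k \<alpha> \<gamma> \<delta> * \<psi> s i j \<gamma> \<alpha> \<beta>)
          + (\<Sum>s=1..p \<alpha> \<gamma>. \<phi> i j s \<beta> \<gamma> \<alpha> * \<psi> l s k \<delta> \<alpha> \<gamma>)
          + of_bool (l = k) * of_bool (\<alpha> = \<gamma>) * t i j \<alpha> \<beta>
          - of_bool (i = j) * of_bool (\<alpha> = \<gamma>) * t l k \<delta> \<alpha>
          - of_bool (i = j) * of_bool (\<alpha> = \<gamma>) *
              (\<Sum>\<nu>=1..m. \<Sum>s=1..p \<nu> \<alpha>. \<Sum>r=1..p \<delta> \<nu>. \<phi> l s r \<alpha> \<nu> \<delta> * \<psi> r s k \<delta> \<nu> \<alpha>)"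
proof -
  let ?f = "as \<alpha> \<delta> l"
  note f = lin_form_as[OF I(4,1) i(4)]
  have a: "(\<Sum>r=1..p \<delta> \<alpha>. F r * ?f (a r \<alpha> \<delta>)) = F l" for F
    using sum_as_a[OF I(4,1) i(4), of F] by (simp add: mult.commute)
  have e: "of_bool (\<alpha> = \<delta>) * x * ?f (e \<alpha>) = 0" for x
    using as_e'[OF I(4,1) i(4)] by auto
  have ak: "of_bool (\<alpha> = \<gamma>) * t i j \<alpha> \<beta> * ?f (a k \<gamma> \<delta>) = of_bool (l = k) * of_bool (\<alpha> = \<gamma>) * t i j \<alpha> \<beta>"
    using as_a[OF I(4,1) i(4)] i(3) by auto
  have c: "of_bool (\<alpha> = \<gamma>) * of_bool (i = j) * (?f (c \<gamma> * a k \<gamma> \<delta>) - (\<Sum>r=1..p \<alpha> \<delta>. \<mu> k r \<gamma> \<delta> * ?f (b r \<alpha> \<delta>)))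
    = - of_bool (i = j) * of_bool (\<alpha> = \<gamma>) * t l k \<delta> \<alpha>
          - of_bool (i = j) * of_bool (\<alpha> = \<gamma>) *
              (\<Sum>\<nu>=1..m. \<Sum>s=1..p \<nu> \<alpha>. \<Sum>r=1..p \<delta> \<nu>. \<phi> l s r \<alpha> \<nu> \<delta> * \<psi> r s k \<delta> \<nu> \<alpha>)"
  proof (cases "\<alpha> = \<gamma>")
    case True
    then have k: "k \<in> {1..p \<delta> \<alpha>}" using i(3) by simp
    have "?f (c \<alpha> * a k \<alpha> \<delta>) = (\<Sum>r=1..p \<alpha> \<delta>. \<mu> k r \<alpha> \<delta> * ?f (b r \<alpha> \<delta>)) - t l k \<delta> \<alpha>
      - (\<Sum>\<nu>=1..m. \<Sum>s=1..p \<nu> \<alpha>. \<Sum>r=1..p \<delta> \<nu>. \<phi> l s r \<alpha> \<nu> \<delta> * \<psi> r s k \<delta> \<nu> \<alpha>)"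
      unfolding c_times_a[OF I(1,4) k] lin_form_simps[OF f] a e by simp
    with True show ?thesis by (simp add: algebra_simps)
  qed simp
  show ?thesis
    using b_a_a_assoc[OF I i(1-3) f] unfolding a e ak c \<phi>_def[of l, symmetric] by (simp add: mult.commute)
qed

text \<open>The coordinate of 1 in the same expansion of baa, with \<delta> = \<alpha>. Here
  \<open>ae\<close> removes every single a, so of \<open>c_times_a\<close> only the multiple of 1 is
  left after the b-terms cancel.\<close>

lemma \<phi>_t_assoc:
  assumes I: "\<alpha> \<in> {1..m}" "\<beta> \<in> {1..m}" "\<gamma> \<in> {1..m}"
    and i: "i \<in> {1..p \<alpha> \<beta>}" "j \<in> {1..p \<gamma> \<beta>}" "k \<in> {1..p \<alpha> \<gamma>}"
  shows "(\<Sum>s=1..p \<alpha> \<beta>. \<phi> s j k \<beta> \<gamma> \<alpha> * t i s \<alpha> \<beta>) =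
        (\<Sum>s=1..p \<gamma> \<alpha>. \<psi> s i j \<gamma> \<alpha> \<beta> * \<mu> s k \<alpha> \<gamma>)
          + (\<Sum>s=1..p \<alpha> \<gamma>. \<phi> i j s \<beta> \<gamma> \<alpha> * t s k \<alpha> \<gamma>)
          - of_bool (i = j) * of_bool (\<alpha> = \<gamma>) *
              (\<Sum>\<nu>=1..m. \<Sum>s=1..p \<alpha> \<nu>. \<Sum>r=1..p \<nu> \<alpha>. \<psi> s r k \<alpha> \<nu> \<alpha> * \<mu> r s \<alpha> \<nu>)"
proof -
  let ?f = "ae \<alpha>"
  note f = lin_form_ae[OF I(1)]
  have a: "(\<Sum>r=1..p \<alpha> \<alpha>. F r * ?f (a r \<alpha> \<alpha>)) = 0" for F
    using ae_a[OF I(1)] by simp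
  have ak: "of_bool (\<alpha> = \<gamma>) * t i j \<alpha> \<beta> * ?f (a k \<gamma> \<alpha>) = 0"
    using ae_a[OF I(1)] i(3) by auto
  have c: "of_bool (\<alpha> = \<gamma>) * of_bool (i = j) * (?f (c \<gamma> * a k \<gamma> \<alpha>) - (\<Sum>r=1..p \<alpha> \<alpha>. \<mu> k r \<gamma> \<alpha> * ?f (b r \<alpha> \<alpha>)))
    = - of_bool (i = j) * of_bool (\<alpha> = \<gamma>) *
              (\<Sum>\<nu>=1..m. \<Sum>s=1..p \<alpha> \<nu>. \<Sum>r=1..p \<nu> \<alpha>. \<psi> s r k \<alpha> \<nu> \<alpha> * \<mu> r s \<alpha> \<nu>)"
  proof (cases "\<alpha> = \<gamma>")
    case True
    have "?f (c \<alpha> * a k \<alpha> \<alpha>) = (\<Sum>r=1..p \<alpha> \<alpha>. \<mu> k r \<alpha> \<alpha> * ?f (b r \<alpha> \<alpha>))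
      - (\<Sum>\<nu>=1..m. \<Sum>r=1..p \<nu> \<alpha>. \<Sum>s=1..p \<alpha> \<nu>. \<mu> r s \<alpha> \<nu> * \<psi> s r k \<alpha> \<nu> \<alpha>)"
      using c_times_a[OF I(1,1), of k] i(3) by (simp add: True[symmetric] lin_form_simps[OF f] ae_a[OF I(1)] ae_e[OF I(1)])
    also have "(\<Sum>\<nu>=1..m. \<Sum>r=1..p \<nu> \<alpha>. \<Sum>s=1..p \<alpha> \<nu>. \<mu> r s \<alpha> \<nu> * \<psi> s r k \<alpha> \<nu> \<alpha>)
      = (\<Sum>\<nu>=1..m. \<Sum>s=1..p \<alpha> \<nu>. \<Sum>r=1..p \<nu> \<alpha>. \<psi> s r k \<alpha> \<nu> \<alpha> * \<mu> r s \<alpha> \<nu>)"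
      by (rule sum.cong[OF refl], subst sum.swap) (simp add: mult.commute)
    finally show ?thesis using True by (simp add: algebra_simps)
  qed simp
  show ?thesis
    using b_a_a_assoc[OF I I(1) i f] unfolding a ak c \<mu>_def[of _ k, symmetric] ae_e[OF I(1)] by simp
qed

text \<open>Both bracketings of bba are evaluated with \<open>be\<close>, which removes the single
  b's and turns bb into \<open>lam\<close>. Now it is the a's and c on which the functional is
  uncontrolled, and these terms are matched before the comparison.\<close>

lemma \<psi>_t_assoc:
  assumes I: "\<alpha> \<in> {1..m}" "\<beta> \<in> {1..m}" "\<gamma> \<in> {1..m}"
    and i: "i \<in> {1..p \<beta> \<gamma>}" "j \<in> {1..p \<alpha> \<gamma>}" "k \<in> {1..p \<alpha> \<beta>}"
  shows "(\<Sum>s=1..p \<alpha> \<gamma>. \<psi> k i s \<alpha> \<beta> \<gamma> * t s j \<alpha> \<gamma>) =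
        (\<Sum>s=1..p \<beta> \<alpha>. \<phi> i j s \<gamma> \<alpha> \<beta> * lam k s \<alpha> \<beta>)
          + (\<Sum>s=1..p \<alpha> \<beta>. \<psi> s i j \<alpha> \<beta> \<gamma> * t k s \<alpha> \<beta>)
          - of_bool (i = j) * of_bool (\<alpha> = \<beta>) *
              (\<Sum>\<nu>=1..m. \<Sum>s=1..p \<nu> \<alpha>. \<Sum>r=1..p \<alpha> \<nu>. \<phi> k s r \<alpha> \<nu> \<alpha> * lam r s \<alpha> \<nu>)"
proof -
  let ?f = "be \<alpha>"
  note f = lin_form_be[OF I(1)]
  let ?A1 = "\<Sum>s=1..p \<alpha> \<gamma>. \<psi> k i s \<alpha> \<beta> \<gamma> * (\<Sum>r=1..p \<alpha> \<alpha>. \<psi> r s j \<alpha> \<alpha> \<gamma> * ?f (a r \<alpha> \<alpha>))"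
  let ?A2 = "\<Sum>s=1..p \<alpha> \<beta>. \<psi> s i j \<alpha> \<beta> \<gamma> * (\<Sum>r=1..p \<alpha> \<alpha>. \<psi> r k s \<alpha> \<alpha> \<beta> * ?f (a r \<alpha> \<alpha>))"
  \<comment> \<open>The coefficients of the a's are compared by \<open>\<psi>_assoc\<close>. The
    surplus with \<open>lam\<close> next to b_k c is the leading term of \<open>b_times_c\<close>;
    the other one is the multiple of 1 in bb times a_j.\<close>
  have A: "?A2 + of_bool (\<alpha> = \<beta>) * of_bool (i = j) * (\<Sum>r=1..p \<alpha> \<alpha>. lam r k \<alpha> \<alpha> * ?f (a r \<alpha> \<alpha>)) =
    ?A1 + of_bool (\<alpha> = \<gamma>) * lam k i \<alpha> \<beta> * ?f (a j \<gamma> \<alpha>)"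
  proof -
    have "(\<Sum>r=1..p \<alpha> \<alpha>. ((\<Sum>s=1..p \<alpha> \<beta>. \<psi> r k s \<alpha> \<alpha> \<beta> * \<psi> s i j \<alpha> \<beta> \<gamma>) + of_bool (i = j) * of_bool (\<alpha> = \<beta>) * lam r k \<alpha> \<alpha>) * ?f (a r \<alpha> \<alpha>))
      = (\<Sum>r=1..p \<alpha> \<alpha>. ((\<Sum>s=1..p \<alpha> \<gamma>. \<psi> k i s \<alpha> \<beta> \<gamma> * \<psi> r s j \<alpha> \<alpha> \<gamma>) + of_bool (r = j) * of_bool (\<alpha> = \<gamma>) * lam k i \<alpha> \<beta>) * ?f (a r \<alpha> \<alpha>))"
      by (intro sum.cong refl arg_cong2[where f = "(*)"] \<psi>_assoc I i)
    moreover have "(\<Sum>r=1..p \<alpha> \<alpha>. of_bool (r = j) * of_bool (\<alpha> = \<gamma>) * lam k i \<alpha> \<beta> * ?f (a r \<alpha> \<alpha>))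
      = of_bool (\<alpha> = \<gamma>) * lam k i \<alpha> \<beta> * ?f (a j \<gamma> \<alpha>)"
    proof (cases "\<alpha> = \<gamma>")
      case True
      have "(\<Sum>r=1..p \<alpha> \<alpha>. of_bool (r = j) * of_bool (\<alpha> = \<gamma>) * lam k i \<alpha> \<beta> * ?f (a r \<alpha> \<alpha>))
        = (\<Sum>r=1..p \<alpha> \<alpha>. if r = j then lam k i \<alpha> \<beta> * ?f (a j \<gamma> \<alpha>) else 0)"
        using True by (intro sum.cong) auto
      with True i(2) show ?thesis by simp
    qed simp
    moreover have "?A1 = (\<Sum>r=1..p \<alpha> \<alpha>. (\<Sum>s=1..p \<alpha> \<gamma>. \<psi> k i s \<alpha> \<beta> \<gamma> * \<psi> r s j \<alpha> \<alpha> \<gamma>) * ?f (a r \<alpha> \<alpha>))"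
      unfolding sum_distrib_left sum_distrib_right by (subst sum.swap) (simp add: mult.assoc)
    moreover have "?A2 = (\<Sum>r=1..p \<alpha> \<alpha>. (\<Sum>s=1..p \<alpha> \<beta>. \<psi> r k s \<alpha> \<alpha> \<beta> * \<psi> s i j \<alpha> \<beta> \<gamma>) * ?f (a r \<alpha> \<alpha>))"
      unfolding sum_distrib_left sum_distrib_right by (subst sum.swap) (simp add: mult_ac)
    moreover have "(\<Sum>r=1..p \<alpha> \<alpha>. of_bool (i = j) * of_bool (\<alpha> = \<beta>) * lam r k \<alpha> \<alpha> * ?f (a r \<alpha> \<alpha>))
      = of_bool (\<alpha> = \<beta>) * of_bool (i = j) * (\<Sum>r=1..p \<alpha> \<alpha>. lam r k \<alpha> \<alpha> * ?f (a r \<alpha> \<alpha>))"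
      unfolding sum_distrib_left by (auto intro!: sum.cong)
    ultimately show ?thesis by (simp only: distrib_right sum.distrib)
  qed
  have b: "(\<Sum>r=1..p \<alpha> \<alpha>. F r * ?f (b r \<alpha> \<alpha>)) = 0" for F
    using be_b[OF I(1)] by simp
  have bk: "of_bool (\<beta> = \<alpha>) * t i j \<beta> \<gamma> * ?f (b k \<alpha> \<beta>) = 0"
    using be_b[OF I(1)] i(3) by auto
  have C1: "(\<Sum>s=1..p \<alpha> \<gamma>. \<psi> k i s \<alpha> \<beta> \<gamma> * (of_bool (s = j) * ?f (c \<alpha>))) = \<psi> k i j \<alpha> \<beta> \<gamma> * ?f (c \<alpha>)"
  proof -
    have "(\<Sum>s=1..p \<alpha> \<gamma>. \<psi> k i s \<alpha> \<beta> \<gamma> * (of_bool (s = j) * ?f (c \<alpha>)))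
      = (\<Sum>s=1..p \<alpha> \<gamma>. if s = j then \<psi> k i j \<alpha> \<beta> \<gamma> * ?f (c \<alpha>) else 0)"
      by (intro sum.cong) auto
    with i(2) show ?thesis by simp
  qed
  have C2: "(\<Sum>s=1..p \<alpha> \<beta>. \<psi> s i j \<alpha> \<beta> \<gamma> * (of_bool (k = s) * ?f (c \<alpha>))) = \<psi> k i j \<alpha> \<beta> \<gamma> * ?f (c \<alpha>)"
  proof -
    have "(\<Sum>s=1..p \<alpha> \<beta>. \<psi> s i j \<alpha> \<beta> \<gamma> * (of_bool (k = s) * ?f (c \<alpha>)))
      = (\<Sum>s=1..p \<alpha> \<beta>. if s = k then \<psi> k i j \<alpha> \<beta> \<gamma> * ?f (c \<alpha>) else 0)"
      by (intro sum.cong) auto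
    with i(3) show ?thesis by simp
  qed
  have c: "of_bool (\<alpha> = \<beta>) * of_bool (i = j) * ?f (b k \<alpha> \<beta> * c \<beta>) =
    of_bool (\<alpha> = \<beta>) * of_bool (i = j) * (\<Sum>r=1..p \<alpha> \<alpha>. lam r k \<alpha> \<alpha> * ?f (a r \<alpha> \<alpha>))
    - of_bool (i = j) * of_bool (\<alpha> = \<beta>) *
              (\<Sum>\<nu>=1..m. \<Sum>s=1..p \<nu> \<alpha>. \<Sum>r=1..p \<alpha> \<nu>. \<phi> k s r \<alpha> \<nu> \<alpha> * lam r s \<alpha> \<nu>)"
  proof (cases "\<alpha> = \<beta>")
    case True
    have "?f (b k \<alpha> \<alpha> * c \<alpha>) = (\<Sum>r=1..p \<alpha> \<alpha>. lam r k \<alpha> \<alpha> * ?f (a r \<alpha> \<alpha>))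
      - (\<Sum>\<nu>=1..m. \<Sum>r=1..p \<alpha> \<nu>. \<Sum>s=1..p \<nu> \<alpha>. \<phi> k s r \<alpha> \<nu> \<alpha> * lam r s \<alpha> \<nu>)"
      using b_times_c[OF I(1,1), of k] i(3) by (simp add: True[symmetric] lin_form_simps[OF f] be_b[OF I(1)] be_e[OF I(1)])
    also have "(\<Sum>\<nu>=1..m. \<Sum>r=1..p \<alpha> \<nu>. \<Sum>s=1..p \<nu> \<alpha>. \<phi> k s r \<alpha> \<nu> \<alpha> * lam r s \<alpha> \<nu>)
      = (\<Sum>\<nu>=1..m. \<Sum>s=1..p \<nu> \<alpha>. \<Sum>r=1..p \<alpha> \<nu>. \<phi> k s r \<alpha> \<nu> \<alpha> * lam r s \<alpha> \<nu>)"
      by (rule sum.cong[OF refl], rule sum.swap)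
    finally show ?thesis using True by (simp add: algebra_simps)
  qed simp
  have "?f ((b k \<alpha> \<beta> * b i \<beta> \<gamma>) * a j \<gamma> \<alpha>) =
    (\<Sum>s=1..p \<alpha> \<gamma>. \<psi> k i s \<alpha> \<beta> \<gamma> * ?f (b s \<alpha> \<gamma> * a j \<gamma> \<alpha>)) + of_bool (\<alpha> = \<gamma>) * lam k i \<alpha> \<beta> * ?f (a j \<gamma> \<alpha>)"
    using e_a[OF I(1,3) i(2)]
    by (auto simp: b_times_b[OF I i(3,1)] lin_form_simps[OF f] distrib_right sum_distrib_right)
  also have "(\<Sum>s=1..p \<alpha> \<gamma>. \<psi> k i s \<alpha> \<beta> \<gamma> * ?f (b s \<alpha> \<gamma> * a j \<gamma> \<alpha>)) =
    (\<Sum>s=1..p \<alpha> \<gamma>. \<psi> k i s \<alpha> \<beta> \<gamma> * (\<Sum>r=1..p \<alpha> \<alpha>. \<psi> r s j \<alpha> \<alpha> \<gamma> * ?f (a r \<alpha> \<alpha>))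
      + \<psi> k i s \<alpha> \<beta> \<gamma> * t s j \<alpha> \<gamma> + \<psi> k i s \<alpha> \<beta> \<gamma> * (of_bool (s = j) * ?f (c \<alpha>)))"
    by (intro sum.cong refl) (simp add: lin_form_b_times_a[OF I(1,3,1) _ i(2) f] b be_b[OF I(1)] be_e[OF I(1)] distrib_left add.assoc)
  finally have 1: "?f ((b k \<alpha> \<beta> * b i \<beta> \<gamma>) * a j \<gamma> \<alpha>) =
    ?A1 + (\<Sum>s=1..p \<alpha> \<gamma>. \<psi> k i s \<alpha> \<beta> \<gamma> * t s j \<alpha> \<gamma>) + \<psi> k i j \<alpha> \<beta> \<gamma> * ?f (c \<alpha>)
    + of_bool (\<alpha> = \<gamma>) * lam k i \<alpha> \<beta> * ?f (a j \<gamma> \<alpha>)"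
    unfolding sum.distrib C1 .
  have "?f (b k \<alpha> \<beta> * (b i \<beta> \<gamma> * a j \<gamma> \<alpha>)) =
    (\<Sum>s=1..p \<beta> \<alpha>. \<phi> i j s \<gamma> \<alpha> \<beta> * lam k s \<alpha> \<beta>)
    + (\<Sum>s=1..p \<alpha> \<beta>. \<psi> s i j \<alpha> \<beta> \<gamma> * ?f (b k \<alpha> \<beta> * a s \<beta> \<alpha>))
    + of_bool (\<beta> = \<alpha>) * t i j \<beta> \<gamma> * ?f (b k \<alpha> \<beta>) + of_bool (\<alpha> = \<beta>) * of_bool (i = j) * ?f (b k \<alpha> \<beta> * c \<beta>)"
    using b_e[OF I(1,2) i(3)]
    by (auto simp: b_times_a[OF I(2,3,1) i(1,2)] lin_form_simps[OF f] distrib_left sum_distrib_left lam_def)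
  also have "(\<Sum>s=1..p \<alpha> \<beta>. \<psi> s i j \<alpha> \<beta> \<gamma> * ?f (b k \<alpha> \<beta> * a s \<beta> \<alpha>)) =
    (\<Sum>s=1..p \<alpha> \<beta>. \<psi> s i j \<alpha> \<beta> \<gamma> * (\<Sum>r=1..p \<alpha> \<alpha>. \<psi> r k s \<alpha> \<alpha> \<beta> * ?f (a r \<alpha> \<alpha>))
      + \<psi> s i j \<alpha> \<beta> \<gamma> * t k s \<alpha> \<beta> + \<psi> s i j \<alpha> \<beta> \<gamma> * (of_bool (k = s) * ?f (c \<alpha>)))"
    by (intro sum.cong refl) (simp add: lin_form_b_times_a[OF I(1,2,1) i(3) _ f] b be_b[OF I(1)] be_e[OF I(1)] distrib_left add.assoc)
  finally have 2: "?f (b k \<alpha> \<beta> * (b i \<beta> \<gamma> * a j \<gamma> \<alpha>)) =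
    (\<Sum>s=1..p \<beta> \<alpha>. \<phi> i j s \<gamma> \<alpha> \<beta> * lam k s \<alpha> \<beta>) + ?A2 + (\<Sum>s=1..p \<alpha> \<beta>. \<psi> s i j \<alpha> \<beta> \<gamma> * t k s \<alpha> \<beta>)
    + \<psi> k i j \<alpha> \<beta> \<gamma> * ?f (c \<alpha>) + of_bool (\<alpha> = \<beta>) * of_bool (i = j) * ?f (b k \<alpha> \<beta> * c \<beta>)"
    unfolding sum.distrib C2 bk by simp
  from 1 2[unfolded c] A show ?thesis unfolding mult.assoc[of "b k \<alpha> \<beta>"] by Groebner_Basis.algebra
qed

end

section \<open>Matrices of fixed size\<close>

lift_definition of_mat :: "complex mat \<Rightarrow> fmat"
  is "\<lambda>X i j. if i < dim_row X \<and> j < dim_col X then X $$ (i, j) else 0"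
  by (rule_tac x = "max (dim_row mat) (dim_col mat)" in exI) auto

lemma supp_of_mat: "X \<in> carrier_mat r c \<Longrightarrow> supp r c (of_mat X)"
  by (auto simp: supp_def of_mat.rep_eq)

lemma of_mat_add: "X \<in> carrier_mat r c \<Longrightarrow> Y \<in> carrier_mat r c \<Longrightarrow> of_mat (X + Y) = of_mat X + of_mat Y"
  and of_mat_minus: "X \<in> carrier_mat r c \<Longrightarrow> Y \<in> carrier_mat r c \<Longrightarrow> of_mat (X - Y) = of_mat X - of_mat Y"
  and of_mat_smult: "of_mat (s \<cdot>\<^sub>m X) = s *\<^sub>C of_mat X"
  and of_mat_one: "of_mat (1\<^sub>m N) = idm N"
  and of_mat_zero: "of_mat (0\<^sub>m r c) = 0"
  by (auto intro!: fmat_eqI simp: of_mat.rep_eq ent_simps idm.rep_eq)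

lemma of_mat_times:
  assumes "X \<in> carrier_mat r k" "Y \<in> carrier_mat k c"
  shows "of_mat (X * Y) = of_mat X * of_mat Y"
proof (rule fmat_eqI)
  fix i j
  have "ent (of_mat X * of_mat Y) i j = (\<Sum>l<k. ent (of_mat X) i l * ent (of_mat Y) l j)"
    by (rule ent_times_supp[OF supp_of_mat[OF assms(1)]])
  with assms show "ent (of_mat (X * Y)) i j = ent (of_mat X * of_mat Y) i j"
    by (auto simp: of_mat.rep_eq scalar_prod_def atLeast0LessThan)
qed

text \<open>Padding forgets sizes, so that all zero matrices have the same image. Equality can be
  reflected only once both matrices are known to have the same size.\<close>

lemma of_mat_inject:
  assumes "X \<in> carrier_mat r c" "Y \<in> carrier_mat r c" "of_mat X = of_mat Y"
  shows "X = Y"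
proof (rule eq_matI)
  fix i j assume "i < dim_row Y" "j < dim_col Y"
  moreover have "ent (of_mat X) i j = ent (of_mat Y) i j" using assms(3) by simp
  ultimately show "X $$ (i, j) = Y $$ (i, j)" using assms(1,2) by (auto simp: of_mat.rep_eq)
qed (use assms in auto)

lemma of_mat_surj:
  assumes "supp r c x"
  shows "\<exists>X\<in>carrier_mat r c. of_mat X = x"
  using assms
  by (intro bexI[of _ "mat r c (\<lambda>(i, j). ent x i j)"])
    (auto intro!: fmat_eqI simp: of_mat.rep_eq supp_def not_less)

lemma of_mat_msum:
  assumes "finite I" "\<And>i. i \<in> I \<Longrightarrow> f i \<in> carrier_mat r c"
  shows "of_mat (msum r c f I) = (\<Sum>i\<in>I. of_mat (f i))"
proof (rule fmat_eqI)
  fix j k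
  have "msum r c f I \<in> carrier_mat r c" using assms(2) by (rule msum_closed)
  moreover have "dim_row (f i) = r" "dim_col (f i) = c" if "i \<in> I" for i using assms(2)[OF that] by auto
  ultimately show "ent (of_mat (msum r c f I)) j k = ent (\<Sum>i\<in>I. of_mat (f i)) j k"
    using msum_index[OF assms, where j = j and k = k] by (auto simp: ent_sum of_mat.rep_eq intro!: sum.cong)
qed

lemma delta_scal_carrier: "delta_scal n \<alpha> \<gamma> s \<in> carrier_mat (n \<alpha>) (n \<gamma>)"
  by (auto simp: delta_scal_def delta_mat_def)

lemma of_mat_delta_scal: "of_mat (delta_scal n \<alpha> \<gamma> s) = (of_bool (\<alpha> = \<gamma>) * s) *\<^sub>C idm (n \<alpha>)"
  by (auto simp: delta_scal_def delta_mat_def of_mat_smult of_mat_one of_mat_zero)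

lemma delta_mat_carrier: "X \<in> carrier_mat (n \<alpha>) (n \<alpha>) \<Longrightarrow> delta_mat n \<alpha> \<gamma> X \<in> carrier_mat (n \<alpha>) (n \<gamma>)"
  by (auto simp: delta_mat_def)

lemma of_mat_delta_mat: "of_mat (delta_mat n \<alpha> \<gamma> (s \<cdot>\<^sub>m X)) = (of_bool (\<alpha> = \<gamma>) * s) *\<^sub>C of_mat X"
  by (auto simp: delta_mat_def of_mat_smult of_mat_zero)

lemma lin_indpt_family_of_mat:
  assumes ind: "lin_indpt_family r c f I" and finite_I: "finite I"
    and f: "\<And>i. i \<in> I \<Longrightarrow> f i \<in> carrier_mat r c" and u: "(\<Sum>i\<in>I. u i *\<^sub>C of_mat (f i)) = 0"
  shows "\<forall>i\<in>I. u i = 0"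
proof (rule ccontr)
  assume "\<not> (\<forall>i\<in>I. u i = 0)"
  then obtain i where i: "i \<in> I" "u i \<noteq> 0" by blast
  let ?V = "module_mat TYPE(complex) r c"
  interpret vectorspace class_ring ?V by (rule matrix_vs)
  have inj: "inj_on f I" and indep: "\<not> lin_dep (f ` I)" using ind by (auto simp: lin_indpt_family_def)
  \<comment> \<open>The library takes coefficients attached to members of a set. Injectivity of the
    family makes the passage from indices to members well defined.\<close>
  define v where "v X = u (the_inv_into I f X)" for X
  have v: "v (f j) = u j" if "j \<in> I" for j
    using that inj by (simp add: v_def the_inv_into_f_f)
  have 1: "lincomb v (f ` I) = msum r c (\<lambda>X. v X \<cdot>\<^sub>m X) (f ` I)"
    by (simp add: lincomb_def msum_def module_mat_simps)
  have carr: "v X \<cdot>\<^sub>m X \<in> carrier_mat r c" if "X \<in> f ` I" for X using that f by auto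
  have "of_mat (msum r c (\<lambda>X. v X \<cdot>\<^sub>m X) (f ` I)) = (\<Sum>X\<in>f ` I. v X *\<^sub>C of_mat X)"
    using finite_I carr by (subst of_mat_msum) (auto simp: of_mat_smult)
  also have "\<dots> = (\<Sum>i\<in>I. u i *\<^sub>C of_mat (f i))"
    unfolding sum.reindex[OF inj] by (rule sum.cong) (auto simp: v)
  finally have "of_mat (msum r c (\<lambda>X. v X \<cdot>\<^sub>m X) (f ` I)) = of_mat (0\<^sub>m r c)"
    using u by (simp add: of_mat_zero)
  then have "msum r c (\<lambda>X. v X \<cdot>\<^sub>m X) (f ` I) = 0\<^sub>m r c"
    by (rule of_mat_inject[rotated 2]) (auto intro!: msum_closed carr)
  with 1 have "lincomb v (f ` I) = \<zero>\<^bsub>?V\<^esub>" by (simp add: module_mat_simps)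
  then have "lin_dep (f ` I)"
    unfolding lin_dep_def using finite_I i v[OF i(1)]
    by (intro exI[of _ "f ` I"] exI[of _ v] exI[of _ "f i"]) (auto simp: class_ring_simps)
  with indep show False by contradiction
qed

section \<open>The given operator on matrices as an operator on padded matrices\<close>

locale matrix_block_operator =
  fixes m :: nat and n :: "nat \<Rightarrow> nat" and p :: "nat \<Rightarrow> nat \<Rightarrow> nat"
    and a b :: "nat \<Rightarrow> nat \<Rightarrow> nat \<Rightarrow> complex mat" and c :: "nat \<Rightarrow> complex mat"
  assumes a_dim: "\<And>\<alpha> \<beta> i. \<alpha> \<in> {1..m} \<Longrightarrow> \<beta> \<in> {1..m} \<Longrightarrow> i \<in> {1..p \<alpha> \<beta>} \<Longrightarrow>
        a i \<beta> \<alpha> \<in> carrier_mat (n \<beta>) (n \<alpha>)"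
    and b_dim: "\<And>\<alpha> \<beta> i. \<alpha> \<in> {1..m} \<Longrightarrow> \<beta> \<in> {1..m} \<Longrightarrow> i \<in> {1..p \<alpha> \<beta>} \<Longrightarrow>
        b i \<alpha> \<beta> \<in> carrier_mat (n \<alpha>) (n \<beta>)"
    and c_dim: "\<And>\<alpha>. \<alpha> \<in> {1..m} \<Longrightarrow> c \<alpha> \<in> carrier_mat (n \<alpha>) (n \<alpha>)"
    and n_gt_0: "\<And>\<alpha>. \<alpha> \<in> {1..m} \<Longrightarrow> 0 < n \<alpha>"
begin

text \<open>The given families start at index 1, which leaves 0 free for the pair c, 1. Index 0 is
  summed over on diagonal blocks only.\<close>

definition "A i \<beta> \<alpha> = of_mat (if i = 0 then c \<beta> else a i \<beta> \<alpha>)"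
definition "B i \<alpha> \<beta> = of_mat (if i = 0 then 1\<^sub>m (n \<alpha>) else b i \<alpha> \<beta>)"

sublocale block_operator m n "\<lambda>\<alpha> \<gamma>. if \<alpha> = \<gamma> then {0..p \<alpha> \<gamma>} else {1..p \<alpha> \<gamma>}" A B
  using n_gt_0 by unfold_locales (auto simp: A_def B_def split: if_splits
      intro!: supp_of_mat a_dim b_dim c_dim one_carrier_mat)

abbreviation "R \<equiv> R_op m n p a b c"

definition represents :: "(nat \<Rightarrow> complex mat) \<Rightarrow> (nat \<Rightarrow> fmat) \<Rightarrow> bool" where
  "represents X x \<longleftrightarrow> (\<forall>\<alpha>\<in>{1..m}. X \<alpha> \<in> carrier_mat (n \<alpha>) (n \<alpha>) \<and> of_mat (X \<alpha>) = x \<alpha>)"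

lemma R_comp_block:
  assumes I: "\<alpha> \<in> {1..m}" "\<beta> \<in> {1..m}" and X: "X \<in> carrier_mat (n \<alpha>) (n \<alpha>)"
  shows "R_comp n p a b c \<beta> \<alpha> X \<in> carrier_mat (n \<beta>) (n \<beta>)" (is ?C)
    and "of_mat (R_comp n p a b c \<beta> \<alpha> X) = block \<beta> \<alpha> (of_mat X)" (is ?E)
proof -
  have car: "a i \<beta> \<alpha> * X * b i \<alpha> \<beta> \<in> carrier_mat (n \<beta>) (n \<beta>)" if "i \<in> {1..p \<alpha> \<beta>}" for i
    using a_dim[OF I that] b_dim[OF I that] X by auto
  have emb: "of_mat (a i \<beta> \<alpha> * X * b i \<alpha> \<beta>) = A i \<beta> \<alpha> * of_mat X * B i \<alpha> \<beta>" if "i \<in> {1..p \<alpha> \<beta>}" for i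
    using of_mat_times[OF mult_carrier_mat[OF a_dim[OF I that] X] b_dim[OF I that]]
      of_mat_times[OF a_dim[OF I that] X] that
    by (simp add: A_def B_def)
  have sum: "msum (n \<beta>) (n \<beta>) (\<lambda>i. a i \<beta> \<alpha> * X * b i \<alpha> \<beta>) {1..p \<alpha> \<beta>} \<in> carrier_mat (n \<beta>) (n \<beta>)"
    "of_mat (msum (n \<beta>) (n \<beta>) (\<lambda>i. a i \<beta> \<alpha> * X * b i \<alpha> \<beta>) {1..p \<alpha> \<beta>}) =
      (\<Sum>i=1..p \<alpha> \<beta>. A i \<beta> \<alpha> * of_mat X * B i \<alpha> \<beta>)"
    by (rule msum_closed, rule car, assumption,
        subst of_mat_msum[OF finite_atLeastAtMost car], assumption, rule sum.cong[OF refl emb])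
  have c: "c \<alpha> * X \<in> carrier_mat (n \<alpha>) (n \<alpha>)" "of_mat (c \<alpha> * X) = A 0 \<alpha> \<alpha> * of_mat X * B 0 \<alpha> \<alpha>"
    using c_dim[OF I(1)] X
    by (auto simp: A_def B_def of_mat_times[of _ "n \<alpha>" "n \<alpha>" _ "n \<alpha>"] of_mat_one
        supp_times_idm[OF supp_of_mat] mult.assoc)
  show ?C using sum(1) c(1) by (auto simp: R_comp_def)
  show ?E
  proof (cases "\<alpha> = \<beta>")
    case True
    with sum c show ?thesis
      by (simp add: R_comp_def block_def of_mat_add[of _ "n \<beta>" "n \<beta>"] sum.atLeast_Suc_atMost[of 0] add.commute)
  qed (use sum in \<open>simp add: R_comp_def block_def\<close>)
qed

lemma represents_R:
  assumes "represents X x"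
  shows "represents (R X) (block_op x)"
  unfolding represents_def
proof (intro ballI conjI)
  fix \<beta> assume \<beta>: "\<beta> \<in> {1..m}"
  have *: "R_comp n p a b c \<beta> \<alpha> (X \<alpha>) \<in> carrier_mat (n \<beta>) (n \<beta>)"
    "of_mat (R_comp n p a b c \<beta> \<alpha> (X \<alpha>)) = block \<beta> \<alpha> (x \<alpha>)" if "\<alpha> \<in> {1..m}" for \<alpha>
    using R_comp_block[OF that \<beta>, of "X \<alpha>"] assms that by (auto simp: represents_def)
  show "R X \<beta> \<in> carrier_mat (n \<beta>) (n \<beta>)"
    using \<beta> * by (auto simp: R_op_def intro!: msum_closed)
  have "R X \<beta> = msum (n \<beta>) (n \<beta>) (\<lambda>\<alpha>. R_comp n p a b c \<beta> \<alpha> (X \<alpha>)) {1..m}"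
    using \<beta> by (simp add: R_op_def)
  then have "of_mat (R X \<beta>) = (\<Sum>\<alpha>=1..m. of_mat (R_comp n p a b c \<beta> \<alpha> (X \<alpha>)))"
    using of_mat_msum[OF finite_atLeastAtMost *(1)] by simp
  with * show "of_mat (R X \<beta>) = block_op x \<beta>" by (simp add: block_op_def)
qed

lemma represents_circ:
  assumes X: "represents X x" and Y: "represents Y y"
  shows "represents (circ m R X Y) (circ_prod x y)"
proof -
  have "represents (dtimes m X Y) (\<lambda>\<delta>. x \<delta> * y \<delta>)"
    unfolding represents_def
  proof
    fix \<alpha> assume \<alpha>: "\<alpha> \<in> {1..m}"
    then have car: "X \<alpha> \<in> carrier_mat (n \<alpha>) (n \<alpha>)" "Y \<alpha> \<in> carrier_mat (n \<alpha>) (n \<alpha>)"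
      using X Y by (auto simp: represents_def)
    show "dtimes m X Y \<alpha> \<in> carrier_mat (n \<alpha>) (n \<alpha>) \<and> of_mat (dtimes m X Y \<alpha>) = x \<alpha> * y \<alpha>"
      using of_mat_times[OF car] mult_carrier_mat[OF car] X Y \<alpha> by (auto simp: represents_def dtimes_def)
  qed
  then have XY: "represents (R (dtimes m X Y)) (block_op (\<lambda>\<delta>. x \<delta> * y \<delta>))" by (rule represents_R)
  note RX = represents_R[OF X] and RY = represents_R[OF Y]
  show ?thesis
    unfolding represents_def
  proof (intro ballI)
    fix \<gamma> assume \<gamma>: "\<gamma> \<in> {1..m}"
    have car: "X \<gamma> \<in> carrier_mat (n \<gamma>) (n \<gamma>)" "Y \<gamma> \<in> carrier_mat (n \<gamma>) (n \<gamma>)" "R X \<gamma> \<in> carrier_mat (n \<gamma>) (n \<gamma>)"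
      "R Y \<gamma> \<in> carrier_mat (n \<gamma>) (n \<gamma>)" "R (dtimes m X Y) \<gamma> \<in> carrier_mat (n \<gamma>) (n \<gamma>)"
      and emb: "of_mat (X \<gamma>) = x \<gamma>" "of_mat (Y \<gamma>) = y \<gamma>" "of_mat (R X \<gamma>) = block_op x \<gamma>" "of_mat (R Y \<gamma>) = block_op y \<gamma>"
      "of_mat (R (dtimes m X Y) \<gamma>) = block_op (\<lambda>\<delta>. x \<delta> * y \<delta>) \<gamma>"
      using X Y RX RY XY \<gamma> by (auto simp: represents_def)
    have circ: "circ m R X Y \<gamma> = R X \<gamma> * Y \<gamma> + X \<gamma> * R Y \<gamma> - R (dtimes m X Y) \<gamma>"
      using \<gamma> by (simp add: circ_def dminus_def dplus_def dtimes_def)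
    have car': "R X \<gamma> * Y \<gamma> \<in> carrier_mat (n \<gamma>) (n \<gamma>)" "X \<gamma> * R Y \<gamma> \<in> carrier_mat (n \<gamma>) (n \<gamma>)"
      using car by auto
    have "of_mat (circ m R X Y \<gamma>) = circ_prod x y \<gamma>"
      unfolding circ circ_prod_def of_mat_minus[OF add_carrier_mat[OF car'(2)] car(5)] of_mat_add[OF car'] 
        of_mat_times[OF car(3,2)] of_mat_times[OF car(1,4)] emb ..
    then show "circ m R X Y \<gamma> \<in> carrier_mat (n \<gamma>) (n \<gamma>) \<and> of_mat (circ m R X Y \<gamma>) = circ_prod x y \<gamma>"
      using car' car unfolding circ by auto
  qed
qed

lemma blockwise_represented:
  assumes "blockwise x"
  shows "\<exists>X\<in>dsum m n. represents X x"
proof -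
  have "\<forall>\<alpha>\<in>{1..m}. \<exists>X. X \<in> carrier_mat (n \<alpha>) (n \<alpha>) \<and> of_mat X = x \<alpha>"
    using assms of_mat_surj unfolding blockwise_def by blast
  then obtain X where "\<forall>\<alpha>\<in>{1..m}. X \<alpha> \<in> carrier_mat (n \<alpha>) (n \<alpha>) \<and> of_mat (X \<alpha>) = x \<alpha>"
    by metis
  then show ?thesis
    by (intro bexI[of _ "restrict X {1..m}"]) (auto simp: represents_def dsum_def)
qed

text \<open>Every blockwise family of padded matrices is represented by an element of M, and the
  product respects representation, so associativity carries over.\<close>

lemma associative_if:
  assumes assoc: "\<And>x y z. x \<in> dsum m n \<Longrightarrow> y \<in> dsum m n \<Longrightarrow> z \<in> dsum m n \<Longrightarrow>
        circ m R (circ m R x y) z = circ m R x (circ m R y z)"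
  shows "unital_block_operator m n p A B"
proof unfold_locales
  fix x y z \<gamma> assume *: "blockwise x" "blockwise y" "blockwise z" and \<gamma>: "\<gamma> \<in> {1..m}"
  obtain X Y Z where D: "X \<in> dsum m n" "Y \<in> dsum m n" "Z \<in> dsum m n"
    and rep: "represents X x" "represents Y y" "represents Z z"
    using *[THEN blockwise_represented] by blast
  have "circ_prod (circ_prod x y) z \<gamma> = of_mat (circ m R (circ m R X Y) Z \<gamma>)"
    using represents_circ[OF represents_circ[OF rep(1,2)] rep(3)] \<gamma> by (simp add: represents_def)
  also have "\<dots> = of_mat (circ m R X (circ m R Y Z) \<gamma>)" using assoc[OF D] by simp
  also have "\<dots> = circ_prod x (circ_prod y z) \<gamma>"
    using represents_circ[OF rep(1) represents_circ[OF rep(2,3)]] \<gamma> by (simp add: represents_def)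
  finally show "circ_prod (circ_prod x y) z \<gamma> = circ_prod x (circ_prod y z) \<gamma>" .
qed (auto simp: B_def of_mat_one)

end

section \<open>Coordinate functionals for the given matrices\<close>

lemma dual_family:
  assumes "\<And>u. (\<Sum>i\<in>I. u i *\<^sub>C x i) = 0 \<Longrightarrow> \<forall>i\<in>I. u i = 0" "finite I"
  shows "\<exists>F. \<forall>i\<in>I. lin_form (F i) \<and> (\<forall>j\<in>I. F i (x j) = of_bool (i = j))"
  by (intro bchoice ballI dual_functional assms)

text \<open>\<open>N'\<close> and \<open>K'\<close> are block labels while \<open>N\<close> and
  \<open>K\<close> are sizes. The distinction matters because two different blocks may have the same
  size, and then 1 does not belong to the family.\<close>

lemma dual_family_idm:
  fixes q :: nat
  assumes car: "\<And>i. i \<in> {1..q} \<Longrightarrow> x i \<in> carrier_mat N K"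
    and ind: "if N' = (K' :: nat) then K = N \<and> lin_indpt_family N N (\<lambda>i. if i = 0 then 1\<^sub>m N else x i) {0..q}
      else lin_indpt_family N K x {1..q}"
  shows "\<exists>F. \<forall>i\<in>{1..q}. lin_form (F i) \<and> (\<forall>j\<in>{1..q}. F i (of_mat (x j)) = of_bool (i = j)) \<and> (N' = K' \<longrightarrow> F i (idm N) = 0)"
proof (cases "N' = K'")
  case True
  let ?x = "\<lambda>i. if i = 0 then 1\<^sub>m N else x i"
  have "\<exists>F. \<forall>i\<in>{0..q}. lin_form (F i) \<and> (\<forall>j\<in>{0..q}. F i (of_mat (?x j)) = of_bool (i = j))"
    using ind car True by (intro dual_family lin_indpt_family_of_mat[where f = ?x]) auto
  then obtain F where F: "\<forall>i\<in>{0..q}. lin_form (F i) \<and> (\<forall>j\<in>{0..q}. F i (of_mat (?x j)) = of_bool (i = j))" by blast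
  have *: "F i (of_mat (?x j)) = of_bool (i = j)" if "i \<in> {0..q}" "j \<in> {0..q}" for i j using F that by blast
  have "F i (of_mat (1\<^sub>m N)) = 0" if "i \<in> {1..q}" for i using *[of i 0] that by simp
  moreover have "F i (of_mat (x j)) = of_bool (i = j)" if "i \<in> {1..q}" "j \<in> {1..q}" for i j
    using *[of i j] that by simp
  ultimately show ?thesis
    using F by (intro exI[of _ F]) (auto simp: of_mat_one)
next
  case False
  have "\<exists>F. \<forall>i\<in>{1..q}. lin_form (F i) \<and> (\<forall>j\<in>{1..q}. F i (of_mat (x j)) = of_bool (i = j))"
    using ind car False by (intro dual_family lin_indpt_family_of_mat[where f = x]) auto
  with False show ?thesis by auto
qed

lemma dual_idm:
  fixes q :: nat
  assumes car: "\<And>i. i \<in> {1..q} \<Longrightarrow> x i \<in> carrier_mat N N"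
    and ind: "lin_indpt_family N N (\<lambda>i. if i = 0 then 1\<^sub>m N else x i) {0..q}"
  shows "\<exists>F. lin_form F \<and> F (idm N) = 1 \<and> (\<forall>j\<in>{1..q}. F (of_mat (x j)) = 0)"
proof -
  let ?x = "\<lambda>i. if i = 0 then 1\<^sub>m N else x i"
  have "\<exists>F. \<forall>i\<in>{0..q}. lin_form (F i) \<and> (\<forall>j\<in>{0..q}. F i (of_mat (?x j)) = of_bool (i = j))"
    using ind car by (intro dual_family lin_indpt_family_of_mat[where f = ?x]) auto
  then obtain F where F: "\<forall>i\<in>{0..q}. lin_form (F i) \<and> (\<forall>j\<in>{0..q}. F i (of_mat (?x j)) = of_bool (i = j))" by blast
  have *: "F 0 (of_mat (?x j)) = of_bool (0 = j)" if "j \<in> {0..q}" for j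
    using F that by (metis atLeastAtMost_iff zero_le)
  have "F 0 (of_mat (x j)) = 0" if "j \<in> {1..q}" for j using *[of j] that by simp
  moreover have "F 0 (idm N) = 1" using *[of 0] by (simp add: of_mat_one)
  ultimately show ?thesis
    using F by (intro exI[of _ "F 0"]) simp
qed

theorem theorem3p1:
  fixes m :: nat
    and n :: "nat \<Rightarrow> nat"
    and p :: "nat \<Rightarrow> nat \<Rightarrow> nat"
    and a :: "nat \<Rightarrow> nat \<Rightarrow> nat \<Rightarrow> complex mat"
    and b :: "nat \<Rightarrow> nat \<Rightarrow> nat \<Rightarrow> complex mat"
    and c :: "nat \<Rightarrow> complex mat"
  defines "R \<equiv> R_op m n p a b c"
  assumes a_dim: "\<And>\<alpha> \<beta> i. \<alpha> \<in> {1..m} \<Longrightarrow> \<beta> \<in> {1..m} \<Longrightarrow> i \<in> {1..p \<alpha> \<beta>} \<Longrightarrow>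
        a i \<beta> \<alpha> \<in> carrier_mat (n \<beta>) (n \<alpha>)"
    and b_dim: "\<And>\<alpha> \<beta> i. \<alpha> \<in> {1..m} \<Longrightarrow> \<beta> \<in> {1..m} \<Longrightarrow> i \<in> {1..p \<alpha> \<beta>} \<Longrightarrow>
        b i \<alpha> \<beta> \<in> carrier_mat (n \<alpha>) (n \<beta>)"
    and c_dim: "\<And>\<alpha>. \<alpha> \<in> {1..m} \<Longrightarrow> c \<alpha> \<in> carrier_mat (n \<alpha>) (n \<alpha>)"
    and a_indep: "\<And>\<alpha> \<beta>. \<alpha> \<in> {1..m} \<Longrightarrow> \<beta> \<in> {1..m} \<Longrightarrow> \<alpha> \<noteq> \<beta> \<Longrightarrow>
        lin_indpt_family (n \<beta>) (n \<alpha>) (\<lambda>i. a i \<beta> \<alpha>) {1..p \<alpha> \<beta>}"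
    and b_indep: "\<And>\<alpha> \<beta>. \<alpha> \<in> {1..m} \<Longrightarrow> \<beta> \<in> {1..m} \<Longrightarrow> \<alpha> \<noteq> \<beta> \<Longrightarrow>
        lin_indpt_family (n \<alpha>) (n \<beta>) (\<lambda>i. b i \<alpha> \<beta>) {1..p \<alpha> \<beta>}"
    and a_diag_indep: "\<And>\<alpha>. \<alpha> \<in> {1..m} \<Longrightarrow>
        lin_indpt_family (n \<alpha>) (n \<alpha>) (\<lambda>i. if i = 0 then 1\<^sub>m (n \<alpha>) else a i \<alpha> \<alpha>) {0..p \<alpha> \<alpha>}"
    and b_diag_indep: "\<And>\<alpha>. \<alpha> \<in> {1..m} \<Longrightarrow>
        lin_indpt_family (n \<alpha>) (n \<alpha>) (\<lambda>i. if i = 0 then 1\<^sub>m (n \<alpha>) else b i \<alpha> \<alpha>) {0..p \<alpha> \<alpha>}"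
    and assoc: "\<And>x y z. x \<in> dsum m n \<Longrightarrow> y \<in> dsum m n \<Longrightarrow> z \<in> dsum m n \<Longrightarrow>
        circ m R (circ m R x y) z = circ m R x (circ m R y z)"
  shows "\<exists>(\<phi> :: nat \<Rightarrow> nat \<Rightarrow> nat \<Rightarrow> nat \<Rightarrow> nat \<Rightarrow> nat \<Rightarrow> complex)
          (\<mu> :: nat \<Rightarrow> nat \<Rightarrow> nat \<Rightarrow> nat \<Rightarrow> complex)
          (\<psi> :: nat \<Rightarrow> nat \<Rightarrow> nat \<Rightarrow> nat \<Rightarrow> nat \<Rightarrow> nat \<Rightarrow> complex)
          (lam :: nat \<Rightarrow> nat \<Rightarrow> nat \<Rightarrow> nat \<Rightarrow> complex)
          (t :: nat \<Rightarrow> nat \<Rightarrow> nat \<Rightarrow> nat \<Rightarrow> complex).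
    (\<forall>\<alpha>\<in>{1..m}. \<forall>\<beta>\<in>{1..m}. \<forall>\<gamma>\<in>{1..m}. \<forall>i\<in>{1..p \<beta> \<alpha>}. \<forall>j\<in>{1..p \<gamma> \<beta>}.
        a i \<alpha> \<beta> * a j \<beta> \<gamma> =
          msum (n \<alpha>) (n \<gamma>) (\<lambda>k. \<phi> k i j \<alpha> \<beta> \<gamma> \<cdot>\<^sub>m a k \<alpha> \<gamma>) {1..p \<gamma> \<alpha>}
          + delta_scal n \<alpha> \<gamma> (\<mu> i j \<alpha> \<beta>)) \<and>
    (\<forall>\<alpha>\<in>{1..m}. \<forall>\<beta>\<in>{1..m}. \<forall>\<gamma>\<in>{1..m}. \<forall>i\<in>{1..p \<alpha> \<beta>}. \<forall>j\<in>{1..p \<beta> \<gamma>}.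
        b i \<alpha> \<beta> * b j \<beta> \<gamma> =
          msum (n \<alpha>) (n \<gamma>) (\<lambda>k. \<psi> i j k \<alpha> \<beta> \<gamma> \<cdot>\<^sub>m b k \<alpha> \<gamma>) {1..p \<alpha> \<gamma>}
          + delta_scal n \<alpha> \<gamma> (lam i j \<alpha> \<beta>)) \<and>
    (\<forall>\<alpha>\<in>{1..m}. \<forall>\<beta>\<in>{1..m}. \<forall>\<gamma>\<in>{1..m}. \<forall>i\<in>{1..p \<alpha> \<beta>}. \<forall>j\<in>{1..p \<gamma> \<beta>}.
        b i \<alpha> \<beta> * a j \<beta> \<gamma> =
          msum (n \<alpha>) (n \<gamma>) (\<lambda>k. \<phi> i j k \<beta> \<gamma> \<alpha> \<cdot>\<^sub>m b k \<alpha> \<gamma>) {1..p \<alpha> \<gamma>}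
          + msum (n \<alpha>) (n \<gamma>) (\<lambda>k. \<psi> k i j \<gamma> \<alpha> \<beta> \<cdot>\<^sub>m a k \<alpha> \<gamma>) {1..p \<gamma> \<alpha>}
          + delta_scal n \<alpha> \<gamma> (t i j \<alpha> \<beta>)
          + delta_mat n \<alpha> \<gamma> (of_bool (i = j) \<cdot>\<^sub>m c \<alpha>)) \<and>
    (\<forall>\<alpha>\<in>{1..m}. \<forall>\<beta>\<in>{1..m}. \<forall>i\<in>{1..p \<beta> \<alpha>}.
        c \<alpha> * a i \<alpha> \<beta> =
          msum (n \<alpha>) (n \<beta>) (\<lambda>k. \<mu> i k \<alpha> \<beta> \<cdot>\<^sub>m b k \<alpha> \<beta>) {1..p \<alpha> \<beta>}
          - msum (n \<alpha>) (n \<beta>) (\<lambda>k. t k i \<beta> \<alpha> \<cdot>\<^sub>m a k \<alpha> \<beta>) {1..p \<beta> \<alpha>}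
          - msum (n \<alpha>) (n \<beta>)
              (\<lambda>k. (\<Sum>\<nu>=1..m. \<Sum>l=1..p \<nu> \<alpha>. \<Sum>s=1..p \<beta> \<nu>. \<phi> k l s \<alpha> \<nu> \<beta> * \<psi> s l i \<beta> \<nu> \<alpha>)
                    \<cdot>\<^sub>m a k \<alpha> \<beta>) {1..p \<beta> \<alpha>}
          - delta_scal n \<alpha> \<beta>
              (\<Sum>\<nu>=1..m. \<Sum>l=1..p \<nu> \<alpha>. \<Sum>s=1..p \<alpha> \<nu>. \<mu> l s \<alpha> \<nu> * \<psi> s l i \<alpha> \<nu> \<alpha>)) \<and>
    (\<forall>\<alpha>\<in>{1..m}. \<forall>\<beta>\<in>{1..m}. \<forall>i\<in>{1..p \<alpha> \<beta>}.
        b i \<alpha> \<beta> * c \<beta> =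
          msum (n \<alpha>) (n \<beta>) (\<lambda>k. lam k i \<beta> \<alpha> \<cdot>\<^sub>m a k \<alpha> \<beta>) {1..p \<beta> \<alpha>}
          - msum (n \<alpha>) (n \<beta>) (\<lambda>k. t i k \<alpha> \<beta> \<cdot>\<^sub>m b k \<alpha> \<beta>) {1..p \<alpha> \<beta>}
          - msum (n \<alpha>) (n \<beta>)
              (\<lambda>k. (\<Sum>\<nu>=1..m. \<Sum>l=1..p \<nu> \<beta>. \<Sum>s=1..p \<alpha> \<nu>. \<phi> i l s \<beta> \<nu> \<alpha> * \<psi> s l k \<alpha> \<nu> \<beta>)
                    \<cdot>\<^sub>m b k \<alpha> \<beta>) {1..p \<alpha> \<beta>}
          - delta_scal n \<alpha> \<beta>
              (\<Sum>\<nu>=1..m. \<Sum>l=1..p \<alpha> \<nu>. \<Sum>s=1..p \<nu> \<alpha>. \<phi> i s l \<alpha> \<nu> \<alpha> * lam l s \<alpha> \<nu>)) \<and>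
    (\<forall>\<alpha>\<in>{1..m}. \<forall>\<beta>\<in>{1..m}. \<forall>\<gamma>\<in>{1..m}. \<forall>\<delta>\<in>{1..m}.
      \<forall>i\<in>{1..p \<delta> \<alpha>}. \<forall>j\<in>{1..p \<beta> \<alpha>}. \<forall>k\<in>{1..p \<gamma> \<beta>}. \<forall>l\<in>{1..p \<delta> \<gamma>}.
        (\<Sum>s=1..p \<gamma> \<alpha>. \<phi> s j k \<alpha> \<beta> \<gamma> * \<phi> i s l \<alpha> \<gamma> \<delta>)
          + of_bool (i = l) * of_bool (\<alpha> = \<gamma>) * \<mu> j k \<alpha> \<beta> =
        (\<Sum>s=1..p \<delta> \<beta>. \<phi> i j s \<alpha> \<beta> \<delta> * \<phi> s k l \<beta> \<gamma> \<delta>)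
          + of_bool (i = j) * of_bool (\<beta> = \<delta>) * \<mu> k l \<beta> \<gamma>) \<and>
    (\<forall>\<alpha>\<in>{1..m}. \<forall>\<beta>\<in>{1..m}. \<forall>\<gamma>\<in>{1..m}.
      \<forall>i\<in>{1..p \<beta> \<alpha>}. \<forall>j\<in>{1..p \<gamma> \<beta>}. \<forall>k\<in>{1..p \<alpha> \<gamma>}.
        (\<Sum>s=1..p \<alpha> \<beta>. \<phi> s j k \<beta> \<gamma> \<alpha> * \<mu> i s \<alpha> \<beta>) =
        (\<Sum>s=1..p \<gamma> \<alpha>. \<phi> s i j \<alpha> \<beta> \<gamma> * \<mu> s k \<alpha> \<gamma>)) \<and>
    (\<forall>\<alpha>\<in>{1..m}. \<forall>\<beta>\<in>{1..m}. \<forall>\<gamma>\<in>{1..m}. \<forall>\<delta>\<in>{1..m}.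
      \<forall>i\<in>{1..p \<alpha> \<beta>}. \<forall>j\<in>{1..p \<beta> \<gamma>}. \<forall>k\<in>{1..p \<gamma> \<delta>}. \<forall>l\<in>{1..p \<alpha> \<delta>}.
        (\<Sum>s=1..p \<alpha> \<gamma>. \<psi> i j s \<alpha> \<beta> \<gamma> * \<psi> s k l \<alpha> \<gamma> \<delta>)
          + of_bool (k = l) * of_bool (\<alpha> = \<gamma>) * lam i j \<alpha> \<beta> =
        (\<Sum>s=1..p \<beta> \<delta>. \<psi> j k s \<beta> \<gamma> \<delta> * \<psi> i s l \<alpha> \<beta> \<delta>)
          + of_bool (i = l) * of_bool (\<beta> = \<delta>) * lam j k \<beta> \<gamma>) \<and>
    (\<forall>\<alpha>\<in>{1..m}. \<forall>\<beta>\<in>{1..m}. \<forall>\<gamma>\<in>{1..m}.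
      \<forall>i\<in>{1..p \<alpha> \<beta>}. \<forall>j\<in>{1..p \<beta> \<gamma>}. \<forall>k\<in>{1..p \<gamma> \<alpha>}.
        (\<Sum>s=1..p \<alpha> \<gamma>. \<psi> i j s \<alpha> \<beta> \<gamma> * lam s k \<alpha> \<gamma>) =
        (\<Sum>s=1..p \<beta> \<alpha>. \<psi> j k s \<beta> \<gamma> \<alpha> * lam i s \<alpha> \<beta>)) \<and>
    (\<forall>\<alpha>\<in>{1..m}. \<forall>\<beta>\<in>{1..m}. \<forall>\<gamma>\<in>{1..m}. \<forall>\<delta>\<in>{1..m}.
      \<forall>i\<in>{1..p \<alpha> \<beta>}. \<forall>j\<in>{1..p \<gamma> \<beta>}. \<forall>k\<in>{1..p \<delta> \<gamma>}. \<forall>l\<in>{1..p \<delta> \<alpha>}.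
        (\<Sum>s=1..p \<delta> \<beta>. \<phi> s j k \<beta> \<gamma> \<delta> * \<psi> l i s \<delta> \<alpha> \<beta>) =
        (\<Sum>s=1..p \<gamma> \<alpha>. \<phi> l s k \<alpha> \<gamma> \<delta> * \<psi> s i j \<gamma> \<alpha> \<beta>)
          + (\<Sum>s=1..p \<alpha> \<gamma>. \<phi> i j s \<beta> \<gamma> \<alpha> * \<psi> l s k \<delta> \<alpha> \<gamma>)
          + of_bool (l = k) * of_bool (\<alpha> = \<gamma>) * t i j \<alpha> \<beta>
          - of_bool (i = j) * of_bool (\<alpha> = \<gamma>) * t l k \<delta> \<alpha>
          - of_bool (i = j) * of_bool (\<alpha> = \<gamma>) *
              (\<Sum>\<nu>=1..m. \<Sum>s=1..p \<nu> \<alpha>. \<Sum>r=1..p \<delta> \<nu>. \<phi> l s r \<alpha> \<nu> \<delta> * \<psi> r s k \<delta> \<nu> \<alpha>)) \<and>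
    (\<forall>\<alpha>\<in>{1..m}. \<forall>\<beta>\<in>{1..m}. \<forall>\<gamma>\<in>{1..m}.
      \<forall>i\<in>{1..p \<alpha> \<beta>}. \<forall>j\<in>{1..p \<gamma> \<beta>}. \<forall>k\<in>{1..p \<alpha> \<gamma>}.
        (\<Sum>s=1..p \<alpha> \<beta>. \<phi> s j k \<beta> \<gamma> \<alpha> * t i s \<alpha> \<beta>) =
        (\<Sum>s=1..p \<gamma> \<alpha>. \<psi> s i j \<gamma> \<alpha> \<beta> * \<mu> s k \<alpha> \<gamma>)
          + (\<Sum>s=1..p \<alpha> \<gamma>. \<phi> i j s \<beta> \<gamma> \<alpha> * t s k \<alpha> \<gamma>)
          - of_bool (i = j) * of_bool (\<alpha> = \<gamma>) *
              (\<Sum>\<nu>=1..m. \<Sum>s=1..p \<alpha> \<nu>. \<Sum>r=1..p \<nu> \<alpha>. \<psi> s r k \<alpha> \<nu> \<alpha> * \<mu> r s \<alpha> \<nu>)) \<and>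
    (\<forall>\<alpha>\<in>{1..m}. \<forall>\<beta>\<in>{1..m}. \<forall>\<gamma>\<in>{1..m}.
      \<forall>i\<in>{1..p \<beta> \<gamma>}. \<forall>j\<in>{1..p \<alpha> \<gamma>}. \<forall>k\<in>{1..p \<alpha> \<beta>}.
        (\<Sum>s=1..p \<alpha> \<gamma>. \<psi> k i s \<alpha> \<beta> \<gamma> * t s j \<alpha> \<gamma>) =
        (\<Sum>s=1..p \<beta> \<alpha>. \<phi> i j s \<gamma> \<alpha> \<beta> * lam k s \<alpha> \<beta>)
          + (\<Sum>s=1..p \<alpha> \<beta>. \<psi> s i j \<alpha> \<beta> \<gamma> * t k s \<alpha> \<beta>)
          - of_bool (i = j) * of_bool (\<alpha> = \<beta>) *
              (\<Sum>\<nu>=1..m. \<Sum>s=1..p \<nu> \<alpha>. \<Sum>r=1..p \<alpha> \<nu>. \<phi> k s r \<alpha> \<nu> \<alpha> * lam r s \<alpha> \<nu>))"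
proof -
  \<comment> \<open>The identity is a member of an independent family, hence nonzero, so no block
    has size 0.\<close>
  have n_pos: "0 < n \<alpha>" if \<alpha>: "\<alpha> \<in> {1..m}" for \<alpha>
  proof (rule ccontr)
    assume "\<not> 0 < n \<alpha>"
    then have "idm (n \<alpha>) = 0" by (auto intro!: fmat_eqI simp: idm.rep_eq ent_simps)
    moreover obtain F where "lin_form F" "F (idm (n \<alpha>)) = 1"
      using dual_idm[OF a_dim[OF \<alpha> \<alpha>] a_diag_indep[OF \<alpha>]] by blast
    ultimately show False using lin_form_simps(4)[of F] by simp
  qed
  interpret M: matrix_block_operator m n p a b c
    by unfold_locales (fact a_dim b_dim c_dim n_pos)+
  interpret U: unital_block_operator m n p M.A M.B
    by (rule M.associative_if) (fact assoc[unfolded R_def])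
  have A: "M.A i \<beta> \<alpha> = of_mat (a i \<beta> \<alpha>)" and B: "M.B i \<beta> \<alpha> = of_mat (b i \<beta> \<alpha>)" if "i \<in> {1..k}" for i \<beta> \<alpha> k
    using that by (auto simp: M.A_def M.B_def)
  have A0: "M.A 0 \<alpha> \<alpha> = of_mat (c \<alpha>)" for \<alpha> by (simp add: M.A_def)
  have "\<forall>\<beta>\<in>{1..m}. \<forall>\<alpha>\<in>{1..m}. \<exists>F. \<forall>i\<in>{1..p \<alpha> \<beta>}. lin_form (F i) \<and>
      (\<forall>j\<in>{1..p \<alpha> \<beta>}. F i (of_mat (a j \<beta> \<alpha>)) = of_bool (i = j)) \<and> (\<beta> = \<alpha> \<longrightarrow> F i (idm (n \<beta>)) = 0)"
    using a_dim a_indep a_diag_indep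
    by (intro ballI dual_family_idm) (auto simp del: atLeastAtMost_iff)
  then obtain as where as: "\<forall>\<beta>\<in>{1..m}. \<forall>\<alpha>\<in>{1..m}. \<forall>i\<in>{1..p \<alpha> \<beta>}. lin_form (as \<beta> \<alpha> i) \<and>
      (\<forall>j\<in>{1..p \<alpha> \<beta>}. as \<beta> \<alpha> i (of_mat (a j \<beta> \<alpha>)) = of_bool (i = j)) \<and> (\<beta> = \<alpha> \<longrightarrow> as \<beta> \<alpha> i (idm (n \<beta>)) = 0)"
    by metis
  have "\<forall>\<alpha>\<in>{1..m}. \<forall>\<beta>\<in>{1..m}. \<exists>F. \<forall>i\<in>{1..p \<alpha> \<beta>}. lin_form (F i) \<and>
      (\<forall>j\<in>{1..p \<alpha> \<beta>}. F i (of_mat (b j \<alpha> \<beta>)) = of_bool (i = j)) \<and> (\<alpha> = \<beta> \<longrightarrow> F i (idm (n \<alpha>)) = 0)"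
    using b_dim b_indep b_diag_indep
    by (intro ballI dual_family_idm) (auto simp del: atLeastAtMost_iff)
  then obtain bs where bs: "\<forall>\<alpha>\<in>{1..m}. \<forall>\<beta>\<in>{1..m}. \<forall>i\<in>{1..p \<alpha> \<beta>}. lin_form (bs \<alpha> \<beta> i) \<and>
      (\<forall>j\<in>{1..p \<alpha> \<beta>}. bs \<alpha> \<beta> i (of_mat (b j \<alpha> \<beta>)) = of_bool (i = j)) \<and> (\<alpha> = \<beta> \<longrightarrow> bs \<alpha> \<beta> i (idm (n \<alpha>)) = 0)"
    by metis
  have "\<forall>\<alpha>\<in>{1..m}. \<exists>F. lin_form F \<and> F (idm (n \<alpha>)) = 1 \<and> (\<forall>j\<in>{1..p \<alpha> \<alpha>}. F (of_mat (a j \<alpha> \<alpha>)) = 0)"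
    using a_dim a_diag_indep by (intro ballI dual_idm)
  then obtain ae where ae: "\<forall>\<alpha>\<in>{1..m}. lin_form (ae \<alpha>) \<and> ae \<alpha> (idm (n \<alpha>)) = 1 \<and>
      (\<forall>j\<in>{1..p \<alpha> \<alpha>}. ae \<alpha> (of_mat (a j \<alpha> \<alpha>)) = 0)"
    by metis
  have "\<forall>\<alpha>\<in>{1..m}. \<exists>F. lin_form F \<and> F (idm (n \<alpha>)) = 1 \<and> (\<forall>j\<in>{1..p \<alpha> \<alpha>}. F (of_mat (b j \<alpha> \<alpha>)) = 0)"
    using b_dim b_diag_indep by (intro ballI dual_idm)
  then obtain be where be: "\<forall>\<alpha>\<in>{1..m}. lin_form (be \<alpha>) \<and> be \<alpha> (idm (n \<alpha>)) = 1 \<and>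
      (\<forall>j\<in>{1..p \<alpha> \<alpha>}. be \<alpha> (of_mat (b j \<alpha> \<alpha>)) = 0)"
    by metis
  have as_lin_form: "lin_form (as \<beta> \<alpha> i)" and bs_lin_form: "lin_form (bs \<alpha> \<beta> i)"
    if "\<alpha> \<in> {1..m}" "\<beta> \<in> {1..m}" "i \<in> {1..p \<alpha> \<beta>}" for \<alpha> \<beta> i
    using as bs that by blast+
  have as_A: "as \<beta> \<alpha> i (M.A j \<beta> \<alpha>) = of_bool (i = j)" and bs_B: "bs \<alpha> \<beta> i (M.B j \<alpha> \<beta>) = of_bool (i = j)"
    if "\<alpha> \<in> {1..m}" "\<beta> \<in> {1..m}" "i \<in> {1..p \<alpha> \<beta>}" "j \<in> {1..p \<alpha> \<beta>}" for \<alpha> \<beta> i j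
    unfolding A[OF that(4)] B[OF that(4)] using as bs that by blast+
  have as_idm: "as \<alpha> \<alpha> i (idm (n \<alpha>)) = 0" and bs_idm: "bs \<alpha> \<alpha> i (idm (n \<alpha>)) = 0"
    if "\<alpha> \<in> {1..m}" "i \<in> {1..p \<alpha> \<alpha>}" for \<alpha> i
    using as bs that by blast+
  have ae_lin_form: "lin_form (ae \<alpha>)" and be_lin_form: "lin_form (be \<alpha>)" and ae_idm: "ae \<alpha> (idm (n \<alpha>)) = 1"
    and be_idm: "be \<alpha> (idm (n \<alpha>)) = 1" if "\<alpha> \<in> {1..m}" for \<alpha>
    using ae be that by blast+
  have ae_A: "ae \<alpha> (M.A i \<alpha> \<alpha>) = 0" and be_B: "be \<alpha> (M.B i \<alpha> \<alpha>) = 0"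
    if "\<alpha> \<in> {1..m}" "i \<in> {1..p \<alpha> \<alpha>}" for \<alpha> i
    unfolding A[OF that(2)] B[OF that(2)] using ae be that by blast+
  \<comment> \<open>The role of S is taken by the form of the primitive of the torsion, that of c by
    the left factor with index 0.\<close>
  interpret T: tensor_data m p M.A M.B "\<lambda>\<alpha>. M.A 0 \<alpha> \<alpha>" "\<lambda>\<alpha>. idm (n \<alpha>)" as bs ae be U.primitive_form
    by (rule tensor_data.intro)
      (rule U.idm_times_A U.A_times_idm U.idm_times_B U.B_times_idm as_lin_form as_A as_idm bs_lin_form bs_B bs_idm
        ae_lin_form ae_A ae_idm be_lin_form be_B be_idm U.torsion; assumption)+
  have Ma: "msum (n \<beta>) (n \<alpha>) (\<lambda>k. u k \<cdot>\<^sub>m a k \<beta> \<alpha>) {1..p \<alpha> \<beta>} \<in> carrier_mat (n \<beta>) (n \<alpha>)"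
    and La: "of_mat (msum (n \<beta>) (n \<alpha>) (\<lambda>k. u k \<cdot>\<^sub>m a k \<beta> \<alpha>) {1..p \<alpha> \<beta>}) = (\<Sum>k=1..p \<alpha> \<beta>. u k *\<^sub>C M.A k \<beta> \<alpha>)"
    if "\<alpha> \<in> {1..m}" "\<beta> \<in> {1..m}" for \<alpha> \<beta> u
  proof -
    have car: "u k \<cdot>\<^sub>m a k \<beta> \<alpha> \<in> carrier_mat (n \<beta>) (n \<alpha>)" if "k \<in> {1..p \<alpha> \<beta>}" for k
      by (rule smult_carrier_mat[OF a_dim]) fact+
    show "msum (n \<beta>) (n \<alpha>) (\<lambda>k. u k \<cdot>\<^sub>m a k \<beta> \<alpha>) {1..p \<alpha> \<beta>} \<in> carrier_mat (n \<beta>) (n \<alpha>)"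
      by (rule msum_closed, rule car)
    show "of_mat (msum (n \<beta>) (n \<alpha>) (\<lambda>k. u k \<cdot>\<^sub>m a k \<beta> \<alpha>) {1..p \<alpha> \<beta>}) = (\<Sum>k=1..p \<alpha> \<beta>. u k *\<^sub>C M.A k \<beta> \<alpha>)"
      by (subst of_mat_msum[OF finite_atLeastAtMost car], assumption) (auto simp: of_mat_smult A intro!: sum.cong)
  qed
  have Mb: "msum (n \<alpha>) (n \<beta>) (\<lambda>k. u k \<cdot>\<^sub>m b k \<alpha> \<beta>) {1..p \<alpha> \<beta>} \<in> carrier_mat (n \<alpha>) (n \<beta>)"
    and Lb: "of_mat (msum (n \<alpha>) (n \<beta>) (\<lambda>k. u k \<cdot>\<^sub>m b k \<alpha> \<beta>) {1..p \<alpha> \<beta>}) = (\<Sum>k=1..p \<alpha> \<beta>. u k *\<^sub>C M.B k \<alpha> \<beta>)"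
    if "\<alpha> \<in> {1..m}" "\<beta> \<in> {1..m}" for \<alpha> \<beta> u
  proof -
    have car: "u k \<cdot>\<^sub>m b k \<alpha> \<beta> \<in> carrier_mat (n \<alpha>) (n \<beta>)" if "k \<in> {1..p \<alpha> \<beta>}" for k
      by (rule smult_carrier_mat[OF b_dim]) fact+
    show "msum (n \<alpha>) (n \<beta>) (\<lambda>k. u k \<cdot>\<^sub>m b k \<alpha> \<beta>) {1..p \<alpha> \<beta>} \<in> carrier_mat (n \<alpha>) (n \<beta>)"
      by (rule msum_closed, rule car)
    show "of_mat (msum (n \<alpha>) (n \<beta>) (\<lambda>k. u k \<cdot>\<^sub>m b k \<alpha> \<beta>) {1..p \<alpha> \<beta>}) = (\<Sum>k=1..p \<alpha> \<beta>. u k *\<^sub>C M.B k \<alpha> \<beta>)"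
      by (subst of_mat_msum[OF finite_atLeastAtMost car], assumption) (auto simp: of_mat_smult B intro!: sum.cong)
  qed
  \<comment> \<open>This identity and the four matrix identities after it are obtained by padding
    both sides, which have equal sizes, and applying the expansion of padded matrices.\<close>
  have aa: "a i \<alpha> \<beta> * a j \<beta> \<gamma> =
          msum (n \<alpha>) (n \<gamma>) (\<lambda>k. T.\<phi> k i j \<alpha> \<beta> \<gamma> \<cdot>\<^sub>m a k \<alpha> \<gamma>) {1..p \<gamma> \<alpha>}
          + delta_scal n \<alpha> \<gamma> (T.\<mu> i j \<alpha> \<beta>)"
    if I: "\<alpha> \<in> {1..m}" "\<beta> \<in> {1..m}" "\<gamma> \<in> {1..m}" and i: "i \<in> {1..p \<beta> \<alpha>}" and j: "j \<in> {1..p \<gamma> \<beta>}" for \<alpha> \<beta> \<gamma> i j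
  proof (rule of_mat_inject)
    note M1 = Ma[OF I(3,1)] and L1 = La[OF I(3,1)]
    note D = delta_scal_carrier[of n \<alpha> \<gamma>]
    show "a i \<alpha> \<beta> * a j \<beta> \<gamma> \<in> carrier_mat (n \<alpha>) (n \<gamma>)"
      by (rule mult_carrier_mat[OF a_dim[OF I(2,1) i] a_dim[OF I(3,2) j]])
    show "msum (n \<alpha>) (n \<gamma>) (\<lambda>k. T.\<phi> k i j \<alpha> \<beta> \<gamma> \<cdot>\<^sub>m a k \<alpha> \<gamma>) {1..p \<gamma> \<alpha>}
          + delta_scal n \<alpha> \<gamma> (T.\<mu> i j \<alpha> \<beta>) \<in> carrier_mat (n \<alpha>) (n \<gamma>)"
      by (rule add_carrier_mat[OF D])
    show "of_mat (a i \<alpha> \<beta> * a j \<beta> \<gamma>) = of_mat (msum (n \<alpha>) (n \<gamma>) (\<lambda>k. T.\<phi> k i j \<alpha> \<beta> \<gamma> \<cdot>\<^sub>m a k \<alpha> \<gamma>) {1..p \<gamma> \<alpha>}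
          + delta_scal n \<alpha> \<gamma> (T.\<mu> i j \<alpha> \<beta>))"
      unfolding of_mat_times[OF a_dim[OF I(2,1) i] a_dim[OF I(3,2) j]] of_mat_add[OF M1 D] L1 of_mat_delta_scal
      using T.a_times_a[OF I i j] unfolding A[OF i] A[OF j] .
  qed
  have bb: "b i \<alpha> \<beta> * b j \<beta> \<gamma> =
          msum (n \<alpha>) (n \<gamma>) (\<lambda>k. T.\<psi> i j k \<alpha> \<beta> \<gamma> \<cdot>\<^sub>m b k \<alpha> \<gamma>) {1..p \<alpha> \<gamma>}
          + delta_scal n \<alpha> \<gamma> (T.lam i j \<alpha> \<beta>)"
    if I: "\<alpha> \<in> {1..m}" "\<beta> \<in> {1..m}" "\<gamma> \<in> {1..m}" and i: "i \<in> {1..p \<alpha> \<beta>}" and j: "j \<in> {1..p \<beta> \<gamma>}" for \<alpha> \<beta> \<gamma> i j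
  proof (rule of_mat_inject)
    note M1 = Mb[OF I(1,3)] and L1 = Lb[OF I(1,3)]
    note D = delta_scal_carrier[of n \<alpha> \<gamma>]
    show "b i \<alpha> \<beta> * b j \<beta> \<gamma> \<in> carrier_mat (n \<alpha>) (n \<gamma>)"
      by (rule mult_carrier_mat[OF b_dim[OF I(1,2) i] b_dim[OF I(2,3) j]])
    show "msum (n \<alpha>) (n \<gamma>) (\<lambda>k. T.\<psi> i j k \<alpha> \<beta> \<gamma> \<cdot>\<^sub>m b k \<alpha> \<gamma>) {1..p \<alpha> \<gamma>}
          + delta_scal n \<alpha> \<gamma> (T.lam i j \<alpha> \<beta>) \<in> carrier_mat (n \<alpha>) (n \<gamma>)"
      by (rule add_carrier_mat[OF D])
    show "of_mat (b i \<alpha> \<beta> * b j \<beta> \<gamma>) = of_mat (msum (n \<alpha>) (n \<gamma>) (\<lambda>k. T.\<psi> i j k \<alpha> \<beta> \<gamma> \<cdot>\<^sub>m b k \<alpha> \<gamma>) {1..p \<alpha> \<gamma>}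
          + delta_scal n \<alpha> \<gamma> (T.lam i j \<alpha> \<beta>))"
      unfolding of_mat_times[OF b_dim[OF I(1,2) i] b_dim[OF I(2,3) j]] of_mat_add[OF M1 D] L1 of_mat_delta_scal
      using T.b_times_b[OF I i j] unfolding B[OF i] B[OF j] .
  qed
  have ba: "b i \<alpha> \<beta> * a j \<beta> \<gamma> =
          msum (n \<alpha>) (n \<gamma>) (\<lambda>k. T.\<phi> i j k \<beta> \<gamma> \<alpha> \<cdot>\<^sub>m b k \<alpha> \<gamma>) {1..p \<alpha> \<gamma>}
          + msum (n \<alpha>) (n \<gamma>) (\<lambda>k. T.\<psi> k i j \<gamma> \<alpha> \<beta> \<cdot>\<^sub>m a k \<alpha> \<gamma>) {1..p \<gamma> \<alpha>}
          + delta_scal n \<alpha> \<gamma> (T.t i j \<alpha> \<beta>)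
          + delta_mat n \<alpha> \<gamma> (of_bool (i = j) \<cdot>\<^sub>m c \<alpha>)" (is "_ = ?rhs")
    if I: "\<alpha> \<in> {1..m}" "\<beta> \<in> {1..m}" "\<gamma> \<in> {1..m}" and i: "i \<in> {1..p \<alpha> \<beta>}" and j: "j \<in> {1..p \<gamma> \<beta>}" for \<alpha> \<beta> \<gamma> i j
  proof (rule of_mat_inject)
    note M1 = Mb[OF I(1,3)] and L1 = Lb[OF I(1,3)]
    note M2 = Ma[OF I(3,1)] and L2 = La[OF I(3,1)]
    note D = delta_scal_carrier[of n \<alpha> \<gamma>]
    have E: "delta_mat n \<alpha> \<gamma> (u \<cdot>\<^sub>m c \<alpha>) \<in> carrier_mat (n \<alpha>) (n \<gamma>)" for u
      by (rule delta_mat_carrier, rule smult_carrier_mat, rule c_dim[OF I(1)])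
    show "b i \<alpha> \<beta> * a j \<beta> \<gamma> \<in> carrier_mat (n \<alpha>) (n \<gamma>)"
      by (rule mult_carrier_mat[OF b_dim[OF I(1,2) i] a_dim[OF I(3,2) j]])
    show "?rhs \<in> carrier_mat (n \<alpha>) (n \<gamma>)"
      by (rule add_carrier_mat[OF E])
    show "of_mat (b i \<alpha> \<beta> * a j \<beta> \<gamma>) = of_mat ?rhs"
      unfolding of_mat_times[OF b_dim[OF I(1,2) i] a_dim[OF I(3,2) j]] of_mat_add[OF add_carrier_mat[OF D] E]
        of_mat_add[OF add_carrier_mat[OF M2] D] of_mat_add[OF M1 M2] L1 L2 of_mat_delta_scal of_mat_delta_mat
      using T.b_times_a[OF I i j] unfolding B[OF i] A[OF j] A0 .
  qed
  have ca: "c \<alpha> * a i \<alpha> \<beta> =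
          msum (n \<alpha>) (n \<beta>) (\<lambda>k. T.\<mu> i k \<alpha> \<beta> \<cdot>\<^sub>m b k \<alpha> \<beta>) {1..p \<alpha> \<beta>}
          - msum (n \<alpha>) (n \<beta>) (\<lambda>k. T.t k i \<beta> \<alpha> \<cdot>\<^sub>m a k \<alpha> \<beta>) {1..p \<beta> \<alpha>}
          - msum (n \<alpha>) (n \<beta>)
              (\<lambda>k. (\<Sum>\<nu>=1..m. \<Sum>l=1..p \<nu> \<alpha>. \<Sum>s=1..p \<beta> \<nu>. T.\<phi> k l s \<alpha> \<nu> \<beta> * T.\<psi> s l i \<beta> \<nu> \<alpha>)
                    \<cdot>\<^sub>m a k \<alpha> \<beta>) {1..p \<beta> \<alpha>}
          - delta_scal n \<alpha> \<beta>
              (\<Sum>\<nu>=1..m. \<Sum>l=1..p \<nu> \<alpha>. \<Sum>s=1..p \<alpha> \<nu>. T.\<mu> l s \<alpha> \<nu> * T.\<psi> s l i \<alpha> \<nu> \<alpha>)" (is "_ = ?rhs")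
    if I: "\<alpha> \<in> {1..m}" "\<beta> \<in> {1..m}" and i: "i \<in> {1..p \<beta> \<alpha>}" for \<alpha> \<beta> i
  proof (rule of_mat_inject)
    note M1 = Mb[OF I] and L1 = Lb[OF I]
    note M2 = Ma[OF I(2,1)] and L2 = La[OF I(2,1)]
    note D = delta_scal_carrier[of n \<alpha> \<beta>]
    show "c \<alpha> * a i \<alpha> \<beta> \<in> carrier_mat (n \<alpha>) (n \<beta>)"
      by (rule mult_carrier_mat[OF c_dim[OF I(1)] a_dim[OF I(2,1) i]])
    show "?rhs \<in> carrier_mat (n \<alpha>) (n \<beta>)"
      by (rule minus_carrier_mat[OF D])
    show "of_mat (c \<alpha> * a i \<alpha> \<beta>) = of_mat ?rhs"
      unfolding of_mat_times[OF c_dim[OF I(1)] a_dim[OF I(2,1) i]] of_mat_minus[OF minus_carrier_mat[OF M2] D]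
        of_mat_minus[OF minus_carrier_mat[OF M2] M2] of_mat_minus[OF M1 M2] L1 L2 of_mat_delta_scal
      using T.c_times_a[OF I i] unfolding A[OF i] A0 .
  qed
  have bc: "b i \<alpha> \<beta> * c \<beta> =
          msum (n \<alpha>) (n \<beta>) (\<lambda>k. T.lam k i \<beta> \<alpha> \<cdot>\<^sub>m a k \<alpha> \<beta>) {1..p \<beta> \<alpha>}
          - msum (n \<alpha>) (n \<beta>) (\<lambda>k. T.t i k \<alpha> \<beta> \<cdot>\<^sub>m b k \<alpha> \<beta>) {1..p \<alpha> \<beta>}
          - msum (n \<alpha>) (n \<beta>)
              (\<lambda>k. (\<Sum>\<nu>=1..m. \<Sum>l=1..p \<nu> \<beta>. \<Sum>s=1..p \<alpha> \<nu>. T.\<phi> i l s \<beta> \<nu> \<alpha> * T.\<psi> s l k \<alpha> \<nu> \<beta>)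
                    \<cdot>\<^sub>m b k \<alpha> \<beta>) {1..p \<alpha> \<beta>}
          - delta_scal n \<alpha> \<beta>
              (\<Sum>\<nu>=1..m. \<Sum>l=1..p \<alpha> \<nu>. \<Sum>s=1..p \<nu> \<alpha>. T.\<phi> i s l \<alpha> \<nu> \<alpha> * T.lam l s \<alpha> \<nu>)" (is "_ = ?rhs")
    if I: "\<alpha> \<in> {1..m}" "\<beta> \<in> {1..m}" and i: "i \<in> {1..p \<alpha> \<beta>}" for \<alpha> \<beta> i
  proof (rule of_mat_inject)
    note M1 = Mb[OF I] and L1 = Lb[OF I]
    note M2 = Ma[OF I(2,1)] and L2 = La[OF I(2,1)]
    note D = delta_scal_carrier[of n \<alpha> \<beta>]
    show "b i \<alpha> \<beta> * c \<beta> \<in> carrier_mat (n \<alpha>) (n \<beta>)"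
      by (rule mult_carrier_mat[OF b_dim[OF I i] c_dim[OF I(2)]])
    show "?rhs \<in> carrier_mat (n \<alpha>) (n \<beta>)"
      by (rule minus_carrier_mat[OF D])
    show "of_mat (b i \<alpha> \<beta> * c \<beta>) = of_mat ?rhs"
      unfolding of_mat_times[OF b_dim[OF I i] c_dim[OF I(2)]] of_mat_minus[OF minus_carrier_mat[OF M1] D]
        of_mat_minus[OF minus_carrier_mat[OF M1] M1] of_mat_minus[OF M2 M1] L1 L2 of_mat_delta_scal
      using T.b_times_c[OF I i] unfolding B[OF i] A0 .
  qed
  show ?thesis
    by (rule exI[of _ T.\<phi>], rule exI[of _ T.\<mu>], rule exI[of _ T.\<psi>], rule exI[of _ T.lam], rule exI[of _ T.t],
        intro conjI ballI)
      (rule aa bb ba ca bc T.\<phi>_assoc T.\<phi>_\<mu>_assoc T.\<psi>_assoc T.\<psi>_lam_assoc T.\<phi>_\<psi>_assoc T.\<phi>_t_assoc T.\<psi>_t_assoc; assumption)+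
qed

end
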